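(* (Ergodic capacity of P2.) Suppose that each destination terminal $\mathcal{D}_m$ ($1\le m\le M$) has perfect knowledge of the mean of the effective channel gain of its link, namely of the deterministic number $\frac{\pi}{4\sqrt{KM}}\sum_{k=1}^{K}C^{m,m}_{\mathrm{P2},k}$. Then, for any $\epsilon,\delta>0$ there exist $M_0,K_0>0$ such that for all $M\ge M_0$, $K\ge K_0$, the per source-destination terminal pair capacity $C_{\mathrm{P2}}$ achieved by P2 satisfies $$\frac12\log\left(1+\frac{\pi^{2}}{16}\frac{\underline{C}^{2}}{\overline{C}^{2}_{\mathrm{SN}}}\frac{K}{M^2}(1-\epsilon)\right)\le C_{\mathrm{P2}}\le\frac12\log\left(1+\frac{\pi^2}{16}\frac{\overline{C}^{2}}{\underline{C}^{2}_{\mathrm{SN}}}\,\frac{\max\left[K,M^{1+\delta}\right]}{M^2}(1+\epsilon)\right).$$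
   Context: $\log$ is to base 2. Fix constants $0<\underline{E}\le\overline{E}<\infty$, $0<\underline{P}\le\overline{P}<\infty$, $P_{\mathrm{rel}}>0$, $\sigma^2>0$ (independent of $M,K$). For every $M$ and $K$ a network with $M$ source-destination pairs and $K$ relays is given, with deterministic coefficients $E_{k,m}\in[\underline{E},\overline{E}]$, $P_{m,k}\in[\underline{P},\overline{P}]$ ($1\le k\le K$, $1\le m\le M$). The channel gains $h_{k,m}$ (source $m$ to relay $k$) and $f_{m,k}$ (relay $k$ to destination $m$) are jointly independent $\mathcal{CN}(0,1)$, and ergodic over time. Put $\tilde h_{k,m}=\exp(j\arg h_{k,m})$, $\tilde f_{m,k}=\exp(j\arg f_{m,k})$. Protocol P2: let $$d_{\mathrm{P2},k}=\sqrt{P_{\mathrm{rel}}}\Big[K\sum_{m=1}^M E_{k,m}+MK\sigma^2\Big]^{-1/2},\quad C^{m,\hat m}_{\mathrm{P2},k}=\sqrt{KM}\,d_{\mathrm{P2},k}\sqrt{P_{m,k}E_{k,\hat m}},\quad C^{m}_{\mathrm{P2},k}=\sqrt{KM}\,d_{\mathrm{P2},k}\sqrt{P_{m,k}},$$ $$a_k^{m,\hat m,\tilde m}=C^{m,\hat m}_{\mathrm{P2},k}\,\tilde f^{*}_{\tilde m,k}\,f_{m,k}\,\tilde h^{*}_{k,\tilde m}\,h_{k,\hat m},\qquad b_k^{m,\tilde m}=C^{m}_{\mathrm{P2},k}\,\tilde f^{*}_{\tilde m,k}\,f_{m,k}\,\tilde h^{*}_{k,\tilde m}.$$ Destination $\mathcal{D}_m$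 receives $$y_m=s_m\frac{1}{\sqrt{KM}}\sum_{k=1}^K\sum_{\tilde m=1}^M a_k^{m,m,\tilde m}+\sum_{\hat m\ne m}s_{\hat m}\frac1{\sqrt{KM}}\sum_{k=1}^K\sum_{\tilde m=1}^M a_k^{m,\hat m,\tilde m}+\frac1{\sqrt{KM}}\sum_{k=1}^K\sum_{\tilde m=1}^M b_k^{m,\tilde m} z_k+w_m,$$ where the source signals $s_m\sim\mathcal{CN}(0,1/M)$ and the noise variables $z_k,w_m\sim\mathcal{CN}(0,\sigma^2)$ are jointly independent, independent of the channel gains, and i.i.d. over time. The destinations do not cooperate, and the only channel knowledge assumed at $\mathcal{D}_m$ is the deterministic mean gain named in the claim. The per source-destination terminal pair capacity achieved (induced) by P2, for pair $m$, is $C_{\mathrm{P2}}=\frac12 I(y_m;s_m)$, the factor $\frac12$ accounting for the use of two time slots (two-hop half-duplex relaying); the bounds hold for each $m\in\{1,\dots,M\}$. Constants: $\underline{C}=\sqrt{\underline{P}\,\underline{E}P_{\mathrm{rel}}/(\overline{E}+\sigma^2)}$, $\overline{C}=\sqrt{\overline{P}\,\overline{E}P_{\mathrm{rel}}/(\underline{E}+\sigma^2)}$, $\underline{c}=\sqrt{\underline{P}P_{\mathrm{rel}}/(\overline{E}+\sigma^2)}$, $\overline{c}=\sqrt{\overline{P}P_{\mathrm{rel}}/(\underline{E}+\sigma^2)}$, $\overline{C}_{\mathrm{SN}}=\sqrt{\overline{C}^2+\sigma^2(\overline{c}^2+1)}$, $\underline{C}_{\mathrm{SN}}=\sqrt{\underline{C}^2+\sigma^2(\underline{c}^2+1)}$.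 *)

theory Defs
  imports "HOL-Probability.Probability"
begin

text \<open>
  \<open>X\<close> is circularly symmetric complex Gaussian \<open>CN(0, v)\<close>, \<open>v > 0\<close>: the real and imaginary
  parts are independent real Gaussians with mean \<open>0\<close> and variance \<open>v / 2\<close> each. Lebesgue
  measure on the complex numbers is that of the plane, so the joint density is the product below.
\<close>
definition complex_gaussian :: "'a measure \<Rightarrow> real \<Rightarrow> ('a \<Rightarrow> complex) \<Rightarrow> bool" where
  "complex_gaussian \<Omega> v X \<longleftrightarrow>
     distributed \<Omega> lborel X
       (\<lambda>x. ennreal (normal_density 0 (sqrt (v / 2)) (Re x) * normal_density 0 (sqrt (v / 2)) (Im x)))"

text \<open>The phase factor \<open>exp (j arg x)\<close>. At \<open>x = 0\<close>, an event of probability zero for the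
  channel gains, its value is \<open>1\<close> because \<open>Arg 0 = 0\<close>.\<close>
definition phase :: "complex \<Rightarrow> complex" where
  "phase x = cis (Arg x)"

text \<open>Names for all elementary random variables of the network, so that their joint independence
  can be stated for a single indexed family.\<close>
datatype rv_index =
    Source_Relay_Gain nat nat
  | Relay_Dest_Gain nat nat
  | Source_Signal nat
  | Relay_Noise nat
  | Dest_Noise nat

definition rv_indices :: "nat \<Rightarrow> nat \<Rightarrow> rv_index set" where
  "rv_indices M K =
     {Source_Relay_Gain k m | k m. k \<in> {1..K} \<and> m \<in> {1..M}} \<union>
     {Relay_Dest_Gain m k | m k. m \<in> {1..M} \<and> k \<in> {1..K}} \<union>
     Source_Signal ` {1..M} \<union> Relay_Noise ` {1..K} \<union> Dest_Noise ` {1..M}"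

text \<open>
  A network with \<open>M\<close> source-destination pairs and \<open>K\<close> relays. The energy coefficients \<open>E k m\<close> and
  \<open>P m k\<close> lie in \<open>[Elo, Ehi]\<close> and \<open>[Plo, Phi]\<close>, and \<open>\<sigma>2\<close> is the noise variance
  (written \<open>\<sigma>\<^sup>2\<close> on paper). All random variables are those of one fixed channel use; its law
  alone determines the single-letter mutual information below.
\<close>
locale relay_network = prob_space \<Omega>
  for \<Omega> :: "'a measure" +
  fixes M K :: nat
    and Elo Ehi Plo Phi Prel \<sigma>2 :: real
    and E P :: "nat \<Rightarrow> nat \<Rightarrow> real"
    and h f :: "nat \<Rightarrow> nat \<Rightarrow> 'a \<Rightarrow> complex"
    and s z w :: "nat \<Rightarrow> 'a \<Rightarrow> complex"
  assumes E_bounds: "\<And>k m. k \<in> {1..K} \<Longrightarrow> m \<in> {1..M} \<Longrightarrow> E k m \<in> {Elo..Ehi}"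
    and P_bounds: "\<And>m k. m \<in> {1..M} \<Longrightarrow> k \<in> {1..K} \<Longrightarrow> P m k \<in> {Plo..Phi}"
    and h_gaussian: "\<And>k m. k \<in> {1..K} \<Longrightarrow> m \<in> {1..M} \<Longrightarrow> complex_gaussian \<Omega> 1 (h k m)"
    and f_gaussian: "\<And>m k. m \<in> {1..M} \<Longrightarrow> k \<in> {1..K} \<Longrightarrow> complex_gaussian \<Omega> 1 (f m k)"
    and s_gaussian: "\<And>m. m \<in> {1..M} \<Longrightarrow> complex_gaussian \<Omega> (1 / real M) (s m)"
    and z_gaussian: "\<And>k. k \<in> {1..K} \<Longrightarrow> complex_gaussian \<Omega> \<sigma>2 (z k)"
    and w_gaussian: "\<And>m. m \<in> {1..M} \<Longrightarrow> complex_gaussian \<Omega> \<sigma>2 (w m)"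
    and independent:
      "indep_vars (\<lambda>_. borel)
         (\<lambda>i. case i of
            Source_Relay_Gain k m \<Rightarrow> h k m
          | Relay_Dest_Gain m k \<Rightarrow> f m k
          | Source_Signal m \<Rightarrow> s m
          | Relay_Noise k \<Rightarrow> z k
          | Dest_Noise m \<Rightarrow> w m)
         (rv_indices M K)"
begin

definition d_P2 :: "nat \<Rightarrow> real" where
  "d_P2 k = sqrt Prel * (real K * (\<Sum>m = 1..M. E k m) + real M * real K * \<sigma>2) powr (- 1 / 2)"

text \<open>\<open>C_sig m m' k\<close> is \<open>C\<close> with superscripts \<open>m, m'\<close> and \<open>C_noise m k\<close> is \<open>C\<close> with the single
  superscript \<open>m\<close>.\<close>
definition C_sig :: "nat \<Rightarrow> nat \<Rightarrow> nat \<Rightarrow> real" where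
  "C_sig m m' k = sqrt (real K * real M) * d_P2 k * sqrt (P m k * E k m')"

definition C_noise :: "nat \<Rightarrow> nat \<Rightarrow> real" where
  "C_noise m k = sqrt (real K * real M) * d_P2 k * sqrt (P m k)"

text \<open>\<open>m'\<close> is the interfering source (\<open>m\<close> with a hat), \<open>n\<close> the pair whose phases relay \<open>k\<close>
  corrects (\<open>m\<close> with a tilde).\<close>
definition a_coeff :: "nat \<Rightarrow> nat \<Rightarrow> nat \<Rightarrow> nat \<Rightarrow> 'a \<Rightarrow> complex" where
  "a_coeff m m' n k \<omega> =
     complex_of_real (C_sig m m' k) * cnj (phase (f n k \<omega>)) * f m k \<omega> * cnj (phase (h k n \<omega>)) * h k m' \<omega>"

definition b_coeff :: "nat \<Rightarrow> nat \<Rightarrow> nat \<Rightarrow> 'a \<Rightarrow> complex" where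
  "b_coeff m n k \<omega> =
     complex_of_real (C_noise m k) * cnj (phase (f n k \<omega>)) * f m k \<omega> * cnj (phase (h k n \<omega>))"

definition received :: "nat \<Rightarrow> 'a \<Rightarrow> complex" where
  "received m \<omega> =
     s m \<omega> * (1 / complex_of_real (sqrt (real K * real M))) *
       (\<Sum>k = 1..K. \<Sum>n = 1..M. a_coeff m m n k \<omega>) +
     (\<Sum>m' \<in> {1..M} - {m}. s m' \<omega> * (1 / complex_of_real (sqrt (real K * real M))) *
       (\<Sum>k = 1..K. \<Sum>n = 1..M. a_coeff m m' n k \<omega>)) +
     (1 / complex_of_real (sqrt (real K * real M))) *
       (\<Sum>k = 1..K. \<Sum>n = 1..M. b_coeff m n k \<omega> * z k \<omega>) +
     w m \<omega>"

text \<open>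
  Half of the mutual information, in bits, between the observation of destination \<open>m\<close> and the
  signal of source \<open>m\<close>. The destination knows
  \<open>pi / (4 * sqrt (K * M)) * (\<Sum>k = 1..K. C_sig m m k)\<close>, the mean of its effective channel gain.
  This number is deterministic, so knowing it neither adds an observed random variable nor
  conditions the law of \<open>(received m, s m)\<close>. In particular no channel realisation is observed.
\<close>
definition C_P2 :: "nat \<Rightarrow> real" where
  "C_P2 m = 1 / 2 * mutual_information 2 borel borel (received m) (s m)"

end

text \<open>Called with \<open>(Plo, Elo, Ehi)\<close> the next constant is the underlined \<open>C\<close>, with
  \<open>(Phi, Ehi, Elo)\<close> the overlined one; in the same way \<open>const_c\<close> is called with \<open>(Plo, Ehi)\<close> and
  \<open>(Phi, Elo)\<close>. So \<open>E'\<close> is the energy bound in the denominator.\<close>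
definition const_C :: "real \<Rightarrow> real \<Rightarrow> real \<Rightarrow> real \<Rightarrow> real \<Rightarrow> real" where
  "const_C P E E' Prel \<sigma>2 = sqrt (P * E * Prel / (E' + \<sigma>2))"

definition const_c :: "real \<Rightarrow> real \<Rightarrow> real \<Rightarrow> real \<Rightarrow> real" where
  "const_c P E' Prel \<sigma>2 = sqrt (P * Prel / (E' + \<sigma>2))"

definition const_C_SN :: "real \<Rightarrow> real \<Rightarrow> real \<Rightarrow> real \<Rightarrow> real \<Rightarrow> real" where
  "const_C_SN P E E' Prel \<sigma>2 =
     sqrt ((const_C P E E' Prel \<sigma>2)\<^sup>2 + \<sigma>2 * ((const_c P E' Prel \<sigma>2)\<^sup>2 + 1))"

end

(* A destination that is told the channel gains faces a Gaussian channel, so the mutual information is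
   at most the mean of log (1 + SINR) by Gibbs' inequality; a destination that treats the deviation of
   the gain from its mean as noise achieves log (1 + signal / (noise + deviation)), again by Gibbs.
   What remains are second moments. The signal and interference terms are monomials in independent
   symmetric gains and their phases, and flipping the sign of one gain shows that distinct monomials are
   orthogonal. This gives the variance of the effective gain, and it shows that the interference power
   D deviates from its mean by O(1 / sqrt K + 1 / sqrt M) in L1. Since D is at least the noise variance,
   the mean of 1 / D is then close to the inverse of the mean of D. The variance of the effective gain
   contributes O(1 / M) to the SINR, which the factor M powr delta absorbs; in the lower bound all
   error terms have the right sign, so that it holds for all M and K. *)
theory Submission
  imports Defs
begin

section \<open>Circularly symmetric complex Gaussian measures\<close>

text \<open>The upper bound needs only the mean of \<open>|G|^2 / D\<close>, since concavity of the
  logarithm moves the expectation inside. Gain and interference depend on the same channels;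
  \<open>|G|^2 \<le> (1 + \<eta>) |\<mu>|^2 + (1 + 1 / \<eta>) |G - \<mu>|^2\<close> decouples them:
  the deterministic \<open>\<mu>\<close> multiplies \<open>1 / D\<close>, while the fluctuation
  meets only the crude bound \<open>D \<ge> \<sigma>2\<close>. As \<open>|\<mu>|^2\<close> grows
  like \<open>K / M\<close>, the error in \<open>1 / D\<close> must be relative, not absolute. The
  crude part costs a constant times \<open>M / M^2\<close>, which \<open>K / M^2\<close> does not
  dominate when \<open>K\<close> is below \<open>M\<close>; this is the source of the exponent
  \<open>1 + \<delta>\<close>. The obstacle in the estimate of \<open>D\<close> is that the power
  from a single interferer does not concentrate: its cross terms between relays are of the same
  order as its mean. Only the average over the interferers is small, so products belonging to
  different sources must be orthogonal as well.\<close>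

lemma lborel_complex_eq: "(lborel :: complex measure) = distr (lborel \<Otimes>\<^sub>M lborel) borel (\<lambda>(a, b). Complex a b)"
proof (rule lborel_eqI)
  have [measurable]: "(\<lambda>(a, b). Complex a b) \<in> borel_measurable (lborel \<Otimes>\<^sub>M lborel)"
    unfolding Complex_eq by measurable
  fix l u :: complex
  assume lu: "\<And>b. b \<in> Basis \<Longrightarrow> l \<bullet> b \<le> u \<bullet> b"
  have le: "Re l \<le> Re u" "Im l \<le> Im u"
    using lu[of 1] lu[of \<i>] by (auto simp: Basis_complex_def)
  have eq: "(\<lambda>(a, b). Complex a b) -` box l u \<inter> space (lborel \<Otimes>\<^sub>M lborel) = {Re l<..<Re u} \<times> {Im l<..<Im u}"
    by (auto simp: space_pair_measure box_def Basis_complex_def)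
  have "emeasure (distr (lborel \<Otimes>\<^sub>M lborel) borel (\<lambda>(a, b). Complex a b)) (box l u)
      = emeasure (lborel \<Otimes>\<^sub>M lborel) ({Re l<..<Re u} \<times> {Im l<..<Im u})"
    by (subst emeasure_distr) (auto simp: eq)
  also have "\<dots> = (Re u - Re l) * (Im u - Im l)"
    using le by (simp add: lborel.emeasure_pair_measure_Times ennreal_mult)
  also have "\<dots> = (\<Prod>b\<in>Basis. (u - l) \<bullet> b)"
    by (simp add: Basis_complex_def)
  finally show "emeasure (distr (lborel \<Otimes>\<^sub>M lborel) borel (\<lambda>(a, b). Complex a b)) (box l u)
      = ennreal (\<Prod>b\<in>Basis. (u - l) \<bullet> b)" .
qed simp

lemma measurable_Complex_pair [measurable]: "(\<lambda>(a, b). Complex a b) \<in> borel_measurable (borel \<Otimes>\<^sub>M borel)"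
  unfolding Complex_eq by measurable

lemma nn_integral_lborel_complex:
  assumes [measurable]: "f \<in> borel_measurable borel"
  shows "(\<integral>\<^sup>+x. f x \<partial>lborel) = (\<integral>\<^sup>+a. \<integral>\<^sup>+b. f (Complex a b) \<partial>lborel \<partial>lborel)"
proof -
  have "(\<integral>\<^sup>+x. f x \<partial>lborel) = (\<integral>\<^sup>+p. f (case p of (a, b) \<Rightarrow> Complex a b) \<partial>(lborel \<Otimes>\<^sub>M lborel))"
    by (subst lborel_complex_eq, subst nn_integral_distr) auto
  also have "\<dots> = (\<integral>\<^sup>+a. \<integral>\<^sup>+b. f (Complex a b) \<partial>lborel \<partial>lborel)"
    by (subst lborel.nn_integral_fst[symmetric]) (auto simp: split_beta')
  finally show ?thesis .
qed

lemma nn_integral_lborel_shift: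
  fixes t :: "'b::euclidean_space"
  assumes [measurable]: "f \<in> borel_measurable borel"
  shows "(\<integral>\<^sup>+x. f (x + t) \<partial>lborel) = (\<integral>\<^sup>+x. f x \<partial>lborel)"
proof -
  have "(\<integral>\<^sup>+x. f x \<partial>lborel) = (\<integral>\<^sup>+x. f x \<partial>distr lborel borel (\<lambda>x. t + x))"
    by (subst lborel_distr_plus) simp
  then show ?thesis by (simp add: nn_integral_distr add.commute)
qed

section \<open>Density, convolution and second moment of CN(0, v)\<close>

definition cgauss :: "real \<Rightarrow> complex \<Rightarrow> real" where
  "cgauss v x = exp (- (cmod x)\<^sup>2 / v) / (pi * v)"

definition CN :: "real \<Rightarrow> complex measure" where
  "CN v = density lborel (\<lambda>x. ennreal (cgauss v x))"

lemma cgauss_pos: "0 < v \<Longrightarrow> 0 < cgauss v x"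
  and cgauss_le: "0 < v \<Longrightarrow> cgauss v x \<le> 1 / (pi * v)"
  by (auto simp: cgauss_def divide_simps)

lemma cgauss_nonneg: "0 \<le> v \<Longrightarrow> 0 \<le> cgauss v x"
  by (auto simp: cgauss_def)

lemma ln_cgauss: "0 < v \<Longrightarrow> ln (cgauss v x) = - (cmod x)\<^sup>2 / v - ln (pi * v)"
  by (simp add: cgauss_def ln_div)

lemma borel_measurable_cgauss [measurable (raw)]:
  assumes [measurable]: "f \<in> borel_measurable M" "g \<in> borel_measurable M"
  shows "(\<lambda>x. cgauss (f x) (g x)) \<in> borel_measurable M"
  unfolding cgauss_def by measurable

lemma sets_CN [simp, measurable_cong]: "sets (CN v) = sets borel"
  and space_CN [simp]: "space (CN v) = UNIV"
  by (simp_all add: CN_def)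

lemma cgauss_eq_normal_density:
  assumes "0 < v"
  shows "cgauss v x = normal_density 0 (sqrt (v / 2)) (Re x) * normal_density 0 (sqrt (v / 2)) (Im x)"
proof -
  have "cgauss v x = exp (- (Re x)\<^sup>2 / v) * exp (- (Im x)\<^sup>2 / v) / (pi * v)"
    by (simp add: cgauss_def cmod_power2 exp_add[symmetric] add_divide_distrib diff_divide_distrib)
  moreover have "sqrt (2 * pi * (sqrt (v / 2))\<^sup>2) = sqrt (pi * v)"
    using assms by simp
  moreover have "sqrt (pi * v) * sqrt (pi * v) = pi * v"
    using assms by simp
  ultimately show ?thesis using assms
    by (simp add: normal_density_def divide_simps)
qed

lemma nn_integral_CN:
  assumes "f \<in> borel_measurable borel"
  shows "(\<integral>\<^sup>+x. f x \<partial>CN v) = (\<integral>\<^sup>+x. ennreal (cgauss v x) * f x \<partial>lborel)"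
  using assms unfolding CN_def by (subst nn_integral_density) auto

lemma nn_integral_cgauss:
  assumes "0 < v"
  shows "(\<integral>\<^sup>+x. ennreal (cgauss v x) \<partial>lborel) = 1"
proof -
  let ?n = "normal_density 0 (sqrt (v / 2))"
  have s: "0 < sqrt (v / 2)" using assms by simp
  have 1: "(\<integral>\<^sup>+x. ennreal (?n x) \<partial>lborel) = 1"
    using s by (subst nn_integral_eq_integral) (auto intro: integrable_normal_density integral_normal_density)
  have "(\<integral>\<^sup>+x. ennreal (cgauss v x) \<partial>lborel) = (\<integral>\<^sup>+a. \<integral>\<^sup>+b. ennreal (?n a) * ennreal (?n b) \<partial>lborel \<partial>lborel)"
    by (subst nn_integral_lborel_complex) (auto simp: cgauss_eq_normal_density[OF assms] ennreal_mult)
  also have "\<dots> = 1" by (simp add: nn_integral_cmult 1)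
  finally show ?thesis .
qed

lemma prob_space_CN: "0 < v \<Longrightarrow> prob_space (CN v)"
  by standard (simp add: CN_def emeasure_density nn_integral_cgauss)

lemma complex_gaussian_distr:
  assumes "complex_gaussian \<Omega> v X" "0 < v"
  shows "distr \<Omega> borel X = CN v"
proof -
  have "distr \<Omega> lborel X = CN v"
    using assms unfolding complex_gaussian_def distributed_def CN_def
    by (simp add: cgauss_eq_normal_density)
  moreover have "distr \<Omega> lborel X = distr \<Omega> borel X"
    by (rule distr_cong) auto
  ultimately show ?thesis by simp
qed

text \<open>Completing the square in \<open>x\<close> splits the exponent into a part in
  \<open>b\<close> of variance \<open>u + |c|^2 v\<close> and a shifted Gaussian in
  \<open>x\<close>, whose integral is 1 by translation invariance.\<close>

lemma cgauss_convolution: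
  assumes "0 < u" "0 < v"
  shows "(\<integral>\<^sup>+x. ennreal (cgauss u (b - c * x)) * ennreal (cgauss v x) \<partial>lborel) = ennreal (cgauss (u + (cmod c)\<^sup>2 * v) b)"
proof -
  define w where "w = u + (cmod c)\<^sup>2 * v"
  \<comment> \<open>If \<open>b = c X + N\<close> with \<open>X\<close> of variance \<open>v\<close>
    and independent noise \<open>N\<close> of variance \<open>u\<close>, then \<open>\<tau>\<close>
    is the conditional variance of \<open>X\<close> given \<open>b\<close>, and \<open>- x0\<close>
    its conditional mean.\<close>
  define \<tau> where "\<tau> = u * v / w"
  define x0 where "x0 = - cnj c * b * of_real (v / w)"
  have w: "0 < w" unfolding w_def using assms by (simp add: add_pos_nonneg)
  have tau: "0 < \<tau>" unfolding \<tau>_def using assms w by simp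
  have sq: "(cmod (b - c * x))\<^sup>2 / u + (cmod x)\<^sup>2 / v = (cmod b)\<^sup>2 / w + (cmod (x + x0))\<^sup>2 / \<tau>" for x
  proof -
    obtain b1 b2 c1 c2 x1 x2 where e: "b = Complex b1 b2" "c = Complex c1 c2" "x = Complex x1 x2"
      by (metis complex.exhaust)
    have w': "w = u + (c1\<^sup>2 + c2\<^sup>2) * v" by (simp add: w_def e cmod_power2)
    \<comment> \<open>Cleared of denominators, the identity is polynomial in the real
      coordinates.\<close>
    have "w * ((b1 - (c1*x1 - c2*x2))\<^sup>2 + (b2 - (c1*x2 + c2*x1))\<^sup>2) * v * w + w * (x1\<^sup>2+x2\<^sup>2) * u * w
       = (b1\<^sup>2 + b2\<^sup>2) * u * v * w + ((x1 * w - (c1*b1+c2*b2) * v)\<^sup>2 + (x2 * w - (c1*b2-c2*b1) * v)\<^sup>2) * w"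
      unfolding w' by algebra
    moreover have "(cmod (x + x0))\<^sup>2 * w\<^sup>2 = (x1 * w - (c1*b1+c2*b2) * v)\<^sup>2 + (x2 * w - (c1*b2-c2*b1) * v)\<^sup>2"
    proof -
      have "Re (x + x0) * w = x1 * w - (c1*b1+c2*b2) * v" "Im (x + x0) * w = x2 * w - (c1*b2-c2*b1) * v"
        using w by (simp_all add: x0_def e divide_simps algebra_simps)
      then show ?thesis by (simp add: cmod_power2 distrib_right power_mult_distrib[symmetric])
    qed
    moreover have "(cmod (b - c * x))\<^sup>2 = (b1 - (c1*x1 - c2*x2))\<^sup>2 + (b2 - (c1*x2 + c2*x1))\<^sup>2"
      "(cmod x)\<^sup>2 = x1\<^sup>2+x2\<^sup>2" "(cmod b)\<^sup>2 = b1\<^sup>2+b2\<^sup>2"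
      by (simp_all add: e cmod_power2)
    ultimately have "w * (cmod (b - c * x))\<^sup>2 * v * w + w * (cmod x)\<^sup>2 * u * w
        = (cmod b)\<^sup>2 * u * v * w + (cmod (x + x0))\<^sup>2 * w\<^sup>2 * w" by simp
    then have "w\<^sup>2 * ((cmod (b - c * x))\<^sup>2 * v + (cmod x)\<^sup>2 * u) = w\<^sup>2 * ((cmod b)\<^sup>2 * u * v / w + (cmod (x + x0))\<^sup>2 * w)"
      using w by (simp add: field_simps power2_eq_square)
    then have "(cmod (b - c * x))\<^sup>2 * v + (cmod x)\<^sup>2 * u = (cmod b)\<^sup>2 * u * v / w + (cmod (x + x0))\<^sup>2 * w"
      using w by simp
    then have "((cmod (b - c * x))\<^sup>2 * v + (cmod x)\<^sup>2 * u) / (u * v) = ((cmod b)\<^sup>2 * u * v / w + (cmod (x + x0))\<^sup>2 * w) / (u * v)"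
      by simp
    then show ?thesis
      using assms w by (simp add: add_divide_distrib \<tau>_def)
  qed
  have prod: "cgauss u (b - c * x) * cgauss v x = cgauss w b * cgauss \<tau> (x + x0)" for x
  proof -
    have "cgauss u (b - c * x) * cgauss v x = exp (- ((cmod (b - c * x))\<^sup>2 / u + (cmod x)\<^sup>2 / v)) / (pi * pi * (u * v))"
      by (simp add: cgauss_def mult_exp_exp)
    also have "\<dots> = exp (- ((cmod b)\<^sup>2 / w + (cmod (x + x0))\<^sup>2 / \<tau>)) / (pi * pi * (w * \<tau>))"
      unfolding sq using w by (simp add: \<tau>_def)
    also have "\<dots> = cgauss w b * cgauss \<tau> (x + x0)"
      by (simp add: cgauss_def mult_exp_exp)
    finally show ?thesis .
  qed
  have "(\<integral>\<^sup>+x. ennreal (cgauss u (b - c * x)) * ennreal (cgauss v x) \<partial>lborel)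
      = (\<integral>\<^sup>+x. ennreal (cgauss w b) * ennreal (cgauss \<tau> (x + x0)) \<partial>lborel)"
    using assms w tau by (simp add: ennreal_mult[symmetric] cgauss_nonneg prod)
  also have "\<dots> = ennreal (cgauss w b) * (\<integral>\<^sup>+x. ennreal (cgauss \<tau> x) \<partial>lborel)"
    by (subst nn_integral_cmult, simp, subst nn_integral_lborel_shift[where f="\<lambda>x. ennreal (cgauss \<tau> x)"]) simp_all
  also have "\<dots> = ennreal (cgauss w b)" by (simp add: nn_integral_cgauss tau)
  finally show ?thesis by (simp add: w_def)
qed

lemma nn_integral_CN_shift:
  assumes [measurable]: "f \<in> borel_measurable borel"
  shows "(\<integral>\<^sup>+b. f (b + t) \<partial>CN u) = (\<integral>\<^sup>+b. ennreal (cgauss u (b - t)) * f b \<partial>lborel)"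
  by (subst nn_integral_CN, measurable)
    (subst nn_integral_lborel_shift[where t = t and f="\<lambda>b. ennreal (cgauss u (b - t)) * f b", symmetric], auto)

text \<open>An independent Gaussian entering through the coefficient \<open>c\<close> only raises
  the noise variance: shifting \<open>b\<close> exposes the product of the two densities, and
  Tonelli leaves their convolution.\<close>

lemma CN_linear:
  assumes uv: "0 < u" "0 < v" and [measurable]: "f \<in> borel_measurable borel"
  shows "(\<integral>\<^sup>+x. \<integral>\<^sup>+b. f (b + c * x) \<partial>CN u \<partial>CN v) = (\<integral>\<^sup>+b. f b \<partial>CN (u + (cmod c)\<^sup>2 * v))"
proof -
  have "(\<integral>\<^sup>+x. \<integral>\<^sup>+b. f (b + c * x) \<partial>CN u \<partial>CN v) = 
     (\<integral>\<^sup>+x. \<integral>\<^sup>+b. ennreal (cgauss u (b - c * x)) * f b \<partial>lborel \<partial>CN v)"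
    by (subst nn_integral_CN_shift) auto
  also have "\<dots> = (\<integral>\<^sup>+x. \<integral>\<^sup>+b. (ennreal (cgauss u (b - c * x)) * ennreal (cgauss v x)) * f b \<partial>lborel \<partial>lborel)"
    by (subst nn_integral_CN) (auto simp: nn_integral_cmult[symmetric] mult_ac)
  also have "\<dots> = (\<integral>\<^sup>+b. \<integral>\<^sup>+x. (ennreal (cgauss u (b - c * x)) * ennreal (cgauss v x)) * f b \<partial>lborel \<partial>lborel)"
    by (rule lborel_pair.Fubini') simp
  also have "\<dots> = (\<integral>\<^sup>+b. ennreal (cgauss (u + (cmod c)\<^sup>2 * v) b) * f b \<partial>lborel)"
    by (simp add: nn_integral_multc cgauss_convolution uv)
  finally show ?thesis by (simp add: nn_integral_CN)
qed

lemma nn_integral_CN_cmod2: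
  assumes "0 < v"
  shows "(\<integral>\<^sup>+x. ennreal ((cmod x)\<^sup>2) \<partial>CN v) = ennreal v"
proof -
  let ?n = "normal_density 0 (sqrt (v / 2))"
  have s: "0 < sqrt (v / 2)" using assms by simp
  have 1: "(\<integral>\<^sup>+x. ennreal (?n x) \<partial>lborel) = 1"
    using s by (subst nn_integral_eq_integral) (auto intro: integrable_normal_density integral_normal_density)
  have 2: "(\<integral>\<^sup>+x. ennreal (?n x * x\<^sup>2) \<partial>lborel) = ennreal (v / 2)"
  proof -
    have "has_bochner_integral lborel (\<lambda>x. ?n x * x\<^sup>2) (v / 2)"
      using normal_moment_even[OF s, of 0 1] assms by (simp add: divide_simps)
    then have i: "integrable lborel (\<lambda>x. ?n x * x\<^sup>2)" and e: "(LBINT x. ?n x * x\<^sup>2) = v / 2"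
      by (blast intro: integrable.intros, rule has_bochner_integral_integral_eq)
    show ?thesis
      by (subst nn_integral_eq_integral[OF i]) (simp_all add: e)
  qed
  have "(\<integral>\<^sup>+x. ennreal ((cmod x)\<^sup>2) \<partial>CN v) = 
     (\<integral>\<^sup>+a. \<integral>\<^sup>+b. ennreal (?n a * a\<^sup>2) * ennreal (?n b) + ennreal (?n a) * ennreal (?n b * b\<^sup>2) \<partial>lborel \<partial>lborel)"
    by (simp add: nn_integral_CN, subst nn_integral_lborel_complex)
      (auto simp: cgauss_eq_normal_density[OF assms] ennreal_mult[symmetric] ennreal_plus[symmetric] cmod_power2 algebra_simps
        simp del: ennreal_plus intro!: nn_integral_cong)
  also have "\<dots> = ennreal v"
    using assms by (simp add: nn_integral_add nn_integral_cmult nn_integral_multc 1 2 ennreal_plus[symmetric] del: ennreal_plus)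
  finally show ?thesis .
qed

lemma measurable_nn_integral_CN [measurable (raw)]:
  assumes "0 < u" and [measurable]: "case_prod f \<in> borel_measurable (N \<Otimes>\<^sub>M borel)"
  shows "(\<lambda>x. \<integral>\<^sup>+b. f x b \<partial>CN u) \<in> borel_measurable N"
proof -
  interpret prob_space "CN u" using assms(1) by (rule prob_space_CN)
  show ?thesis by (rule borel_measurable_nn_integral) measurable
qed

text \<open>The variables are absorbed into the noise one at a time by \<open>CN_linear\<close>. The
  base variance grows at each stage, hence \<open>u\<close> is generalised in the induction.\<close>

lemma CN_sum:
  fixes v :: "'i \<Rightarrow> real"
  assumes fin: "finite I" and v: "\<And>i. 0 < v i" and u: "0 < u" and f: "f \<in> borel_measurable borel"
  shows "(\<integral>\<^sup>+x. \<integral>\<^sup>+b. f (b + (\<Sum>i\<in>I. c i * x i)) \<partial>CN u \<partial>Pi\<^sub>M I (\<lambda>i. CN (v i)))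
    = (\<integral>\<^sup>+b. f b \<partial>CN (u + (\<Sum>i\<in>I. (cmod (c i))\<^sup>2 * v i)))"
  using fin u
proof (induction I arbitrary: u rule: finite_induct)
  case empty
  interpret product_sigma_finite "\<lambda>i. CN (v i)"
    by (intro product_sigma_finite.intro prob_space_imp_sigma_finite prob_space_CN v)
  show ?case using f by (simp add: nn_integral_empty PiM_empty)
next
  case (insert i I)
  interpret product_sigma_finite "\<lambda>i. CN (v i)"
    by (intro product_sigma_finite.intro prob_space_imp_sigma_finite prob_space_CN v)
  note [measurable] = f
  let ?u = "u + (cmod (c i))\<^sup>2 * v i"
  have u': "0 < ?u" using insert.prems v by (simp add: add_pos_nonneg less_imp_le)
  have "(\<integral>\<^sup>+x. \<integral>\<^sup>+b. f (b + (\<Sum>i\<in>insert i I. c i * x i)) \<partial>CN u \<partial>Pi\<^sub>M (insert i I) (\<lambda>i. CN (v i)))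
     = (\<integral>\<^sup>+x. \<integral>\<^sup>+y. \<integral>\<^sup>+b. f (b + (\<Sum>j\<in>insert i I. c j * (x(i := y)) j)) \<partial>CN u \<partial>CN (v i) \<partial>Pi\<^sub>M I (\<lambda>i. CN (v i)))"
    using insert by (subst product_nn_integral_insert) auto
  also have "\<dots> = (\<integral>\<^sup>+x. \<integral>\<^sup>+y. \<integral>\<^sup>+b. f ((b + c i * y) + (\<Sum>j\<in>I. c j * x j)) \<partial>CN u \<partial>CN (v i) \<partial>Pi\<^sub>M I (\<lambda>i. CN (v i)))"
  proof -
    have "(\<Sum>j\<in>insert i I. c j * (x(i := y)) j) = c i * y + (\<Sum>j\<in>I. c j * x j)" for x y
      using insert by (subst sum.insert) (auto intro!: sum.cong)
    then show ?thesis by (simp add: add.assoc)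
  qed
  also have "\<dots> = (\<integral>\<^sup>+x. \<integral>\<^sup>+b. f (b + (\<Sum>j\<in>I. c j * x j)) \<partial>CN ?u \<partial>Pi\<^sub>M I (\<lambda>i. CN (v i)))"
    by (subst CN_linear) (use insert.prems v in auto)
  also have "\<dots> = (\<integral>\<^sup>+b. f b \<partial>CN (?u + (\<Sum>i\<in>I. (cmod (c i))\<^sup>2 * v i)))"
    by (rule insert.IH[OF u'])
  finally show ?case using insert by (simp add: add.assoc)
qed

section \<open>Mutual information over a Gaussian channel with random state\<close>

text \<open>Jensen for the logarithm, from its tangent at the mean: \<open>ln t \<le> t - 1\<close>
  at \<open>t = g x / expectation g\<close>.\<close>

lemma (in prob_space) expectation_ln_le:
  fixes g :: "'a \<Rightarrow> real"
  assumes "integrable M g" "integrable M (\<lambda>x. ln (g x))" "\<And>x. x \<in> space M \<Longrightarrow> 0 < g x"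
  shows "expectation (\<lambda>x. ln (g x)) \<le> ln (expectation g)"
proof -
  have pos: "0 < expectation g"
    using assms by (intro expectation_greater) auto
  have "expectation (\<lambda>x. ln (g x)) \<le> expectation (\<lambda>x. g x / expectation g - 1 + ln (expectation g))"
  proof (rule integral_mono)
    fix x assume x: "x \<in> space M"
    have "ln (g x / expectation g) \<le> g x / expectation g - 1"
      using pos assms(3)[OF x] by (intro ln_le_minus_one) simp
    then show "ln (g x) \<le> g x / expectation g - 1 + ln (expectation g)"
      using pos assms(3)[OF x] by (simp add: ln_div)
  qed (use assms in auto)
  also have "\<dots> = ln (expectation g)"
    using pos assms by (simp add: prob_space)
  finally show ?thesis .
qed

text \<open>In use \<open>M\<close> is the true law and \<open>g\<close> a comparison density over
  the true one, so that its mean is at most 1 and Jensen gives the sign.\<close>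

lemma (in prob_space) gibbs_le:
  fixes g :: "'a \<Rightarrow> real"
  assumes "\<And>x. x \<in> space M \<Longrightarrow> 0 < g x" and [measurable]: "g \<in> borel_measurable M"
    and "(\<integral>\<^sup>+x. ennreal (g x) \<partial>M) \<le> 1" and "integrable M (\<lambda>x. ln (g x))"
  shows "expectation (\<lambda>x. ln (g x)) \<le> 0"
proof -
  have int: "integrable M g"
    using assms by (intro integrableI_nonneg) (auto intro!: AE_I2 less_imp_le simp: le_less_trans[OF assms(3)])
  have "ennreal (expectation g) \<le> 1"
    using assms(1,3) int by (subst nn_integral_eq_integral[symmetric]) (auto intro!: AE_I2 less_imp_le)
  then have "expectation g \<le> 1" by simp
  moreover have "0 < expectation g"
    using assms int by (intro expectation_greater) auto
  ultimately have "ln (expectation g) \<le> 0" by (subst ln_le_zero_iff) auto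
  then show ?thesis using expectation_ln_le[OF int assms(4,1)] by simp
qed

text \<open>A channel \<open>y = G s + noise\<close> with Gaussian input, whose noise is Gaussian of variance \<open>D\<close> given
  the state \<open>H\<close>; the decoder does not observe the state.\<close>

locale gaussian_channel = prob_space \<Omega> + state: prob_space \<nu>
  for \<Omega> :: "'a measure" and \<nu> :: "'s measure" +
  fixes H :: "'a \<Rightarrow> 's" and s y :: "'a \<Rightarrow> complex" and G :: "'s \<Rightarrow> complex" and D :: "'s \<Rightarrow> real"
    and q d0 :: real
  assumes q_pos: "0 < q" and d0_pos: "0 < d0" and D_ge: "\<And>x. d0 \<le> D x"
    and measurable_state [measurable]: "H \<in> measurable \<Omega> \<nu>" "s \<in> borel_measurable \<Omega>" "y \<in> borel_measurable \<Omega>"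
      "G \<in> borel_measurable \<nu>" "D \<in> borel_measurable \<nu>"
    and integrable_G2: "integrable \<nu> (\<lambda>x. (cmod (G x))\<^sup>2)" and integrable_D: "integrable \<nu> D"
    and law: "\<And>\<phi>. \<phi> \<in> borel_measurable (\<nu> \<Otimes>\<^sub>M (borel \<Otimes>\<^sub>M borel)) \<Longrightarrow>
      (\<integral>\<^sup>+\<omega>. \<phi> (H \<omega>, s \<omega>, y \<omega>) \<partial>\<Omega>)
      = (\<integral>\<^sup>+x. \<integral>\<^sup>+a. \<integral>\<^sup>+b. \<phi> (x, a, b + G x * a) \<partial>CN (D x) \<partial>CN q \<partial>\<nu>)"
begin

sublocale pair_sigma_finite \<nu> "lborel :: complex measure" ..

text \<open>\<open>V\<close> is the output variance given the state. \<open>W b a\<close> and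
  \<open>p b\<close> are the output densities, with and without \<open>s = a\<close> given, averaged
  over the state because the decoder does not see it.\<close>

definition V :: "'s \<Rightarrow> real" where "V x = D x + (cmod (G x))\<^sup>2 * q"
definition W :: "complex \<Rightarrow> complex \<Rightarrow> real" where "W b a = (\<integral>x. cgauss (D x) (b - G x * a) \<partial>\<nu>)"
definition p :: "complex \<Rightarrow> real" where "p b = (\<integral>x. cgauss (V x) b \<partial>\<nu>)"

lemma D_pos: "0 < D x" using D_ge[of x] d0_pos by linarith
lemma V_ge: "D x \<le> V x" "d0 \<le> V x" using D_ge[of x] q_pos by (auto simp: V_def add_increasing2)
lemma V_pos: "0 < V x" using V_ge[of x] D_pos[of x] by linarith

lemma measurable_V [measurable]: "V \<in> borel_measurable \<nu>" unfolding V_def by measurable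
lemma integrable_V: "integrable \<nu> V" unfolding V_def using integrable_D integrable_G2 by simp

lemma integrable_cgauss_state:
  assumes [measurable]: "v \<in> borel_measurable \<nu>" "g \<in> borel_measurable \<nu>" and "\<And>x. d0 \<le> v x"
  shows "integrable \<nu> (\<lambda>x. cgauss (v x) (g x))"
proof (rule state.integrable_const_bound[where B="1 / (pi * d0)"])
  have "cgauss (v x) (g x) \<le> 1 / (pi * d0)" "0 \<le> cgauss (v x) (g x)" for x
  proof -
    have "0 < v x" using assms(3)[of x] d0_pos by linarith
    then show "0 \<le> cgauss (v x) (g x)" by (simp add: cgauss_nonneg)
    have "cgauss (v x) (g x) \<le> 1 / (pi * v x)" using \<open>0 < v x\<close> by (rule cgauss_le)
    also have "\<dots> \<le> 1 / (pi * d0)" using assms(3)[of x] d0_pos by (intro divide_left_mono) auto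
    finally show "cgauss (v x) (g x) \<le> 1 / (pi * d0)" .
  qed
  then show "AE x in \<nu>. norm (cgauss (v x) (g x)) \<le> 1 / (pi * d0)" by auto
qed measurable

text \<open>The floor \<open>d0\<close> on the variance caps the mixture density, and Jensen bounds
  its logarithm from below by the mean of a quadratic. So log densities grow at most quadratically,
  which will make the information density integrable.\<close>

lemma expectation_cgauss_bounds:
  assumes [measurable]: "v \<in> borel_measurable \<nu>" "g \<in> borel_measurable \<nu>" and v: "\<And>x. d0 \<le> v x"
    and int: "integrable \<nu> v" "integrable \<nu> (\<lambda>x. (cmod (g x))\<^sup>2)"
  shows "0 < state.expectation (\<lambda>x. cgauss (v x) (g x))"
    "\<bar>ln (state.expectation (\<lambda>x. cgauss (v x) (g x)))\<bar>
     \<le> \<bar>ln (pi * d0)\<bar> + pi * state.expectation v + state.expectation (\<lambda>x. (cmod (g x))\<^sup>2) / d0"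
proof -
  have vpos: "0 < v x" for x using v[of x] d0_pos by linarith
  let ?e = "state.expectation (\<lambda>x. cgauss (v x) (g x))"
  have i: "integrable \<nu> (\<lambda>x. cgauss (v x) (g x))" by (rule integrable_cgauss_state) (use v in auto)
  show pos: "0 < ?e" by (rule state.expectation_greater[OF i]) (simp add: cgauss_pos vpos)
  have lnb: "- (pi * v x) - (cmod (g x))\<^sup>2 / d0 \<le> ln (cgauss (v x) (g x))" "ln (cgauss (v x) (g x)) \<le> - ln (pi * d0)" for x
  proof -
    \<comment> \<open>A linear bound on the logarithm, since the mean of \<open>v\<close> is what is
      controlled.\<close>
    have "ln (pi * v x) \<le> pi * v x" using ln_le_minus_one[of "pi * v x"] vpos[of x] by simp
    moreover have "(cmod (g x))\<^sup>2 / v x \<le> (cmod (g x))\<^sup>2 / d0"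
      using v[of x] d0_pos by (intro divide_left_mono) auto
    ultimately show "- (pi * v x) - (cmod (g x))\<^sup>2 / d0 \<le> ln (cgauss (v x) (g x))"
      by (simp add: ln_cgauss vpos)
    have "ln (pi * d0) \<le> ln (pi * v x)" using v[of x] d0_pos by (intro ln_mono) auto
    moreover have "0 \<le> (cmod (g x))\<^sup>2 / v x" using vpos[of x] by simp
    ultimately show "ln (cgauss (v x) (g x)) \<le> - ln (pi * d0)" by (simp add: ln_cgauss vpos)
  qed
  have il: "integrable \<nu> (\<lambda>x. ln (cgauss (v x) (g x)))"
  proof (rule Bochner_Integration.integrable_bound)
    show "integrable \<nu> (\<lambda>x. \<bar>ln (pi * d0)\<bar> + pi * v x + (cmod (g x))\<^sup>2 / d0)" using int by simp
    show "AE x in \<nu>. norm (ln (cgauss (v x) (g x))) \<le> norm (\<bar>ln (pi * d0)\<bar> + pi * v x + (cmod (g x))\<^sup>2 / d0)"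
    proof (intro AE_I2)
      fix x
      have "0 \<le> pi * v x" "0 \<le> (cmod (g x))\<^sup>2 / d0" using vpos[of x] d0_pos by auto
      then show "norm (ln (cgauss (v x) (g x))) \<le> norm (\<bar>ln (pi * d0)\<bar> + pi * v x + (cmod (g x))\<^sup>2 / d0)"
        using lnb[of x] by auto
    qed
  qed measurable
  have "state.expectation (\<lambda>x. - (pi * v x) - (cmod (g x))\<^sup>2 / d0) \<le> state.expectation (\<lambda>x. ln (cgauss (v x) (g x)))"
    using int il lnb by (intro integral_mono) auto
  also have "\<dots> \<le> ln ?e" by (rule state.expectation_ln_le[OF i il]) (simp add: cgauss_pos vpos)
  finally have lo: "- (pi * state.expectation v) - state.expectation (\<lambda>x. (cmod (g x))\<^sup>2) / d0 \<le> ln ?e"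
    using int by simp
  have "?e \<le> 1 / (pi * d0)"
  proof (rule state.integral_le_const[OF i], rule AE_I2)
    fix x
    have "cgauss (v x) (g x) \<le> 1 / (pi * v x)" using vpos[of x] by (rule cgauss_le)
    also have "\<dots> \<le> 1 / (pi * d0)" using v[of x] d0_pos by (intro divide_left_mono) auto
    finally show "cgauss (v x) (g x) \<le> 1 / (pi * d0)" .
  qed
  then have "ln ?e \<le> ln (1 / (pi * d0))" using pos by (rule ln_mono)
  then have hi: "ln ?e \<le> - ln (pi * d0)" using d0_pos by (simp add: ln_div)
  have "0 \<le> state.expectation v" using vpos by (simp add: less_imp_le)
  moreover have "0 \<le> state.expectation (\<lambda>x. (cmod (g x))\<^sup>2) / d0" using d0_pos by (intro divide_nonneg_pos) auto
  ultimately show "\<bar>ln ?e\<bar> \<le> \<bar>ln (pi * d0)\<bar> + pi * state.expectation v + state.expectation (\<lambda>x. (cmod (g x))\<^sup>2) / d0"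
    using lo hi by (smt (verit) mult_nonneg_nonneg pi_ge_zero)
qed

lemma integrable_cmod2_affine: "integrable \<nu> (\<lambda>x. (cmod (b - G x * a))\<^sup>2)"
  and expectation_cmod2_affine: "state.expectation (\<lambda>x. (cmod (b - G x * a))\<^sup>2)
     \<le> 2 * (cmod b)\<^sup>2 + 2 * state.expectation (\<lambda>x. (cmod (G x))\<^sup>2) * (cmod a)\<^sup>2"
proof -
  have le: "(cmod (b - G x * a))\<^sup>2 \<le> 2 * (cmod b)\<^sup>2 + 2 * (cmod (G x))\<^sup>2 * (cmod a)\<^sup>2" for x
  proof -
    have "(cmod (b - G x * a))\<^sup>2 \<le> (cmod b + cmod (G x * a))\<^sup>2"
      by (intro power_mono norm_triangle_ineq4) auto
    also have "\<dots> \<le> 2 * (cmod b)\<^sup>2 + 2 * (cmod (G x * a))\<^sup>2"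
      using sum_squares_bound[of "cmod b" "cmod (G x * a)"] by (simp add: power2_sum)
    finally show ?thesis by (simp add: norm_mult power_mult_distrib)
  qed
  have i: "integrable \<nu> (\<lambda>x. 2 * (cmod b)\<^sup>2 + 2 * (cmod (G x))\<^sup>2 * (cmod a)\<^sup>2)"
    using integrable_G2 by simp
  show i2: "integrable \<nu> (\<lambda>x. (cmod (b - G x * a))\<^sup>2)"
    by (rule Bochner_Integration.integrable_bound[OF i]) (use le in \<open>auto intro!: AE_I2\<close>)
  have "state.expectation (\<lambda>x. (cmod (b - G x * a))\<^sup>2) \<le> state.expectation (\<lambda>x. 2 * (cmod b)\<^sup>2 + 2 * (cmod (G x))\<^sup>2 * (cmod a)\<^sup>2)"
    using le i i2 by (intro integral_mono) auto
  also have "\<dots> = 2 * (cmod b)\<^sup>2 + 2 * state.expectation (\<lambda>x. (cmod (G x))\<^sup>2) * (cmod a)\<^sup>2"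
    using integrable_G2 by (simp add: state.prob_space)
  finally show "state.expectation (\<lambda>x. (cmod (b - G x * a))\<^sup>2)
     \<le> 2 * (cmod b)\<^sup>2 + 2 * state.expectation (\<lambda>x. (cmod (G x))\<^sup>2) * (cmod a)\<^sup>2" .
qed

lemma W_pos: "0 < W b a"
  unfolding W_def using integrable_cmod2_affine integrable_D D_ge by (intro expectation_cgauss_bounds) auto
lemma p_pos: "0 < p b"
  unfolding p_def using integrable_V V_ge by (intro expectation_cgauss_bounds) auto

lemma measurable_W [measurable]: "(\<lambda>(b, a). W b a) \<in> borel_measurable (borel \<Otimes>\<^sub>M borel)"
  unfolding W_def split_beta' by measurable
lemma measurable_p [measurable]: "p \<in> borel_measurable borel"
  unfolding p_def by measurable

lemma ennreal_W: "ennreal (W b a) = (\<integral>\<^sup>+x. ennreal (cgauss (D x) (b - G x * a)) \<partial>\<nu>)"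
  unfolding W_def using D_ge D_pos
  by (intro nn_integral_eq_integral[symmetric] integrable_cgauss_state) (auto simp: cgauss_nonneg less_imp_le)
lemma ennreal_p: "ennreal (p b) = (\<integral>\<^sup>+x. ennreal (cgauss (V x) b) \<partial>\<nu>)"
  unfolding p_def using V_ge V_pos
  by (intro nn_integral_eq_integral[symmetric] integrable_cgauss_state) (auto simp: cgauss_nonneg less_imp_le)

section \<open>Laws of the input, the output and their pair\<close>

lemma law_lborel:
  assumes [measurable]: "\<phi> \<in> borel_measurable (\<nu> \<Otimes>\<^sub>M (borel \<Otimes>\<^sub>M borel))"
  shows "(\<integral>\<^sup>+\<omega>. \<phi> (H \<omega>, s \<omega>, y \<omega>) \<partial>\<Omega>)
    = (\<integral>\<^sup>+x. \<integral>\<^sup>+a. \<integral>\<^sup>+b. ennreal (cgauss q a) * (ennreal (cgauss (D x) (b - G x * a)) * \<phi> (x, a, b)) \<partial>lborel \<partial>lborel \<partial>\<nu>)"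
proof -
  have "(\<integral>\<^sup>+a. \<integral>\<^sup>+b. \<phi> (x, a, b + G x * a) \<partial>CN (D x) \<partial>CN q)
    = (\<integral>\<^sup>+a. \<integral>\<^sup>+b. ennreal (cgauss q a) * (ennreal (cgauss (D x) (b - G x * a)) * \<phi> (x, a, b)) \<partial>lborel \<partial>lborel)"
    if [simp]: "x \<in> space \<nu>" for x
    by (subst nn_integral_CN_shift, measurable, subst nn_integral_CN, measurable) (simp add: nn_integral_cmult)
  then show ?thesis by (subst law, measurable) (auto intro!: nn_integral_cong)
qed

text \<open>Tonelli moves the state innermost, where it averages the conditional density to
  \<open>W\<close>.\<close>

lemma law_pair:
  assumes [measurable]: "\<phi> \<in> borel_measurable (borel \<Otimes>\<^sub>M borel)"
  shows "(\<integral>\<^sup>+\<omega>. \<phi> (y \<omega>, s \<omega>) \<partial>\<Omega>)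
    = (\<integral>\<^sup>+a. \<integral>\<^sup>+b. ennreal (W b a * cgauss q a) * \<phi> (b, a) \<partial>lborel \<partial>lborel)"
proof -
  have "(\<integral>\<^sup>+\<omega>. \<phi> (y \<omega>, s \<omega>) \<partial>\<Omega>) = (\<integral>\<^sup>+x. \<integral>\<^sup>+a. \<integral>\<^sup>+b. ennreal (cgauss q a) * (ennreal (cgauss (D x) (b - G x * a)) * \<phi> (b, a)) \<partial>lborel \<partial>lborel \<partial>\<nu>)"
    using law_lborel[of "\<lambda>(x, a, b). \<phi> (b, a)"] by simp
  also have "\<dots> = (\<integral>\<^sup>+a. \<integral>\<^sup>+x. \<integral>\<^sup>+b. ennreal (cgauss q a) * (ennreal (cgauss (D x) (b - G x * a)) * \<phi> (b, a)) \<partial>lborel \<partial>\<nu> \<partial>lborel)"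
    by (rule Fubini'[symmetric]) measurable
  also have "\<dots> = (\<integral>\<^sup>+a. \<integral>\<^sup>+b. \<integral>\<^sup>+x. ennreal (cgauss q a) * (ennreal (cgauss (D x) (b - G x * a)) * \<phi> (b, a)) \<partial>\<nu> \<partial>lborel \<partial>lborel)"
    by (intro nn_integral_cong Fubini'[symmetric]) measurable
  also have "\<dots> = (\<integral>\<^sup>+a. \<integral>\<^sup>+b. ennreal (W b a * cgauss q a) * \<phi> (b, a) \<partial>lborel \<partial>lborel)"
    using W_pos q_pos
    by (intro nn_integral_cong)
      (simp add: nn_integral_cmult nn_integral_multc ennreal_W[symmetric] ennreal_mult cgauss_nonneg less_imp_le,
        simp add: mult_ac)
  finally show ?thesis .
qed

text \<open>Given the state, input and noise merge into one Gaussian by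
  \<open>CN_linear\<close>.\<close>

lemma law_output:
  assumes [measurable]: "\<phi> \<in> borel_measurable (\<nu> \<Otimes>\<^sub>M borel)"
  shows "(\<integral>\<^sup>+\<omega>. \<phi> (H \<omega>, y \<omega>) \<partial>\<Omega>) = (\<integral>\<^sup>+x. \<integral>\<^sup>+b. \<phi> (x, b) \<partial>CN (V x) \<partial>\<nu>)"
proof -
  have "(\<integral>\<^sup>+\<omega>. \<phi> (H \<omega>, y \<omega>) \<partial>\<Omega>) = (\<integral>\<^sup>+x. \<integral>\<^sup>+a. \<integral>\<^sup>+b. \<phi> (x, b + G x * a) \<partial>CN (D x) \<partial>CN q \<partial>\<nu>)"
    using law[of "\<lambda>(x, a, b). \<phi> (x, b)"] by simp
  also have "\<dots> = (\<integral>\<^sup>+x. \<integral>\<^sup>+b. \<phi> (x, b) \<partial>CN (V x) \<partial>\<nu>)"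
    unfolding V_def using D_pos q_pos by (intro nn_integral_cong CN_linear) measurable
  finally show ?thesis .
qed

lemma law_state:
  assumes [measurable]: "\<phi> \<in> borel_measurable \<nu>"
  shows "(\<integral>\<^sup>+\<omega>. \<phi> (H \<omega>) \<partial>\<Omega>) = (\<integral>\<^sup>+x. \<phi> x \<partial>\<nu>)"
proof -
  have "(\<integral>\<^sup>+b. \<phi> x \<partial>CN (V x)) = \<phi> x" for x
    using prob_space.emeasure_space_1[OF prob_space_CN[OF V_pos]] by simp
  then show ?thesis using law_output[of "\<lambda>(x, b). \<phi> x"] by simp
qed

lemma distr_state: "distr \<Omega> \<nu> H = \<nu>"
proof (rule measure_eqI)
  fix A assume A: "A \<in> sets (distr \<Omega> \<nu> H)"
  then have [measurable]: "A \<in> sets \<nu>" by simp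
  show "emeasure (distr \<Omega> \<nu> H) A = emeasure \<nu> A"
    using law_state[of "indicator A"] nn_integral_distr[of H \<Omega> \<nu> "indicator A"] by simp
qed simp

lemma law_input:
  assumes [measurable]: "\<phi> \<in> borel_measurable borel"
  shows "(\<integral>\<^sup>+\<omega>. \<phi> (s \<omega>) \<partial>\<Omega>) = (\<integral>\<^sup>+a. \<phi> a \<partial>CN q)"
proof -
  have "(\<integral>\<^sup>+b. c \<partial>CN (D x)) = c" for c x
    using prob_space.emeasure_space_1[OF prob_space_CN[OF D_pos]] by simp
  then show ?thesis using law[of "\<lambda>(x, a, b). \<phi> a"] by (simp add: state.emeasure_space_1)
qed

lemma distributed_input: "distributed \<Omega> lborel s (\<lambda>a. ennreal (cgauss q a))"
  unfolding distributed_def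
proof (intro conjI measure_eqI)
  fix A assume A: "A \<in> sets (distr \<Omega> lborel s)"
  then have [measurable]: "A \<in> sets borel" by simp
  have "emeasure (distr \<Omega> lborel s) A = (\<integral>\<^sup>+\<omega>. indicator A (s \<omega>) \<partial>\<Omega>)"
    using nn_integral_distr[of s \<Omega> lborel "indicator A"] by simp
  then show "emeasure (distr \<Omega> lborel s) A = emeasure (density lborel (\<lambda>a. ennreal (cgauss q a))) A"
    using law_input[of "indicator A"] by (simp add: nn_integral_CN emeasure_density del: nn_integral_indicator)
qed (auto)

lemma distributed_output: "distributed \<Omega> lborel y (\<lambda>b. ennreal (p b))"
  unfolding distributed_def
proof (intro conjI measure_eqI)
  fix A assume A: "A \<in> sets (distr \<Omega> lborel y)"
  then have [measurable]: "A \<in> sets borel" by simp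
  have "emeasure (distr \<Omega> lborel y) A = (\<integral>\<^sup>+\<omega>. indicator A (y \<omega>) \<partial>\<Omega>)"
    using nn_integral_distr[of y \<Omega> lborel "indicator A"] by simp
  also have "\<dots> = (\<integral>\<^sup>+x. \<integral>\<^sup>+b. ennreal (cgauss (V x) b) * indicator A b \<partial>lborel \<partial>\<nu>)"
    using law_output[of "\<lambda>(x, b). indicator A b"] by (simp add: nn_integral_CN del: nn_integral_indicator)
  also have "\<dots> = (\<integral>\<^sup>+b. \<integral>\<^sup>+x. ennreal (cgauss (V x) b) * indicator A b \<partial>\<nu> \<partial>lborel)"
    by (rule Fubini'[symmetric]) measurable
  also have "\<dots> = emeasure (density lborel (\<lambda>b. ennreal (p b))) A"
    by (simp add: emeasure_density nn_integral_multc ennreal_p)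
  finally show "emeasure (distr \<Omega> lborel y) A = emeasure (density lborel (\<lambda>b. ennreal (p b))) A" .
qed (auto)

lemma distributed_pair:
  "distributed \<Omega> (lborel \<Otimes>\<^sub>M lborel) (\<lambda>\<omega>. (y \<omega>, s \<omega>)) (\<lambda>(b, a). ennreal (W b a * cgauss q a))"
  unfolding distributed_def
proof (intro conjI measure_eqI)
  fix A assume A: "A \<in> sets (distr \<Omega> (lborel \<Otimes>\<^sub>M lborel) (\<lambda>\<omega>. (y \<omega>, s \<omega>)))"
  then have [measurable]: "A \<in> sets (borel \<Otimes>\<^sub>M borel)" by simp
  have "emeasure (distr \<Omega> (lborel \<Otimes>\<^sub>M lborel) (\<lambda>\<omega>. (y \<omega>, s \<omega>))) A = (\<integral>\<^sup>+\<omega>. indicator A (y \<omega>, s \<omega>) \<partial>\<Omega>)"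
    using nn_integral_distr[of "\<lambda>\<omega>. (y \<omega>, s \<omega>)" \<Omega> "lborel \<Otimes>\<^sub>M lborel" "indicator A"] A by simp
  also have "\<dots> = (\<integral>\<^sup>+a. \<integral>\<^sup>+b. ennreal (W b a * cgauss q a) * indicator A (b, a) \<partial>lborel \<partial>lborel)"
    by (rule law_pair) measurable
  also have "\<dots> = (\<integral>\<^sup>+z. (case z of (b, a) \<Rightarrow> ennreal (W b a * cgauss q a)) * indicator A z \<partial>(lborel \<Otimes>\<^sub>M lborel))"
    by (subst lborel_pair.nn_integral_snd[symmetric]) (auto simp: split_beta')
  also have "\<dots> = emeasure (density (lborel \<Otimes>\<^sub>M lborel) (\<lambda>(b, a). ennreal (W b a * cgauss q a))) A"
    using A by (subst emeasure_density) auto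
  finally show "emeasure (distr \<Omega> (lborel \<Otimes>\<^sub>M lborel) (\<lambda>\<omega>. (y \<omega>, s \<omega>))) A =
    emeasure (density (lborel \<Otimes>\<^sub>M lborel) (\<lambda>(b, a). ennreal (W b a * cgauss q a))) A" .
qed (auto)

section \<open>Second moments and the information density\<close>

lemma nn_integral_CN_cmod2_normalised:
  assumes "0 < v"
  shows "(\<integral>\<^sup>+b. ennreal ((cmod b)\<^sup>2 / v) \<partial>CN v) = 1"
proof -
  have "(\<integral>\<^sup>+b. ennreal ((cmod b)\<^sup>2 / v) \<partial>CN v) = (\<integral>\<^sup>+b. ennreal ((cmod b)\<^sup>2) / ennreal v \<partial>CN v)"
    using assms by (simp add: divide_ennreal)
  also have "\<dots> = 1"
    using assms by (subst nn_integral_divide) (simp_all add: nn_integral_CN_cmod2 divide_ennreal)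
  finally show ?thesis .
qed

lemma integrable_input2: "integrable \<Omega> (\<lambda>\<omega>. (cmod (s \<omega>))\<^sup>2)"
  by (rule integrableI_nonneg)
    (use law_input[of "\<lambda>a. ennreal ((cmod a)\<^sup>2)"] nn_integral_CN_cmod2[OF q_pos] in auto)

lemma nn_integral_output2: "(\<integral>\<^sup>+\<omega>. ennreal ((cmod (y \<omega>))\<^sup>2) \<partial>\<Omega>) = ennreal (state.expectation V)"
proof -
  have "(\<integral>\<^sup>+\<omega>. ennreal ((cmod (y \<omega>))\<^sup>2) \<partial>\<Omega>) = (\<integral>\<^sup>+x. ennreal (V x) \<partial>\<nu>)"
    using law_output[of "\<lambda>(x, b). ennreal ((cmod b)\<^sup>2)"] by (simp add: nn_integral_CN_cmod2 V_pos)
  also have "\<dots> = ennreal (state.expectation V)"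
    using integrable_V V_pos by (intro nn_integral_eq_integral) (auto simp: less_imp_le)
  finally show ?thesis .
qed

lemma integrable_output2: "integrable \<Omega> (\<lambda>\<omega>. (cmod (y \<omega>))\<^sup>2)"
  and expectation_output2: "expectation (\<lambda>\<omega>. (cmod (y \<omega>))\<^sup>2) = state.expectation V"
proof -
  have "0 \<le> state.expectation V" using V_pos by (simp add: less_imp_le)
  then show "integrable \<Omega> (\<lambda>\<omega>. (cmod (y \<omega>))\<^sup>2)" "expectation (\<lambda>\<omega>. (cmod (y \<omega>))\<^sup>2) = state.expectation V"
    using nn_integral_output2 by (subst (asm) nn_integral_eq_integrable, auto)+
qed

text \<open>The information density in nats: joint density over the product of the marginals, with
  the input density cancelled.\<close>

definition log_ratio :: "'a \<Rightarrow> real" where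
  "log_ratio \<omega> = ln (W (y \<omega>) (s \<omega>) / p (y \<omega>))"

text \<open>Gibbs' inequality presupposes this. Both logarithms are at most quadratic in input and
  output, whose second moments are finite.\<close>

lemma integrable_log_ratio: "integrable \<Omega> log_ratio"
proof (rule Bochner_Integration.integrable_bound)
  let ?EG = "state.expectation (\<lambda>x. (cmod (G x))\<^sup>2)"
  let ?c = "2 * \<bar>ln (pi * d0)\<bar> + pi * state.expectation D + pi * state.expectation V"
  let ?B = "\<lambda>\<omega>. ?c + (2 * (cmod (y \<omega>))\<^sup>2 + 2 * ?EG * (cmod (s \<omega>))\<^sup>2) / d0 + (cmod (y \<omega>))\<^sup>2 / d0"
  show "integrable \<Omega> ?B"
    using integrable_output2 integrable_input2 by simp
  show "log_ratio \<in> borel_measurable \<Omega>"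
    unfolding log_ratio_def by measurable
  show "AE \<omega> in \<Omega>. norm (log_ratio \<omega>) \<le> norm (?B \<omega>)"
  proof (rule AE_I2)
    fix \<omega>
    let ?b = "y \<omega>" and ?a = "s \<omega>"
    have "\<bar>ln (W ?b ?a)\<bar> \<le> \<bar>ln (pi * d0)\<bar> + pi * state.expectation D + state.expectation (\<lambda>x. (cmod (?b - G x * ?a))\<^sup>2) / d0"
      unfolding W_def using integrable_cmod2_affine integrable_D D_ge by (intro expectation_cgauss_bounds) auto
    also have "state.expectation (\<lambda>x. (cmod (?b - G x * ?a))\<^sup>2) / d0 \<le> (2 * (cmod ?b)\<^sup>2 + 2 * ?EG * (cmod ?a)\<^sup>2) / d0"
      using d0_pos expectation_cmod2_affine by (intro divide_right_mono) auto
    finally have 1: "\<bar>ln (W ?b ?a)\<bar> \<le> \<bar>ln (pi * d0)\<bar> + pi * state.expectation D + (2 * (cmod ?b)\<^sup>2 + 2 * ?EG * (cmod ?a)\<^sup>2) / d0"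
      by simp
    have "\<bar>ln (p ?b)\<bar> \<le> \<bar>ln (pi * d0)\<bar> + pi * state.expectation V + state.expectation (\<lambda>x. (cmod ?b)\<^sup>2) / d0"
      unfolding p_def using integrable_V V_ge by (intro expectation_cgauss_bounds) auto
    then have 2: "\<bar>ln (p ?b)\<bar> \<le> \<bar>ln (pi * d0)\<bar> + pi * state.expectation V + (cmod ?b)\<^sup>2 / d0"
      by (simp add: state.prob_space)
    have "log_ratio \<omega> = ln (W ?b ?a) - ln (p ?b)"
      using W_pos p_pos by (simp add: log_ratio_def ln_div less_imp_neq[symmetric])
    then have "\<bar>log_ratio \<omega>\<bar> \<le> ?B \<omega>"
      using 1 2 by linarith
    then show "norm (log_ratio \<omega>) \<le> norm (?B \<omega>)" by simp
  qed
qed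

text \<open>\<open>distr\<close> sees only the sets of its target, so \<open>borel\<close> may be
  replaced by \<open>lborel\<close>, for which mutual information has a density formula; the input
  density then cancels.\<close>

lemma mutual_information_eq: "mutual_information 2 borel borel y s = expectation log_ratio / ln 2"
proof -
  interpret information_space \<Omega> 2 by standard simp
  let ?f = "\<lambda>z. (case z of (b, a) \<Rightarrow> W b a * cgauss q a)"
  have "mutual_information 2 borel borel y s = mutual_information 2 lborel lborel y s"
  proof -
    have "distr \<Omega> borel X = distr \<Omega> lborel X" for X :: "'a \<Rightarrow> complex" by (rule distr_cong) auto
    moreover have "distr \<Omega> (borel \<Otimes>\<^sub>M borel) (\<lambda>\<omega>. (y \<omega>, s \<omega>)) = distr \<Omega> (lborel \<Otimes>\<^sub>M lborel) (\<lambda>\<omega>. (y \<omega>, s \<omega>))"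
      by (rule distr_cong) (auto intro: sets_pair_measure_cong)
    ultimately show ?thesis by (simp add: mutual_information_def)
  qed
  also have "\<dots> = (\<integral>z. ?f z * log 2 (?f z / (p (fst z) * cgauss q (snd z))) \<partial>(lborel \<Otimes>\<^sub>M lborel))"
    using distributed_pair p_pos W_pos q_pos
    by (intro mutual_information_distr distributed_output distributed_input)
      (auto simp: split_beta' less_imp_le cgauss_nonneg lborel.sigma_finite_measure_axioms)
  also have "\<dots> = expectation (\<lambda>\<omega>. log 2 (?f (y \<omega>, s \<omega>) / (p (y \<omega>) * cgauss q (s \<omega>))))"
    using distributed_pair W_pos q_pos
    by (subst distributed_integral[where X="\<lambda>\<omega>. (y \<omega>, s \<omega>)"])
      (auto simp: split_beta' less_imp_le cgauss_nonneg)
  also have "\<dots> = expectation (\<lambda>\<omega>. log_ratio \<omega> / ln 2)"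
  proof -
    have "cgauss q a \<noteq> 0" for a using cgauss_pos[OF q_pos, of a] by simp
    then show ?thesis by (simp add: log_def log_ratio_def)
  qed
  finally show ?thesis by simp
qed

text \<open>Here and in \<open>nn_integral_output2_normalised\<close> the normalised power has mean
  1 whatever the state. In the log-likelihood ratio with known state the two quadratic terms
  therefore cancel in the mean, and only the SINR term remains.\<close>

lemma nn_integral_noise2:
  "(\<integral>\<^sup>+\<omega>. ennreal ((cmod (y \<omega> - G (H \<omega>) * s \<omega>))\<^sup>2 / D (H \<omega>)) \<partial>\<Omega>) = 1"
proof -
  have "(\<integral>\<^sup>+b. ennreal ((cmod b)\<^sup>2 / D x) \<partial>CN (D x)) = 1" for x
    by (rule nn_integral_CN_cmod2_normalised) (rule D_pos)
  then show ?thesis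
    using law[of "\<lambda>(x, a, b). ennreal ((cmod (b - G x * a))\<^sup>2 / D x)"] q_pos
    by (simp add: prob_space.emeasure_space_1[OF prob_space_CN[OF q_pos], simplified] state.emeasure_space_1)
qed

lemma nn_integral_output2_normalised:
  "(\<integral>\<^sup>+\<omega>. ennreal ((cmod (y \<omega>))\<^sup>2 / V (H \<omega>)) \<partial>\<Omega>) = 1"
proof -
  have "(\<integral>\<^sup>+b. ennreal ((cmod b)\<^sup>2 / V x) \<partial>CN (V x)) = 1" for x
    by (rule nn_integral_CN_cmod2_normalised) (rule V_pos)
  then show ?thesis
    using law_output[of "\<lambda>(x, b). ennreal ((cmod b)\<^sup>2 / V x)"]
    by (simp add: state.emeasure_space_1)
qed

lemma integrable_ln_sinr: "integrable \<nu> (\<lambda>x. ln (1 + q * (cmod (G x))\<^sup>2 / D x))"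
proof (rule Bochner_Integration.integrable_bound)
  show "integrable \<nu> (\<lambda>x. q * (cmod (G x))\<^sup>2 / d0)" using integrable_G2 by simp
  show "AE x in \<nu>. norm (ln (1 + q * (cmod (G x))\<^sup>2 / D x)) \<le> norm (q * (cmod (G x))\<^sup>2 / d0)"
  proof (rule AE_I2)
    fix x
    have nn: "0 \<le> q * (cmod (G x))\<^sup>2 / D x" using q_pos D_pos[of x] by simp
    have "ln (1 + q * (cmod (G x))\<^sup>2 / D x) \<le> q * (cmod (G x))\<^sup>2 / D x"
      by (rule ln_add_one_self_le_self) (rule nn)
    also have "\<dots> \<le> q * (cmod (G x))\<^sup>2 / d0"
      using q_pos D_ge[of x] d0_pos by (intro divide_left_mono) auto
    finally have "ln (1 + q * (cmod (G x))\<^sup>2 / D x) \<le> q * (cmod (G x))\<^sup>2 / d0" .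
    moreover have "0 \<le> ln (1 + q * (cmod (G x))\<^sup>2 / D x)" using nn by simp
    ultimately show "norm (ln (1 + q * (cmod (G x))\<^sup>2 / D x)) \<le> norm (q * (cmod (G x))\<^sup>2 / d0)"
      unfolding real_norm_def by linarith
  qed
qed measurable

text \<open>Revealing the state to the decoder bounds the information from above: the likelihood ratio of
  the channel with known state is the comparison function in Gibbs' inequality.\<close>

theorem mutual_information_le:
  "mutual_information 2 borel borel y s \<le> state.expectation (\<lambda>x. log 2 (1 + q * (cmod (G x))\<^sup>2 / D x))"
proof -
  define r where "r \<omega> = W (y \<omega>) (s \<omega>) / p (y \<omega>)" for \<omega>
  \<comment> \<open>Density of the output given state and input, over its density given the state
    alone.\<close>
  define rH where "rH \<omega> = cgauss (D (H \<omega>)) (y \<omega> - G (H \<omega>) * s \<omega>) / cgauss (V (H \<omega>)) (y \<omega>)" for \<omega>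
  have rpos: "0 < r \<omega>" "0 < rH \<omega>" for \<omega>
    unfolding r_def rH_def using W_pos p_pos D_pos V_pos by (auto intro!: divide_pos_pos cgauss_pos)
  have [measurable]: "r \<in> borel_measurable \<Omega>" "rH \<in> borel_measurable \<Omega>"
    unfolding r_def rH_def by measurable
  have ln_r: "ln (r \<omega>) = log_ratio \<omega>" for \<omega> by (simp add: r_def log_ratio_def)
  have ln_rH: "ln (rH \<omega>) = ln (1 + q * (cmod (G (H \<omega>)))\<^sup>2 / D (H \<omega>)) + (cmod (y \<omega>))\<^sup>2 / V (H \<omega>)
      - (cmod (y \<omega> - G (H \<omega>) * s \<omega>))\<^sup>2 / D (H \<omega>)" for \<omega>
  proof -
    have "ln (rH \<omega>) = ln (pi * V (H \<omega>)) - ln (pi * D (H \<omega>)) + (cmod (y \<omega>))\<^sup>2 / V (H \<omega>)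
      - (cmod (y \<omega> - G (H \<omega>) * s \<omega>))\<^sup>2 / D (H \<omega>)"
      unfolding rH_def using D_pos V_pos by (simp add: ln_div cgauss_pos less_imp_neq[symmetric] ln_cgauss)
    also have "ln (pi * V (H \<omega>)) - ln (pi * D (H \<omega>)) = ln (V (H \<omega>) / D (H \<omega>))"
      using D_pos[of "H \<omega>"] V_pos[of "H \<omega>"] by (simp add: ln_div ln_mult)
    also have "V (H \<omega>) / D (H \<omega>) = 1 + q * (cmod (G (H \<omega>)))\<^sup>2 / D (H \<omega>)"
      using D_pos[of "H \<omega>"] by (simp add: V_def divide_simps)
    finally show ?thesis .
  qed
  have i1: "integrable \<Omega> (\<lambda>\<omega>. ln (1 + q * (cmod (G (H \<omega>)))\<^sup>2 / D (H \<omega>)))"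
    using integrable_ln_sinr by (subst (asm) distr_state[symmetric], subst (asm) integrable_distr_eq) auto
  have e1: "expectation (\<lambda>\<omega>. ln (1 + q * (cmod (G (H \<omega>)))\<^sup>2 / D (H \<omega>))) = state.expectation (\<lambda>x. ln (1 + q * (cmod (G x))\<^sup>2 / D x))"
    using integral_distr[of H \<Omega> \<nu> "\<lambda>x. ln (1 + q * (cmod (G x))\<^sup>2 / D x)"] by (simp add: distr_state)
  have nonneg: "0 \<le> (cmod (y \<omega>))\<^sup>2 / V (H \<omega>)" "0 \<le> (cmod (y \<omega> - G (H \<omega>) * s \<omega>))\<^sup>2 / D (H \<omega>)" for \<omega>
    using D_pos[of "H \<omega>"] V_pos[of "H \<omega>"] by auto
  have i2: "has_bochner_integral \<Omega> (\<lambda>\<omega>. (cmod (y \<omega>))\<^sup>2 / V (H \<omega>)) 1"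
    using nonneg nn_integral_output2_normalised by (intro has_bochner_integral_nn_integral) auto
  have i3: "has_bochner_integral \<Omega> (\<lambda>\<omega>. (cmod (y \<omega> - G (H \<omega>) * s \<omega>))\<^sup>2 / D (H \<omega>)) 1"
    using nonneg nn_integral_noise2 by (intro has_bochner_integral_nn_integral) auto
  have irH: "integrable \<Omega> (\<lambda>\<omega>. ln (rH \<omega>))" and erH: "expectation (\<lambda>\<omega>. ln (rH \<omega>)) = state.expectation (\<lambda>x. ln (1 + q * (cmod (G x))\<^sup>2 / D x))"
    unfolding ln_rH using i1 i2 i3 e1 by (auto simp: has_bochner_integral_iff)
  \<comment> \<open>The true conditional density cancels against the numerator of \<open>rH\<close>.
    What is left depends on the state only through \<open>cgauss (V x) b\<close>, whose average is
    \<open>p b\<close>; the total is the mass of the pair density.\<close>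
  have le1: "(\<integral>\<^sup>+\<omega>. ennreal (r \<omega> / rH \<omega>) \<partial>\<Omega>) = 1"
  proof -
    have ratio: "ennreal (cgauss q a) * (ennreal (cgauss (D x) (b - G x * a)) *
        ennreal ((W b a / p b) / (cgauss (D x) (b - G x * a) / cgauss (V x) b)))
      = ennreal (cgauss q a * W b a / p b) * ennreal (cgauss (V x) b)" for x a b
      using cgauss_pos[OF q_pos, of a] W_pos[of b a] p_pos[of b] cgauss_pos[OF D_pos, of x "b - G x * a"] cgauss_pos[OF V_pos, of x b]
      by (simp add: ennreal_mult'[symmetric] less_imp_le field_simps)
    have "(\<integral>\<^sup>+\<omega>. ennreal (r \<omega> / rH \<omega>) \<partial>\<Omega>) = (\<integral>\<^sup>+x. \<integral>\<^sup>+a. \<integral>\<^sup>+b. ennreal (cgauss q a * W b a / p b) * ennreal (cgauss (V x) b) \<partial>lborel \<partial>lborel \<partial>\<nu>)"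
    proof -
      have m: "(\<lambda>(x, a, b). ennreal ((W b a / p b) / (cgauss (D x) (b - G x * a) / cgauss (V x) b)))
          \<in> borel_measurable (\<nu> \<Otimes>\<^sub>M (borel \<Otimes>\<^sub>M borel))" by measurable
      show ?thesis using law_lborel[OF m] by (simp only: prod.case ratio r_def rH_def)
    qed
    also have "\<dots> = (\<integral>\<^sup>+a. \<integral>\<^sup>+x. \<integral>\<^sup>+b. ennreal (cgauss q a * W b a / p b) * ennreal (cgauss (V x) b) \<partial>lborel \<partial>\<nu> \<partial>lborel)"
      by (rule Fubini'[symmetric]) measurable
    also have "\<dots> = (\<integral>\<^sup>+a. \<integral>\<^sup>+b. \<integral>\<^sup>+x. ennreal (cgauss q a * W b a / p b) * ennreal (cgauss (V x) b) \<partial>\<nu> \<partial>lborel \<partial>lborel)"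
      by (intro nn_integral_cong Fubini'[symmetric]) measurable
    also have "\<dots> = (\<integral>\<^sup>+a. \<integral>\<^sup>+b. ennreal (W b a * cgauss q a) * 1 \<partial>lborel \<partial>lborel)"
    proof (intro nn_integral_cong)
      fix a b
      have "ennreal (cgauss q a * W b a / p b) * ennreal (p b) = ennreal (W b a * cgauss q a)"
        using cgauss_pos[OF q_pos, of a] W_pos[of b a] p_pos[of b]
        by (simp add: ennreal_mult'[symmetric] less_imp_le mult.commute)
      then show "(\<integral>\<^sup>+x. ennreal (cgauss q a * W b a / p b) * ennreal (cgauss (V x) b) \<partial>\<nu>) = ennreal (W b a * cgauss q a) * 1"
        by (simp add: nn_integral_cmult ennreal_p[symmetric])
    qed
    also have "\<dots> = 1"
      using law_pair[of "\<lambda>_. 1"] by (simp add: emeasure_space_1)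
    finally show ?thesis .
  qed
  have ln_div': "ln (r \<omega> / rH \<omega>) = log_ratio \<omega> - ln (rH \<omega>)" for \<omega>
    using rpos[of \<omega>] by (simp add: ln_div ln_r)
  have "expectation (\<lambda>\<omega>. ln (r \<omega> / rH \<omega>)) \<le> 0"
    using rpos le1 irH integrable_log_ratio by (intro gibbs_le) (auto simp: ln_div')
  then have "expectation log_ratio \<le> expectation (\<lambda>\<omega>. ln (rH \<omega>))"
    using irH integrable_log_ratio by (simp add: ln_div')
  then show ?thesis
    by (simp add: mutual_information_eq erH log_def divide_right_mono)
qed

text \<open>The decoder that treats the channel as \<open>y = \<mu> s + v\<close>, with \<open>v\<close> an independent Gaussian of the
  true variance, bounds the information from below.\<close>

theorem mutual_information_ge:
  fixes \<mu> :: complex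
  assumes mu: "\<mu> = state.expectation G"
  defines "N \<equiv> state.expectation D + q * state.expectation (\<lambda>x. (cmod (G x - \<mu>))\<^sup>2)"
  shows "log 2 (1 + q * (cmod \<mu>)\<^sup>2 / N) \<le> mutual_information 2 borel borel y s"
proof -
  have iG: "integrable \<nu> G"
  proof (rule Bochner_Integration.integrable_bound)
    show "integrable \<nu> (\<lambda>x. 1 + (cmod (G x))\<^sup>2)" using integrable_G2 by simp
    have "cmod (G x) \<le> 1 + (cmod (G x))\<^sup>2" for x
    proof -
      have "2 * cmod (G x) \<le> 1 + (cmod (G x))\<^sup>2" using sum_squares_bound[of 1 "cmod (G x)"] by simp
      then show ?thesis using norm_ge_zero[of "G x"] by linarith
    qed
    then show "AE x in \<nu>. cmod (G x) \<le> norm (1 + (cmod (G x))\<^sup>2)" by simp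
  qed measurable
  define R where "R x = Re (cnj \<mu> * G x)" for x
  have iR: "integrable \<nu> R" unfolding R_def using iG by (intro integrable_Re) simp
  have sq: "(cmod (G x - \<mu>))\<^sup>2 = (cmod (G x))\<^sup>2 - 2 * R x + (cmod \<mu>)\<^sup>2" for x
    unfolding cmod_power2 R_def by (simp add: power2_eq_square algebra_simps)
  have iGm: "integrable \<nu> (\<lambda>x. (cmod (G x - \<mu>))\<^sup>2)"
    unfolding sq using integrable_G2 iR by simp
  have "state.expectation (\<lambda>x. (cmod (G x - \<mu>))\<^sup>2)
      = state.expectation (\<lambda>x. (cmod (G x))\<^sup>2) - 2 * state.expectation R + (cmod \<mu>)\<^sup>2"
    unfolding sq using integrable_G2 iR by (simp add: state.prob_space)
  also have "state.expectation R = (cmod \<mu>)\<^sup>2"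
  proof -
    have "state.expectation R = Re (state.expectation (\<lambda>x. cnj \<mu> * G x))"
      unfolding R_def using iG by (intro integral_Re) simp
    also have "\<dots> = Re (cnj \<mu> * \<mu>)" by (simp add: mu)
    finally show ?thesis unfolding cmod_power2 by (simp add: power2_eq_square)
  qed
  finally have EG2: "state.expectation (\<lambda>x. (cmod (G x))\<^sup>2) = state.expectation (\<lambda>x. (cmod (G x - \<mu>))\<^sup>2) + (cmod \<mu>)\<^sup>2"
    by simp
  \<comment> \<open>The total output power: deviation and mean part of the gain add without a cross
    term because \<open>\<mu>\<close> is the mean of \<open>G\<close>.\<close>
  define N' where "N' = N + (cmod \<mu>)\<^sup>2 * q"
  have EV: "state.expectation V = N'"
    unfolding V_def N'_def N_def using integrable_D integrable_G2 by (simp add: EG2 algebra_simps)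
  have "0 < state.expectation D" using integrable_D D_pos by (intro state.expectation_greater) auto
  moreover have "0 \<le> q * state.expectation (\<lambda>x. (cmod (G x - \<mu>))\<^sup>2)" using q_pos by simp
  ultimately have N_pos: "0 < N" by (simp add: N_def)
  have N'_pos: "0 < N'" unfolding N'_def using N_pos q_pos by (simp add: add_pos_nonneg)
  \<comment> \<open>Relative to \<open>\<mu> s\<close> the residual is the Gaussian noise plus
    \<open>(G - \<mu>) s\<close>, which are independent given the state.\<close>
  have nn: "(\<integral>\<^sup>+\<omega>. ennreal ((cmod (y \<omega> - \<mu> * s \<omega>))\<^sup>2) \<partial>\<Omega>) = ennreal N"
  proof -
    have "(\<integral>\<^sup>+\<omega>. ennreal ((cmod (y \<omega> - \<mu> * s \<omega>))\<^sup>2) \<partial>\<Omega>)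
       = (\<integral>\<^sup>+x. \<integral>\<^sup>+a. \<integral>\<^sup>+b. ennreal ((cmod (b + (G x - \<mu>) * a))\<^sup>2) \<partial>CN (D x) \<partial>CN q \<partial>\<nu>)"
      using law[of "\<lambda>(x, a, b). ennreal ((cmod (b - \<mu> * a))\<^sup>2)"] by (simp add: algebra_simps)
    also have "\<dots> = (\<integral>\<^sup>+x. ennreal (D x + (cmod (G x - \<mu>))\<^sup>2 * q) \<partial>\<nu>)"
    proof (rule nn_integral_cong)
      fix x
      have "0 < D x + (cmod (G x - \<mu>))\<^sup>2 * q" using D_pos[of x] q_pos by (simp add: add_pos_nonneg)
      then show "(\<integral>\<^sup>+a. \<integral>\<^sup>+b. ennreal ((cmod (b + (G x - \<mu>) * a))\<^sup>2) \<partial>CN (D x) \<partial>CN q) = ennreal (D x + (cmod (G x - \<mu>))\<^sup>2 * q)"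
        by (subst CN_linear[OF D_pos q_pos, where f="\<lambda>b. ennreal ((cmod b)\<^sup>2)"]) (simp_all add: nn_integral_CN_cmod2)
    qed
    also have "\<dots> = ennreal N"
      using integrable_D iGm D_pos q_pos
      by (subst nn_integral_eq_integral) (auto simp: N_def less_imp_le add_nonneg_nonneg mult.commute)
    finally show ?thesis .
  qed
  have i3: "has_bochner_integral \<Omega> (\<lambda>\<omega>. (cmod (y \<omega> - \<mu> * s \<omega>))\<^sup>2) N"
    using nn N_pos by (intro has_bochner_integral_nn_integral) auto
  define r where "r \<omega> = W (y \<omega>) (s \<omega>) / p (y \<omega>)" for \<omega>
  \<comment> \<open>The likelihood ratio of the fictitious channel, with noise variance
    \<open>N\<close> and output variance \<open>N'\<close>.\<close>
  define t where "t \<omega> = cgauss N (y \<omega> - \<mu> * s \<omega>) / cgauss N' (y \<omega>)" for \<omega>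
  have rpos: "0 < r \<omega>" "0 < t \<omega>" for \<omega>
    unfolding r_def t_def using W_pos p_pos N_pos N'_pos by (auto intro!: divide_pos_pos cgauss_pos)
  have [measurable]: "r \<in> borel_measurable \<Omega>" "t \<in> borel_measurable \<Omega>"
    unfolding r_def t_def by measurable
  have ln_r: "ln (r \<omega>) = log_ratio \<omega>" for \<omega> by (simp add: r_def log_ratio_def)
  have ln_t: "ln (t \<omega>) = ln (1 + q * (cmod \<mu>)\<^sup>2 / N) + (cmod (y \<omega>))\<^sup>2 / N'
      - (cmod (y \<omega> - \<mu> * s \<omega>))\<^sup>2 / N" for \<omega>
  proof -
    have "ln (t \<omega>) = ln (pi * N') - ln (pi * N) + (cmod (y \<omega>))\<^sup>2 / N' - (cmod (y \<omega> - \<mu> * s \<omega>))\<^sup>2 / N"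
      unfolding t_def using N_pos N'_pos by (simp add: ln_div cgauss_pos less_imp_neq[symmetric] ln_cgauss)
    also have "ln (pi * N') - ln (pi * N) = ln (N' / N)"
      using N_pos N'_pos by (simp add: ln_div ln_mult)
    also have "N' / N = 1 + q * (cmod \<mu>)\<^sup>2 / N"
      using N_pos by (simp add: N'_def divide_simps)
    finally show ?thesis .
  qed
  have it: "integrable \<Omega> (\<lambda>\<omega>. ln (t \<omega>))" and et: "expectation (\<lambda>\<omega>. ln (t \<omega>)) = ln (1 + q * (cmod \<mu>)\<^sup>2 / N)"
    unfolding ln_t using i3 integrable_output2 expectation_output2 N_pos N'_pos
    by (auto simp: has_bochner_integral_iff EV prob_space)
  \<comment> \<open>\<open>W\<close> cancels. Integrating out the input convolves the remaining
    factors to \<open>cgauss N' b\<close>, which cancels in turn and leaves the density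
    \<open>p\<close>.\<close>
  have le1: "(\<integral>\<^sup>+\<omega>. ennreal (t \<omega> / r \<omega>) \<partial>\<Omega>) = 1"
  proof -
    have ratio: "ennreal (W b a * cgauss q a) * ennreal ((cgauss N (b - \<mu> * a) / cgauss N' b) / (W b a / p b))
      = ennreal (p b / cgauss N' b) * (ennreal (cgauss N (b - \<mu> * a)) * ennreal (cgauss q a))" for a b
      using cgauss_pos[OF q_pos, of a] W_pos[of b a] p_pos[of b] cgauss_pos[OF N_pos, of "b - \<mu> * a"] cgauss_pos[OF N'_pos, of b]
      by (simp add: ennreal_mult'[symmetric] less_imp_le field_simps)
    have "(\<integral>\<^sup>+\<omega>. ennreal (t \<omega> / r \<omega>) \<partial>\<Omega>) = (\<integral>\<^sup>+a. \<integral>\<^sup>+b. ennreal (p b / cgauss N' b) * (ennreal (cgauss N (b - \<mu> * a)) * ennreal (cgauss q a)) \<partial>lborel \<partial>lborel)"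
    proof -
      have m: "(\<lambda>(b, a). ennreal ((cgauss N (b - \<mu> * a) / cgauss N' b) / (W b a / p b)))
          \<in> borel_measurable (borel \<Otimes>\<^sub>M borel)" by measurable
      show ?thesis using law_pair[OF m] by (simp only: prod.case ratio r_def t_def)
    qed
    also have "\<dots> = (\<integral>\<^sup>+b. \<integral>\<^sup>+a. ennreal (p b / cgauss N' b) * (ennreal (cgauss N (b - \<mu> * a)) * ennreal (cgauss q a)) \<partial>lborel \<partial>lborel)"
      by (rule lborel_pair.Fubini') measurable
    also have "\<dots> = (\<integral>\<^sup>+b. ennreal (p b) * 1 \<partial>lborel)"
    proof (intro nn_integral_cong)
      fix b
      have "ennreal (p b / cgauss N' b) * ennreal (cgauss N' b) = ennreal (p b)"
        using p_pos[of b] cgauss_pos[OF N'_pos, of b] by (simp add: ennreal_mult'[symmetric] less_imp_le)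
      then show "(\<integral>\<^sup>+a. ennreal (p b / cgauss N' b) * (ennreal (cgauss N (b - \<mu> * a)) * ennreal (cgauss q a)) \<partial>lborel) = ennreal (p b) * 1"
        by (simp add: nn_integral_cmult cgauss_convolution N_pos q_pos N'_def[symmetric])
    qed
    also have "\<dots> = 1"
      using distributed_nn_integral[OF distributed_output, of "\<lambda>_. 1"] by (simp add: emeasure_space_1)
    finally show ?thesis .
  qed
  have ln_div': "ln (t \<omega> / r \<omega>) = ln (t \<omega>) - log_ratio \<omega>" for \<omega>
    using rpos[of \<omega>] by (simp add: ln_div ln_r)
  have "expectation (\<lambda>\<omega>. ln (t \<omega> / r \<omega>)) \<le> 0"
    using rpos le1 it integrable_log_ratio by (intro gibbs_le) (auto simp: ln_div')
  then have "ln (1 + q * (cmod \<mu>)\<^sup>2 / N) \<le> expectation log_ratio"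
    using it integrable_log_ratio by (simp add: ln_div' et)
  then show ?thesis
    by (simp add: mutual_information_eq log_def divide_right_mono)
qed

end

section \<open>Moments of the standard complex Gaussian\<close>

text \<open>The arctangent on the half line, doubled by evenness. This kernel remains in the first
  moment after the substitution \<open>b = a t\<close>.\<close>

lemma nn_integral_inverse_one_plus_square:
  "(\<integral>\<^sup>+t. ennreal (1 / (1 + t\<^sup>2)) \<partial>lborel) = ennreal pi"
proof -
  have "(\<integral>\<^sup>+t. ennreal (1 / (1 + t\<^sup>2)) * indicator {0..} t \<partial>lborel) = ennreal (pi / 2 - arctan 0)"
  proof (rule nn_integral_FTC_atLeast)
    show "(arctan \<longlongrightarrow> pi / 2) at_top" by (rule tendsto_arctan_at_top)
  qed (auto intro!: derivative_eq_intros simp: field_simps power2_eq_square)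
  also have "(\<integral>\<^sup>+t. ennreal (1 / (1 + t\<^sup>2)) * indicator {0..} t \<partial>lborel)
      = (\<integral>\<^sup>+t. ennreal (indicator {0..} t *\<^sub>R (1 / (1 + t\<^sup>2))) \<partial>lborel)"
    by (intro nn_integral_cong) (simp split: split_indicator)
  finally have "has_bochner_integral lborel (\<lambda>t::real. indicator {0..} t *\<^sub>R (1 / (1 + t\<^sup>2))) (pi / 2)"
    by (intro has_bochner_integral_nn_integral) (auto split: split_indicator)
  then have "has_bochner_integral lborel (\<lambda>t::real. 1 / (1 + t\<^sup>2)) (2 * (pi / 2))"
    using has_bochner_integral_even_function[of "\<lambda>t::real. 1 / (1 + t\<^sup>2)" "pi / 2"] by simp
  then show ?thesis
    by (subst nn_integral_eq_integral) (auto simp: has_bochner_integral_iff)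
qed

lemma nn_integral_square_gaussian:
  assumes "0 < c"
  shows "(\<integral>\<^sup>+a. ennreal (a\<^sup>2 * exp (- (c * a\<^sup>2))) \<partial>lborel) = ennreal (sqrt (pi / c) / (2 * c))"
proof -
  \<comment> \<open>The normal density of this variance is \<open>sqrt (c / pi)\<close> times
    \<open>exp (- (c * x^2))\<close>.\<close>
  define \<sigma> where "\<sigma> = sqrt (1 / (2 * c))"
  have s: "0 < \<sigma>" "\<sigma>\<^sup>2 = 1 / (2 * c)" using assms by (auto simp: \<sigma>_def)
  have "has_bochner_integral lborel (\<lambda>x. normal_density 0 \<sigma> x * x\<^sup>2) (1 / (2 * c))"
    using normal_moment_even[OF s(1), of 0 1] assms by (simp add: s(2))
  then have h: "has_bochner_integral lborel (\<lambda>x. sqrt (pi / c) * (normal_density 0 \<sigma> x * x\<^sup>2)) (sqrt (pi / c) * (1 / (2 * c)))"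
    by (intro has_bochner_integral_mult_right) auto
  have e: "sqrt (pi / c) * (normal_density 0 \<sigma> x * x\<^sup>2) = x\<^sup>2 * exp (- (c * x\<^sup>2))" for x
    using assms by (simp add: normal_density_def s(2) mult.commute)
  have h: "has_bochner_integral lborel (\<lambda>x. x\<^sup>2 * exp (- (c * x\<^sup>2))) (sqrt (pi / c) / (2 * c))"
    using h unfolding e by simp
  show ?thesis
    by (subst nn_integral_eq_integral)
      (use h in \<open>auto intro: integrable.intros dest: has_bochner_integral_integral_eq\<close>)
qed

text \<open>The substitution \<open>b = a t\<close> in \<open>|a + i b|\<close> separates the variables.\<close>

lemma nn_integral_CN_cmod: "(\<integral>\<^sup>+x. ennreal (cmod x) \<partial>CN 1) = ennreal (sqrt pi / 2)"
proof -
  let ?g = "\<lambda>a b. ennreal (exp (- (a\<^sup>2 + b\<^sup>2)) / pi * sqrt (a\<^sup>2 + b\<^sup>2))"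
  let ?k = "\<lambda>a t. ennreal (sqrt (1 + t\<^sup>2) / pi) * ennreal (a\<^sup>2 * exp (- ((1 + t\<^sup>2) * a\<^sup>2)))"
  have "(\<integral>\<^sup>+x. ennreal (cmod x) \<partial>CN 1) = (\<integral>\<^sup>+a. \<integral>\<^sup>+b. ?g a b \<partial>lborel \<partial>lborel)"
    by (simp add: nn_integral_CN, subst nn_integral_lborel_complex)
      (auto simp: cgauss_def cmod_def ennreal_mult'[symmetric] intro!: nn_integral_cong)
  also have "\<dots> = (\<integral>\<^sup>+a. \<integral>\<^sup>+t. ?k a t \<partial>lborel \<partial>lborel)"
  \<comment> \<open>The substitution degenerates at \<open>a = 0\<close>, a null set.\<close>
  proof (rule nn_integral_cong_AE, rule AE_I[where N="{0}"])
    show "{a \<in> space lborel. (\<integral>\<^sup>+b. ?g a b \<partial>lborel) \<noteq> (\<integral>\<^sup>+t. ?k a t \<partial>lborel)} \<subseteq> {0}"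
    proof safe
      fix a :: real
      assume ne: "(\<integral>\<^sup>+b. ?g a b \<partial>lborel) \<noteq> (\<integral>\<^sup>+t. ?k a t \<partial>lborel)"
      show "a = 0"
      proof (rule ccontr)
        assume a: "a \<noteq> 0"
        have eq: "ennreal \<bar>a\<bar> * ?g a (0 + a * t) = ?k a t" for t
        proof -
          have e: "a\<^sup>2 + (0 + a * t)\<^sup>2 = (1 + t\<^sup>2) * a\<^sup>2" by (simp add: power_mult_distrib algebra_simps)
          have q: "sqrt ((1 + t\<^sup>2) * a\<^sup>2) = sqrt (1 + t\<^sup>2) * \<bar>a\<bar>" by (simp add: real_sqrt_mult)
          have "\<bar>a\<bar> * (exp (- (a\<^sup>2 + (0 + a * t)\<^sup>2)) / pi * sqrt (a\<^sup>2 + (0 + a * t)\<^sup>2))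
            = (\<bar>a\<bar> * \<bar>a\<bar>) * (exp (- ((1 + t\<^sup>2) * a\<^sup>2)) * (sqrt (1 + t\<^sup>2) / pi))"
            unfolding e q by (simp only: times_divide_eq_left times_divide_eq_right mult_ac)
          also have "\<bar>a\<bar> * \<bar>a\<bar> = a\<^sup>2" by (simp add: power2_eq_square)
          finally have "\<bar>a\<bar> * (exp (- (a\<^sup>2 + (0 + a * t)\<^sup>2)) / pi * sqrt (a\<^sup>2 + (0 + a * t)\<^sup>2))
            = sqrt (1 + t\<^sup>2) / pi * (a\<^sup>2 * exp (- ((1 + t\<^sup>2) * a\<^sup>2)))"
            by (simp only: mult_ac)
          then show ?thesis by (simp add: ennreal_mult'[symmetric])
        qed
        have "(\<integral>\<^sup>+b. ?g a b \<partial>lborel) = (\<integral>\<^sup>+t. ennreal \<bar>a\<bar> * ?g a (0 + a * t) \<partial>lborel)"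
          using a by (subst nn_integral_real_affine[where t=0 and c=a]) (auto simp: nn_integral_cmult)
        then show False using ne unfolding eq by simp
      qed
    qed
  qed auto
  also have "\<dots> = (\<integral>\<^sup>+t. \<integral>\<^sup>+a. ?k a t \<partial>lborel \<partial>lborel)"
    by (rule lborel_pair.Fubini') simp
  \<comment> \<open>With \<open>c = 1 + t^2\<close> the inner moment is a multiple of
    \<open>c powr (- 3 / 2)\<close>; the \<open>sqrt c\<close> in front reduces it to the Cauchy
    kernel.\<close>
  also have "\<dots> = (\<integral>\<^sup>+t. ennreal (sqrt pi / (2 * pi)) * ennreal (1 / (1 + t\<^sup>2)) \<partial>lborel)"
  proof (rule nn_integral_cong)
    fix t :: real
    have p: "0 < 1 + t\<^sup>2" by (simp add: add_pos_nonneg)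
    have "(\<integral>\<^sup>+a. ?k a t \<partial>lborel) = ennreal (sqrt (1 + t\<^sup>2) / pi) * ennreal (sqrt (pi / (1 + t\<^sup>2)) / (2 * (1 + t\<^sup>2)))"
      using p by (simp add: nn_integral_cmult nn_integral_square_gaussian)
    also have "\<dots> = ennreal (sqrt (1 + t\<^sup>2) / pi * (sqrt (pi / (1 + t\<^sup>2)) / (2 * (1 + t\<^sup>2))))"
      using p by (subst ennreal_mult) auto
    also have "sqrt (1 + t\<^sup>2) / pi * (sqrt (pi / (1 + t\<^sup>2)) / (2 * (1 + t\<^sup>2))) = sqrt pi / (2 * pi) * (1 / (1 + t\<^sup>2))"
      using p by (simp add: real_sqrt_divide)
    also have "ennreal \<dots> = ennreal (sqrt pi / (2 * pi)) * ennreal (1 / (1 + t\<^sup>2))"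
      using p by (subst ennreal_mult) auto
    finally show "(\<integral>\<^sup>+a. ?k a t \<partial>lborel) = ennreal (sqrt pi / (2 * pi)) * ennreal (1 / (1 + t\<^sup>2))" .
  qed
  also have "\<dots> = ennreal (sqrt pi / (2 * pi)) * ennreal pi"
    by (subst nn_integral_cmult) (auto simp: nn_integral_inverse_one_plus_square)
  also have "\<dots> = ennreal (sqrt pi / 2)"
    by (subst ennreal_mult[symmetric]) auto
  finally show ?thesis .
qed

text \<open>Expand \<open>(a^2 + b^2)^2\<close>; a real Gaussian of variance \<open>1 / 2\<close>
  has second moment \<open>1 / 2\<close> and fourth moment \<open>3 / 4\<close>. The value bounds
  the fluctuation of squared gains.\<close>

lemma nn_integral_CN_cmod4: "(\<integral>\<^sup>+x. ennreal ((cmod x) ^ 4) \<partial>CN 1) = 2"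
proof -
  let ?n = "normal_density 0 (sqrt (1 / 2))"
  have s: "0 < sqrt (1 / 2)" by simp
  have n: "(\<integral>\<^sup>+x. ennreal (?n x * x ^ (2 * k)) \<partial>lborel) = ennreal (fact (2 * k) / (4 ^ k * fact k))" for k
  proof -
    have h: "has_bochner_integral lborel (\<lambda>x. ?n x * x ^ (2 * k)) (fact (2 * k) / (4 ^ k * fact k))"
      using normal_moment_even[OF s, of 0 k] by simp
    show ?thesis
      by (subst nn_integral_eq_integral)
        (use h in \<open>auto intro: integrable.intros dest: has_bochner_integral_integral_eq\<close>)
  qed
  have moments: "(\<integral>\<^sup>+x. ennreal (?n x) \<partial>lborel) = 1" "(\<integral>\<^sup>+x. ennreal (?n x * x\<^sup>2) \<partial>lborel) = ennreal (1 / 2)"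
    "(\<integral>\<^sup>+x. ennreal (?n x * x ^ 4) \<partial>lborel) = ennreal (3 / 4)"
    using n[of 0] n[of 1] n[of 2] by (simp_all add: fact_numeral)
  have "(\<integral>\<^sup>+x. ennreal ((cmod x) ^ 4) \<partial>CN 1) =
     (\<integral>\<^sup>+a. \<integral>\<^sup>+b. ennreal (?n a * a ^ 4) * ennreal (?n b) + 2 * (ennreal (?n a * a\<^sup>2) * ennreal (?n b * b\<^sup>2))
       + ennreal (?n a) * ennreal (?n b * b ^ 4) \<partial>lborel \<partial>lborel)"
  proof (simp add: nn_integral_CN, subst nn_integral_lborel_complex, simp, intro nn_integral_cong)
    fix a b :: real
    have "cmod (Complex a b) ^ 4 = (a\<^sup>2 + b\<^sup>2)\<^sup>2"
      using power_mult[of "cmod (Complex a b)" 2 2] by (simp add: cmod_power2)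
    then have "cgauss 1 (Complex a b) * cmod (Complex a b) ^ 4 =
        ?n a * a ^ 4 * ?n b + 2 * ((?n a * a\<^sup>2) * (?n b * b\<^sup>2)) + ?n a * (?n b * b ^ 4)"
      by (simp add: cgauss_eq_normal_density algebra_simps power2_eq_square power4_eq_xxxx)
    then have "ennreal (cgauss 1 (Complex a b) * cmod (Complex a b) ^ 4) = 
        ennreal (?n a * a ^ 4 * ?n b + 2 * ((?n a * a\<^sup>2) * (?n b * b\<^sup>2)) + ?n a * (?n b * b ^ 4))" by simp
    also have "\<dots> = ennreal (?n a * a ^ 4) * ennreal (?n b) + 2 * (ennreal (?n a * a\<^sup>2) * ennreal (?n b * b\<^sup>2))
       + ennreal (?n a) * ennreal (?n b * b ^ 4)"
      by (simp add: ennreal_mult ennreal_plus)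
    finally show "ennreal (cgauss 1 (Complex a b)) * ennreal (cmod (Complex a b) ^ 4) =
        ennreal (?n a * a ^ 4) * ennreal (?n b) + 2 * (ennreal (?n a * a\<^sup>2) * ennreal (?n b * b\<^sup>2))
       + ennreal (?n a) * ennreal (?n b * b ^ 4)"
      by (simp add: ennreal_mult' cgauss_nonneg)
  qed
  also have "\<dots> = ennreal (3 / 4) + 2 * (ennreal (1 / 2) * ennreal (1 / 2)) + ennreal (3 / 4)"
    by (simp add: nn_integral_add nn_integral_cmult nn_integral_multc moments)
  also have "\<dots> = ennreal (3 / 4) + ennreal 2 * (ennreal (1 / 2) * ennreal (1 / 2)) + ennreal (3 / 4)"
    by simp
  also have "\<dots> = ennreal (3 / 4 + 2 * (1 / 2 * (1 / 2)) + 3 / 4)"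
  proof -
    have "ennreal (1 / 2 * (1 / 2)) = ennreal (1 / 2) * ennreal (1 / 2)"
      "ennreal (2 * (1 / 2 * (1 / 2))) = ennreal 2 * ennreal (1 / 2 * (1 / 2))"
      by (rule ennreal_mult; simp)+
    moreover have "ennreal (3 / 4 + 2 * (1 / 2 * (1 / 2)) + 3 / 4) = ennreal (3 / 4 + 2 * (1 / 2 * (1 / 2))) + ennreal (3 / 4)"
      "ennreal (3 / 4 + 2 * (1 / 2 * (1 / 2))) = ennreal (3 / 4) + ennreal (2 * (1 / 2 * (1 / 2)))"
      by (rule ennreal_plus; simp)+
    ultimately show ?thesis by (simp only:)
  qed
  also have "3 / 4 + 2 * (1 / 2 * (1 / 2)) + 3 / 4 = (2 :: real)" by simp
  finally show ?thesis by simp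
qed

lemma has_bochner_integral_CN_moments:
  "has_bochner_integral (CN 1) cmod (sqrt pi / 2)"
  "has_bochner_integral (CN 1) (\<lambda>x. (cmod x)\<^sup>2) 1"
  "has_bochner_integral (CN 1) (\<lambda>x. (cmod x) ^ 4) 2"
  using nn_integral_CN_cmod nn_integral_CN_cmod2[of 1] nn_integral_CN_cmod4
  by (auto intro!: has_bochner_integral_nn_integral)

lemma nn_integral_CN_uminus:
  assumes [measurable]: "f \<in> borel_measurable borel"
  shows "(\<integral>\<^sup>+x. f (- x) \<partial>CN v) = (\<integral>\<^sup>+x. f x \<partial>CN v)"
proof -
  have l: "(\<integral>\<^sup>+x. g (- x) \<partial>lborel) = (\<integral>\<^sup>+x. g x \<partial>lborel)" if [measurable]: "g \<in> borel_measurable borel"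
    for g :: "complex \<Rightarrow> ennreal"
    by (subst (2) lborel_affine[of "-1" 0]) (auto simp: nn_integral_density nn_integral_distr)
  have "cgauss v (- x) = cgauss v x" for x by (simp add: cgauss_def)
  then show ?thesis
    using l[of "\<lambda>x. ennreal (cgauss v x) * f x"] by (simp add: nn_integral_CN)
qed

lemma AE_CN_nonzero: "AE x in CN v. x \<noteq> 0"
  unfolding CN_def by (subst AE_density) (auto intro: AE_mp[OF AE_lborel_singleton])

section \<open>Orthogonality by sign flips\<close>

text \<open>The passage from L2 to L1 integrates \<open>2 |X| \<le> t + X^2 / t\<close>.\<close>

lemma (in prob_space) integral_abs_le_of_square:
  fixes X :: "'a \<Rightarrow> real"
  assumes t: "0 < t" and X: "integrable M (\<lambda>x. (X x)\<^sup>2)" "(\<integral>x. (X x)\<^sup>2 \<partial>M) \<le> t\<^sup>2" and [measurable]: "X \<in> borel_measurable M"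
  shows "integrable M X" "(\<integral>x. \<bar>X x\<bar> \<partial>M) \<le> t"
proof -
  show i: "integrable M X" using X by (intro square_integrable_imp_integrable[of X]) auto
  have le: "\<bar>X x\<bar> \<le> (t + (X x)\<^sup>2 / t) / 2" for x
    using sum_squares_bound[of t "\<bar>X x\<bar>"] t by (simp add: field_simps power2_eq_square)
  have "(\<integral>x. \<bar>X x\<bar> \<partial>M) \<le> (\<integral>x. (t + (X x)\<^sup>2 / t) / 2 \<partial>M)"
    using le i X by (intro integral_mono) auto
  also have "\<dots> = (t + (\<integral>x. (X x)\<^sup>2 \<partial>M) / t) / 2"
    using X by (simp add: prob_space)
  also have "\<dots> \<le> (t + t\<^sup>2 / t) / 2"
    using X t by (intro divide_right_mono add_left_mono) auto
  also have "\<dots> = t" using t by (simp add: power2_eq_square)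
  finally show "(\<integral>x. \<bar>X x\<bar> \<partial>M) \<le> t" .
qed

text \<open>The Euclidean setting covers the complex gains, under the real inner product, as well as
  the real fluctuations of the interference power.\<close>

lemma pythagoras:
  fixes X :: "'i \<Rightarrow> 'a \<Rightarrow> 'b::{euclidean_space}"
  assumes fin: "finite A" and [measurable]: "\<And>a. a \<in> A \<Longrightarrow> X a \<in> borel_measurable M"
    and sq: "\<And>a. a \<in> A \<Longrightarrow> integrable M (\<lambda>x. (norm (X a x))\<^sup>2)"
    and orth: "\<And>a b. a \<in> A \<Longrightarrow> b \<in> A \<Longrightarrow> a \<noteq> b \<Longrightarrow> (\<integral>x. X a x \<bullet> X b x \<partial>M) = 0"
  shows "integrable M (\<lambda>x. (norm (\<Sum>a\<in>A. X a x))\<^sup>2)"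
    "(\<integral>x. (norm (\<Sum>a\<in>A. X a x))\<^sup>2 \<partial>M) = (\<Sum>a\<in>A. \<integral>x. (norm (X a x))\<^sup>2 \<partial>M)"
proof -
  have e: "(norm (\<Sum>a\<in>A. X a x))\<^sup>2 = (\<Sum>a\<in>A. \<Sum>b\<in>A. X a x \<bullet> X b x)" for x
    by (simp add: power2_norm_eq_inner inner_sum_left inner_sum_right) (rule sum.swap)
  have i: "integrable M (\<lambda>x. X a x \<bullet> X b x)" if "a \<in> A" "b \<in> A" for a b
  proof (rule Bochner_Integration.integrable_bound)
    show "integrable M (\<lambda>x. (norm (X a x))\<^sup>2 + (norm (X b x))\<^sup>2)" using sq that by simp
    show "(\<lambda>x. X a x \<bullet> X b x) \<in> borel_measurable M" using that by measurable
    have "\<bar>X a x \<bullet> X b x\<bar> \<le> (norm (X a x))\<^sup>2 + (norm (X b x))\<^sup>2" for x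
    proof -
      have "\<bar>X a x \<bullet> X b x\<bar> \<le> norm (X a x) * norm (X b x)" by (rule Cauchy_Schwarz_ineq2)
      also have "\<dots> \<le> 2 * norm (X a x) * norm (X b x)" by simp
      also have "\<dots> \<le> (norm (X a x))\<^sup>2 + (norm (X b x))\<^sup>2" by (rule sum_squares_bound)
      finally show ?thesis .
    qed
    then show "AE x in M. norm (X a x \<bullet> X b x) \<le> norm ((norm (X a x))\<^sup>2 + (norm (X b x))\<^sup>2)" by simp
  qed
  show "integrable M (\<lambda>x. (norm (\<Sum>a\<in>A. X a x))\<^sup>2)"
    unfolding e using i by simp
  have "(\<integral>x. (norm (\<Sum>a\<in>A. X a x))\<^sup>2 \<partial>M) = (\<Sum>a\<in>A. \<Sum>b\<in>A. \<integral>x. X a x \<bullet> X b x \<partial>M)"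
    unfolding e using i by simp
  also have "\<dots> = (\<Sum>a\<in>A. \<Sum>b\<in>A. if a = b then \<integral>x. X a x \<bullet> X b x \<partial>M else 0)"
    using orth by (intro sum.cong) auto
  also have "\<dots> = (\<Sum>a\<in>A. \<integral>x. (norm (X a x))\<^sup>2 \<partial>M)"
    using fin by (simp add: power2_norm_eq_inner)
  finally show "(\<integral>x. (norm (\<Sum>a\<in>A. X a x))\<^sup>2 \<partial>M) = (\<Sum>a\<in>A. \<integral>x. (norm (X a x))\<^sup>2 \<partial>M)" .
qed

definition flip :: "'i \<Rightarrow> ('i \<Rightarrow> 'b::uminus) \<Rightarrow> 'i \<Rightarrow> 'b" where
  "flip i x = x(i := - x i)"

text \<open>The gains are studied on their canonical product space, where a sign flip is a
  measure-preserving map; an abstract probability space need not carry one.\<close>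

locale gaussian_family =
  fixes J :: "'i set"
  assumes finite_J: "finite J"
begin

definition \<nu> :: "('i \<Rightarrow> complex) measure" where "\<nu> = Pi\<^sub>M J (\<lambda>_. CN 1)"

lemma sets_\<nu> [measurable_cong]: "sets \<nu> = sets (Pi\<^sub>M J (\<lambda>_. borel))"
  unfolding \<nu>_def by (rule sets_PiM_cong) auto

sublocale prob_space \<nu>
  unfolding \<nu>_def by (rule prob_space_PiM) (simp add: prob_space_CN)

lemma product_sigma_finite_CN: "product_sigma_finite (\<lambda>_::'i. CN 1)"
  by (intro product_sigma_finite.intro prob_space_imp_sigma_finite prob_space_CN) simp

lemma measurable_coordinate [measurable]: "i \<in> J \<Longrightarrow> (\<lambda>x. x i) \<in> borel_measurable \<nu>"
  by measurable

lemma measurable_flip [measurable]: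
  assumes "i \<in> J"
  shows "flip i \<in> measurable \<nu> \<nu>"
proof -
  have "(\<lambda>x. x(i := - x i)) \<in> measurable (Pi\<^sub>M J (\<lambda>_. borel)) (Pi\<^sub>M J (\<lambda>_. borel :: complex measure))"
    using assms by (intro measurable_fun_upd[where J=J]) auto
  then show ?thesis unfolding flip_def[abs_def] by (simp cong: measurable_cong_sets add: sets_\<nu>)
qed

text \<open>Fubini singles out the coordinate \<open>i\<close>, on which the flip is negation, a
  symmetry of \<open>CN 1\<close>.\<close>

lemma distr_flip:
  assumes i: "i \<in> J"
  shows "distr \<nu> \<nu> (flip i) = \<nu>"
proof (rule measure_eqI)
  interpret product_sigma_finite "\<lambda>_::'i. CN 1" by (rule product_sigma_finite_CN)
  fix A assume "A \<in> sets (distr \<nu> \<nu> (flip i))"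
  then have A: "A \<in> sets \<nu>" by simp
  define J' where "J' = J - {i}"
  have J: "J = insert i J'" "finite J'" "i \<notin> J'" using i finite_J by (auto simp: J'_def)
  have nu': "\<nu> = Pi\<^sub>M (insert i J') (\<lambda>_. CN 1)" by (simp add: \<nu>_def J(1)[symmetric])
  have [measurable]: "indicator A \<in> borel_measurable (Pi\<^sub>M (insert i J') (\<lambda>_. CN 1))"
    unfolding J(1)[symmetric] using A by (simp add: \<nu>_def)
  have [measurable]: "flip i \<in> measurable (Pi\<^sub>M (insert i J') (\<lambda>_. CN 1)) (Pi\<^sub>M (insert i J') (\<lambda>_. CN 1))"
    unfolding J(1)[symmetric] using measurable_flip[OF i] by (simp add: \<nu>_def)
  have "emeasure (distr \<nu> \<nu> (flip i)) A = (\<integral>\<^sup>+x. indicator A (flip i x) \<partial>\<nu>)"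
    using nn_integral_distr[OF measurable_flip[OF i], of "indicator A"] A by simp
  also have "\<dots> = (\<integral>\<^sup>+x. \<integral>\<^sup>+y. indicator A (flip i (x(i := y))) \<partial>CN 1 \<partial>Pi\<^sub>M J' (\<lambda>_. CN 1))"
    unfolding nu' using J(2,3) by (subst product_nn_integral_insert) auto
  also have "\<dots> = (\<integral>\<^sup>+x. \<integral>\<^sup>+y. indicator A (x(i := y)) \<partial>CN 1 \<partial>Pi\<^sub>M J' (\<lambda>_. CN 1))"
  proof (rule nn_integral_cong)
    fix x assume x: "x \<in> space (Pi\<^sub>M J' (\<lambda>_. CN 1))"
    have [measurable]: "(\<lambda>y. x(i := y)) \<in> measurable (CN 1) (Pi\<^sub>M (insert i J') (\<lambda>_. CN 1))"
      using x J(3) by (intro measurable_fun_upd[where J=J']) auto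
    have "(\<lambda>y. indicator A (x(i := y)) :: ennreal) \<in> borel_measurable (CN 1)" by measurable
    then have "(\<lambda>y. indicator A (x(i := y)) :: ennreal) \<in> borel_measurable borel" by simp
    from nn_integral_CN_uminus[OF this]
    show "(\<integral>\<^sup>+y. indicator A (flip i (x(i := y))) \<partial>CN 1) = (\<integral>\<^sup>+y. indicator A (x(i := y)) \<partial>CN 1)"
      by (simp add: flip_def)
  qed
  also have "\<dots> = (\<integral>\<^sup>+x. indicator A x \<partial>\<nu>)"
    unfolding nu' using J(2,3) by (subst product_nn_integral_insert) auto
  also have "\<dots> = emeasure \<nu> A" using A by simp
  finally show "emeasure (distr \<nu> \<nu> (flip i)) A = emeasure \<nu> A" .
qed simp

text \<open>Invariance of \<open>\<nu>\<close> makes the integral its own negative; for a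
  nonintegrable \<open>X\<close> it is 0 by default.\<close>

lemma integral_eq_0_flip:
  fixes X :: "('i \<Rightarrow> complex) \<Rightarrow> 'c::{banach, second_countable_topology}"
  assumes i: "i \<in> J" and [measurable]: "X \<in> borel_measurable \<nu>" and odd: "\<And>x. X (flip i x) = - X x"
  shows "(\<integral>x. X x \<partial>\<nu>) = 0"
proof -
  have "(\<integral>x. X x \<partial>\<nu>) = (\<integral>x. X (flip i x) \<partial>\<nu>)"
    using integral_distr[OF measurable_flip[OF i], of X] by (simp add: distr_flip[OF i])
  also have "\<dots> = - (\<integral>x. X x \<partial>\<nu>)" by (simp add: odd)
  finally have "2 *\<^sub>R (\<integral>x. X x \<partial>\<nu>) = 0" by (metis add.right_inverse scaleR_2)
  then show ?thesis by simp
qed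

text \<open>The working form: two monomials are orthogonal once some coordinate occurs oddly in the
  first and evenly, or not at all, in the second.\<close>

lemma orthogonal_flip:
  fixes X Y :: "('i \<Rightarrow> complex) \<Rightarrow> 'c::euclidean_space"
  assumes "i \<in> J" "X \<in> borel_measurable \<nu>" "Y \<in> borel_measurable \<nu>"
    and "\<And>x. X (flip i x) = - X x" "\<And>x. Y (flip i x) = Y x"
  shows "(\<integral>x. X x \<bullet> Y x \<partial>\<nu>) = 0" "(\<integral>x. Y x \<bullet> X x \<partial>\<nu>) = 0"
  using assms by (auto intro!: integral_eq_0_flip[of i])

lemma has_bochner_integral_coordinates:
  fixes g :: "'i \<Rightarrow> complex \<Rightarrow> real"
  assumes A: "A \<subseteq> J" and g: "\<And>i. i \<in> A \<Longrightarrow> has_bochner_integral (CN 1) (g i) (e i)"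
  shows "has_bochner_integral \<nu> (\<lambda>x. \<Prod>i\<in>A. g i (x i)) (\<Prod>i\<in>A. e i)"
proof -
  interpret product_sigma_finite "\<lambda>_::'i. CN 1" by (rule product_sigma_finite_CN)
  interpret C: prob_space "CN 1" by (simp add: prob_space_CN)
  \<comment> \<open>Padding by the constant 1, of mean 1, extends the product to all of
    \<open>J\<close>.\<close>
  define g' where "g' i = (if i \<in> A then g i else (\<lambda>_. 1))" for i
  have int: "integrable (CN 1) (g' i)" for i
    using g by (auto simp: g'_def has_bochner_integral_iff)
  have eq: "(\<Prod>i\<in>J. g' i (x i)) = (\<Prod>i\<in>A. g i (x i))" for x
    using A finite_J by (intro prod.mono_neutral_cong_right) (auto simp: g'_def)
  have "integrable \<nu> (\<lambda>x. \<Prod>i\<in>J. g' i (x i))"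
    unfolding \<nu>_def by (rule product_integrable_prod[OF finite_J int])
  moreover have "(\<integral>x. (\<Prod>i\<in>J. g' i (x i)) \<partial>\<nu>) = (\<Prod>i\<in>J. integral\<^sup>L (CN 1) (g' i))"
    unfolding \<nu>_def by (rule product_integral_prod[OF finite_J int])
  moreover have "(\<Prod>i\<in>J. integral\<^sup>L (CN 1) (g' i)) = (\<Prod>i\<in>A. e i)"
    using A finite_J g C.prob_space
    by (intro prod.mono_neutral_cong_right) (auto simp: g'_def has_bochner_integral_iff)
  ultimately show ?thesis by (simp add: eq has_bochner_integral_iff)
qed

lemma has_bochner_integral_coordinates2:
  fixes g g' :: "complex \<Rightarrow> real"
  assumes "i \<in> J" "j \<in> J" "i \<noteq> j" "has_bochner_integral (CN 1) g e" "has_bochner_integral (CN 1) g' e'"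
  shows "has_bochner_integral \<nu> (\<lambda>x. g (x i) * g' (x j)) (e * e')"
  using has_bochner_integral_coordinates[of "{i, j}" "\<lambda>l. if l = i then g else g'" "\<lambda>l. if l = i then e else e'"] assms
  by (auto split: if_splits)

lemma has_bochner_integral_coordinates4:
  fixes g g' h h' :: "complex \<Rightarrow> real"
  assumes "{i, j, k, l} \<subseteq> J" "distinct [i, j, k, l]" "has_bochner_integral (CN 1) g e" "has_bochner_integral (CN 1) g' e'"
    "has_bochner_integral (CN 1) h d" "has_bochner_integral (CN 1) h' d'"
  shows "has_bochner_integral \<nu> (\<lambda>x. (g (x i) * g' (x j)) * (h (x k) * h' (x l))) ((e * e') * (d * d'))"
  using has_bochner_integral_coordinates[of "{i, j, k, l}"
      "\<lambda>n. if n = i then g else if n = j then g' else if n = k then h else h'"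
      "\<lambda>n. if n = i then e else if n = j then e' else if n = k then d else d'"] assms
  by (auto simp: mult_ac)

text \<open>Functions of moduli are even in every gain, so flips cannot separate them. Independence
  of disjoint coordinates does, after centring.\<close>

lemma orthogonal_coordinates:
  fixes g g' h h' :: "complex \<Rightarrow> real"
  assumes ijkl: "{i, j, k, l} \<subseteq> J" "distinct [i, j, k, l]" and int: "has_bochner_integral (CN 1) g e" "has_bochner_integral (CN 1) g' e'"
    "has_bochner_integral (CN 1) h d" "has_bochner_integral (CN 1) h' d'"
  shows "(\<integral>x. (g (x i) * g' (x j) - e * e') * (h (x k) * h' (x l) - d * d') \<partial>\<nu>) = 0"
proof -
  note 1 = has_bochner_integral_coordinates4[OF assms]
  have 2: "has_bochner_integral \<nu> (\<lambda>x. g (x i) * g' (x j)) (e * e')"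
    using ijkl int by (intro has_bochner_integral_coordinates2) auto
  have 3: "has_bochner_integral \<nu> (\<lambda>x. h (x k) * h' (x l)) (d * d')"
    using ijkl int by (intro has_bochner_integral_coordinates2) auto
  have "has_bochner_integral \<nu> (\<lambda>x. (g (x i) * g' (x j)) * (h (x k) * h' (x l)) - (e * e') * (h (x k) * h' (x l))
      - (d * d') * (g (x i) * g' (x j)) + (e * e') * (d * d'))
     ((e * e') * (d * d') - (e * e') * (d * d') - (d * d') * (e * e') + (e * e') * (d * d'))"
    using 1 2 3 prob_space
    by (intro has_bochner_integral_add has_bochner_integral_diff has_bochner_integral_mult_right)
      (auto simp: has_bochner_integral_iff)
  then have "has_bochner_integral \<nu> (\<lambda>x. (g (x i) * g' (x j) - e * e') * (h (x k) * h' (x l) - d * d')) 0"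
    by (simp add: algebra_simps)
  then show ?thesis by (rule has_bochner_integral_integral_eq)
qed

lemma AE_nonzero: "AE x in \<nu>. \<forall>i\<in>J. x i \<noteq> 0"
proof -
  have "AE x in \<nu>. x i \<noteq> 0" if "i \<in> J" for i
    unfolding \<nu>_def using that finite_J AE_CN_nonzero[of 1]
    by (intro AE_PiM_component[where P="\<lambda>z. z \<noteq> 0"]) (auto intro: prob_space_CN)
  then show ?thesis using finite_J by (intro AE_finite_allI) auto
qed

end

section \<open>Mean and variance of the effective gains\<close>

text \<open>Each unordered pair is listed once. Over all ordered pairs, \<open>(a, b)\<close> and
  \<open>(b, a)\<close> would give equal terms and spoil the orthogonality used later.\<close>

lemma norm_sum_square_pairs:
  fixes v :: "nat \<Rightarrow> 'b::real_inner"
  assumes "finite A"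
  shows "(norm (\<Sum>a\<in>A. v a))\<^sup>2 = (\<Sum>a\<in>A. (norm (v a))\<^sup>2) + 2 * (\<Sum>(a, b)\<in>{(a, b)\<in>A \<times> A. a < b}. v a \<bullet> v b)"
proof -
  let ?L = "{(a, b)\<in>A \<times> A. a < b}" and ?U = "{(a, b)\<in>A \<times> A. b < a}" and ?E = "(\<lambda>a. (a, a)) ` A"
  have split: "A \<times> A = ?E \<union> (?L \<union> ?U)" by auto
  have fin: "finite ?E" "finite ?L" "finite ?U"
    using assms finite_subset[of ?L "A \<times> A"] finite_subset[of ?U "A \<times> A"] by auto
  have "(norm (\<Sum>a\<in>A. v a))\<^sup>2 = (\<Sum>(a, b)\<in>A \<times> A. v a \<bullet> v b)"
    by (simp add: power2_norm_eq_inner inner_sum_left inner_sum_right sum.cartesian_product[symmetric]) (rule sum.swap)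
  also have "\<dots> = (\<Sum>(a, b)\<in>?E. v a \<bullet> v b) + ((\<Sum>(a, b)\<in>?L. v a \<bullet> v b) + (\<Sum>(a, b)\<in>?U. v a \<bullet> v b))"
  proof -
    have "(\<Sum>(a, b)\<in>A \<times> A. v a \<bullet> v b) = (\<Sum>(a, b)\<in>?E. v a \<bullet> v b) + (\<Sum>(a, b)\<in>?L \<union> ?U. v a \<bullet> v b)"
      by (subst split, rule sum.union_disjoint) (use fin in auto)
    also have "(\<Sum>(a, b)\<in>?L \<union> ?U. v a \<bullet> v b) = (\<Sum>(a, b)\<in>?L. v a \<bullet> v b) + (\<Sum>(a, b)\<in>?U. v a \<bullet> v b)"
      by (rule sum.union_disjoint) (use fin in auto)
    finally show ?thesis .
  qed
  also have "(\<Sum>(a, b)\<in>?E. v a \<bullet> v b) = (\<Sum>a\<in>A. (norm (v a))\<^sup>2)"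
    by (subst sum.reindex) (auto simp: inj_on_def power2_norm_eq_inner)
  also have "(\<Sum>(a, b)\<in>?U. v a \<bullet> v b) = (\<Sum>(a, b)\<in>?L. v a \<bullet> v b)"
    by (rule sum.reindex_bij_witness[where i="\<lambda>(a, b). (b, a)" and j="\<lambda>(a, b). (b, a)"]) (auto simp: inner_commute)
  finally show ?thesis by simp
qed

lemma integral_le_of_bound:
  fixes f :: "'a \<Rightarrow> real"
  assumes "f \<in> borel_measurable N" "\<And>x. 0 \<le> f x" "\<And>x. f x \<le> g x" "has_bochner_integral N g \<beta>"
  shows "integrable N f" "(\<integral>x. f x \<partial>N) \<le> \<beta>"
proof -
  have g: "integrable N g" "integral\<^sup>L N g = \<beta>" using assms(4) by (auto simp: has_bochner_integral_iff)
  have nn: "0 \<le> g x" for x using assms(2,3)[of x] by simp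
  show f: "integrable N f"
    by (rule Bochner_Integration.integrable_bound[OF g(1) assms(1)]) (use assms nn in auto)
  show "(\<integral>x. f x \<partial>N) \<le> \<beta>"
    unfolding g(2)[symmetric] using f g(1) assms(3) by (intro integral_mono) auto
qed

lemma cmod_sgn_le: "cmod (sgn z) \<le> 1" by (simp add: norm_sgn)

lemma borel_measurable_cnj_sgn [measurable (raw)]:
  assumes [measurable]: "f \<in> borel_measurable N"
  shows "(\<lambda>x. cnj (sgn (f x))) \<in> borel_measurable N"
proof -
  have "cnj \<in> borel_measurable borel"
    by (intro borel_measurable_continuous_onI continuous_intros)
  then show ?thesis unfolding sgn_eq by measurable
qed

lemma cnj_sgn_mult: "cnj (sgn z) * z = of_real (cmod z)"
  using complex_norm_square[of z] by (cases "z = 0") (simp_all add: sgn_eq power2_eq_square field_simps)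

definition gain_indices :: "nat \<Rightarrow> nat \<Rightarrow> rv_index set" where
  "gain_indices M K = {Source_Relay_Gain k n | k n. k \<in> {1..K} \<and> n \<in> {1..M}} \<union>
     {Relay_Dest_Gain n k | n k. n \<in> {1..M} \<and> k \<in> {1..K}}"

lemma finite_gain_indices: "finite (gain_indices M K)"
proof -
  have "gain_indices M K = (\<lambda>(k, n). Source_Relay_Gain k n) ` ({1..K} \<times> {1..M}) \<union> (\<lambda>(k, n). Relay_Dest_Gain n k) ` ({1..K} \<times> {1..M})"
    by (auto simp: gain_indices_def)
  then show ?thesis by simp
qed

locale network_gains =
  fixes M K m :: nat
  assumes m: "m \<in> {1..M}" and K: "1 \<le> K"
begin

sublocale gaussian_family "gain_indices M K"
  by standard (rule finite_gain_indices)

lemma M: "1 \<le> M" using m by simp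

lemma gain_indexI: "k \<in> {1..K} \<Longrightarrow> n \<in> {1..M} \<Longrightarrow> Source_Relay_Gain k n \<in> gain_indices M K"
  "k \<in> {1..K} \<Longrightarrow> n \<in> {1..M} \<Longrightarrow> Relay_Dest_Gain n k \<in> gain_indices M K"
  by (auto simp: gain_indices_def)

lemma measurable_gain [measurable]:
  "k \<in> {1..K} \<Longrightarrow> n \<in> {1..M} \<Longrightarrow> (\<lambda>x. x (Source_Relay_Gain k n)) \<in> borel_measurable \<nu>"
  "k \<in> {1..K} \<Longrightarrow> n \<in> {1..M} \<Longrightarrow> (\<lambda>x. x (Relay_Dest_Gain n k)) \<in> borel_measurable \<nu>"
  using gain_indexI by auto

text \<open>\<open>sgn\<close> replaces \<open>phase\<close>: it differs only at \<open>0\<close>, a null event, and is odd everywhere.\<close>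

definition phase_term :: "nat \<Rightarrow> nat \<Rightarrow> (rv_index \<Rightarrow> complex) \<Rightarrow> complex" where
  "phase_term k n x = cnj (sgn (x (Relay_Dest_Gain n k))) * cnj (sgn (x (Source_Relay_Gain k n)))"

definition noise_term :: "nat \<Rightarrow> nat \<Rightarrow> (rv_index \<Rightarrow> complex) \<Rightarrow> complex" where
  "noise_term k n x = cnj (sgn (x (Relay_Dest_Gain n k))) * x (Relay_Dest_Gain m k) * cnj (sgn (x (Source_Relay_Gain k n)))"

definition signal_term :: "nat \<Rightarrow> nat \<Rightarrow> nat \<Rightarrow> (rv_index \<Rightarrow> complex) \<Rightarrow> complex" where
  "signal_term k n m' x = noise_term k n x * x (Source_Relay_Gain k m')"

lemma measurable_terms [measurable]:
  "k \<in> {1..K} \<Longrightarrow> n \<in> {1..M} \<Longrightarrow> phase_term k n \<in> borel_measurable \<nu>"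
  "k \<in> {1..K} \<Longrightarrow> n \<in> {1..M} \<Longrightarrow> noise_term k n \<in> borel_measurable \<nu>"
  "k \<in> {1..K} \<Longrightarrow> n \<in> {1..M} \<Longrightarrow> m' \<in> {1..M} \<Longrightarrow> signal_term k n m' \<in> borel_measurable \<nu>"
  using m unfolding phase_term_def[abs_def] noise_term_def[abs_def] signal_term_def[abs_def] by measurable

lemma cmod_phase_term_le: "cmod (phase_term k n x) \<le> 1"
  unfolding phase_term_def norm_mult complex_mod_cnj by (intro mult_le_one cmod_sgn_le) auto

lemma noise_term_eq: "noise_term k n x = x (Relay_Dest_Gain m k) * phase_term k n x"
  by (simp add: noise_term_def phase_term_def)

lemma signal_term_eq: "signal_term k n m' x = x (Relay_Dest_Gain m k) * x (Source_Relay_Gain k m') * phase_term k n x"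
  by (simp add: signal_term_def noise_term_eq)

text \<open>Where the relay corrects for the pair \<open>m\<close> itself, both phases cancel and
  the term is real and nonnegative. These are the terms that add coherently.\<close>

lemma signal_term_diag: "signal_term k m m x = of_real (cmod (x (Relay_Dest_Gain m k)) * cmod (x (Source_Relay_Gain k m)))"
proof -
  have "signal_term k m m x = (cnj (sgn (x (Relay_Dest_Gain m k))) * x (Relay_Dest_Gain m k)) *
    (cnj (sgn (x (Source_Relay_Gain k m))) * x (Source_Relay_Gain k m))"
    by (simp add: signal_term_def noise_term_def)
  then show ?thesis by (simp add: cnj_sgn_mult)
qed

lemma cmod2_noise_term_le: "(cmod (noise_term k n x))\<^sup>2 \<le> (cmod (x (Relay_Dest_Gain m k)))\<^sup>2 * 1"
proof -
  have "(cmod (phase_term k n x))\<^sup>2 \<le> 1" using cmod_phase_term_le by (simp add: power_le_one)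
  then show ?thesis unfolding noise_term_eq norm_mult power_mult_distrib by (intro mult_left_mono) auto
qed

lemma cmod2_signal_term_le: "(cmod (signal_term k n m' x))\<^sup>2 \<le> (cmod (x (Relay_Dest_Gain m k)))\<^sup>2 * (cmod (x (Source_Relay_Gain k m')))\<^sup>2"
proof -
  have "(cmod (signal_term k n m' x))\<^sup>2 = (cmod (noise_term k n x))\<^sup>2 * (cmod (x (Source_Relay_Gain k m')))\<^sup>2"
    by (simp add: signal_term_def norm_mult power_mult_distrib)
  also have "\<dots> \<le> (cmod (x (Relay_Dest_Gain m k)))\<^sup>2 * (cmod (x (Source_Relay_Gain k m')))\<^sup>2"
    using cmod2_noise_term_le[of k n x] by (intro mult_right_mono) auto
  finally show ?thesis .
qed

lemma has_bochner_integral_weight2: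
  assumes "k \<in> {1..K}" "m' \<in> {1..M}" "has_bochner_integral (CN 1) \<psi> e"
  shows "has_bochner_integral \<nu> (\<lambda>x. (cmod (x (Relay_Dest_Gain m k)))\<^sup>2 * \<psi> (x (Source_Relay_Gain k m'))) e"
  using has_bochner_integral_coordinates2[OF gain_indexI(2)[OF assms(1) m] gain_indexI(1)[OF assms(1,2)] _
      has_bochner_integral_CN_moments(2) assms(3)] by simp

lemma has_bochner_integral_CN_const: "has_bochner_integral (CN 1) (\<lambda>_. c :: real) c"
proof -
  interpret C: prob_space "CN 1" by (simp add: prob_space_CN)
  show ?thesis using C.prob_space by (auto simp: has_bochner_integral_iff)
qed

lemma integrable_cmod2_signal_term:
  assumes "k \<in> {1..K}" "n \<in> {1..M}" "m' \<in> {1..M}"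
  shows "integrable \<nu> (\<lambda>x. (cmod (signal_term k n m' x))\<^sup>2)" "(\<integral>x. (cmod (signal_term k n m' x))\<^sup>2 \<partial>\<nu>) \<le> 1"
proof -
  note b = has_bochner_integral_weight2[OF assms(1,3) has_bochner_integral_CN_moments(2)]
  have "(\<lambda>x. (cmod (signal_term k n m' x))\<^sup>2) \<in> borel_measurable \<nu>" using assms by measurable
  from integral_le_of_bound[OF this _ cmod2_signal_term_le b]
  show "integrable \<nu> (\<lambda>x. (cmod (signal_term k n m' x))\<^sup>2)" "(\<integral>x. (cmod (signal_term k n m' x))\<^sup>2 \<partial>\<nu>) \<le> 1" by auto
qed

lemma integrable_cmod2_noise_term:
  assumes "k \<in> {1..K}" "n \<in> {1..M}"
  shows "integrable \<nu> (\<lambda>x. (cmod (noise_term k n x))\<^sup>2)" "(\<integral>x. (cmod (noise_term k n x))\<^sup>2 \<partial>\<nu>) \<le> 1"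
proof -
  note b = has_bochner_integral_weight2[OF assms(1) m has_bochner_integral_CN_const[of 1]]
  have "(\<lambda>x. (cmod (noise_term k n x))\<^sup>2) \<in> borel_measurable \<nu>" using assms by measurable
  from integral_le_of_bound[OF this _ cmod2_noise_term_le b]
  show "integrable \<nu> (\<lambda>x. (cmod (noise_term k n x))\<^sup>2)" "(\<integral>x. (cmod (noise_term k n x))\<^sup>2 \<partial>\<nu>) \<le> 1" by auto
qed

lemma integrable_signal_term:
  assumes "k \<in> {1..K}" "n \<in> {1..M}" "m' \<in> {1..M}"
  shows "integrable \<nu> (signal_term k n m')"
proof (rule Bochner_Integration.integrable_bound)
  show "integrable \<nu> (\<lambda>x. 1 + (cmod (signal_term k n m' x))\<^sup>2)" using integrable_cmod2_signal_term(1)[OF assms] by simp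
  show "signal_term k n m' \<in> borel_measurable \<nu>" using assms by measurable
  have "cmod z \<le> 1 + (cmod z)\<^sup>2" for z
    using sum_squares_bound[of 1 "cmod z"] norm_ge_zero[of z] by (simp del: norm_ge_zero)
  then show "AE x in \<nu>. norm (signal_term k n m' x) \<le> norm (1 + (cmod (signal_term k n m' x))\<^sup>2)" by simp
qed

text \<open>For \<open>n \<noteq> m\<close> this gain enters the \<open>(k, n)\<close> term through
  its phase alone, and no other term at all. For \<open>n = m\<close> it would also be the
  forwarding factor of every term at relay \<open>k\<close>.\<close>

lemma flip_dest:
  assumes "n \<noteq> m"
  shows "phase_term k n (flip (Relay_Dest_Gain n k) x) = - phase_term k n x"
    "noise_term k n (flip (Relay_Dest_Gain n k) x) = - noise_term k n x"
    "signal_term k n m' (flip (Relay_Dest_Gain n k) x) = - signal_term k n m' x"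
    "(l, q) \<noteq> (k, n) \<Longrightarrow> noise_term l q (flip (Relay_Dest_Gain n k) x) = noise_term l q x"
    "(l, q) \<noteq> (k, n) \<Longrightarrow> signal_term l q m' (flip (Relay_Dest_Gain n k) x) = signal_term l q m' x"
  using assms by (auto simp: phase_term_def signal_term_def noise_term_def flip_def sgn_minus)

text \<open>Phase terms carry no forwarding factor, so \<open>n = m\<close> is covered too.\<close>

lemma flip_dest_phase_term:
  "phase_term k n (flip (Relay_Dest_Gain n k) x) = - phase_term k n x"
  "(l, q) \<noteq> (k, n) \<Longrightarrow> phase_term l q (flip (Relay_Dest_Gain n k) x) = phase_term l q x"
  by (auto simp: phase_term_def flip_def sgn_minus)

text \<open>The flip for the aligned terms \<open>n = m\<close>: a source gain with
  \<open>m' \<noteq> n\<close> enters linearly. If \<open>m' = n\<close>, its own phase corrects it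
  and the term is even.\<close>

lemma flip_source:
  "m' \<noteq> n \<Longrightarrow> signal_term k n m' (flip (Source_Relay_Gain k m') x) = - signal_term k n m' x"
  "l \<noteq> k \<Longrightarrow> signal_term l q m'' (flip (Source_Relay_Gain k m') x) = signal_term l q m'' x"
  "m' \<noteq> q \<Longrightarrow> m' \<noteq> m'' \<Longrightarrow> signal_term l q m'' (flip (Source_Relay_Gain k m') x) = signal_term l q m'' x"
  by (auto simp: signal_term_def noise_term_def flip_def sgn_minus)

text \<open>\<open>pi / 4\<close> is the square of the mean modulus \<open>sqrt pi / 2\<close> of a
  standard gain. A term not aligned with \<open>m\<close> is odd in its destination gain.\<close>

lemma integral_signal_term:
  assumes "k \<in> {1..K}" "n \<in> {1..M}"
  shows "(\<integral>x. signal_term k n m x \<partial>\<nu>) = (if n = m then of_real (pi / 4) else 0)"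
proof (cases "n = m")
  case True
  have "has_bochner_integral \<nu> (\<lambda>x. cmod (x (Relay_Dest_Gain m k)) * cmod (x (Source_Relay_Gain k m))) (sqrt pi / 2 * (sqrt pi / 2))"
    using assms m by (intro has_bochner_integral_coordinates2 gain_indexI has_bochner_integral_CN_moments) auto
  then have e: "(\<integral>x. cmod (x (Relay_Dest_Gain m k)) * cmod (x (Source_Relay_Gain k m)) \<partial>\<nu>) = pi / 4"
    by (simp add: has_bochner_integral_iff)
  show ?thesis unfolding signal_term_diag True integral_complex_of_real e by simp
next
  case False
  have "(\<integral>x. signal_term k n m x \<partial>\<nu>) = 0"
    by (rule integral_eq_0_flip[OF gain_indexI(2)[OF assms]]) (use assms m False flip_dest in auto)
  then show ?thesis using False by simp
qed

text \<open>If one of \<open>n\<close>, \<open>q\<close> differs from \<open>m\<close>, the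
  destination gain of that term is flipped. If both equal \<open>m\<close>, the relays differ, and
  the gain of source \<open>m'\<close> at relay \<open>k\<close> is flipped; the term is odd in it
  because \<open>m' \<noteq> m\<close>.\<close>

lemma orthogonal_interference:
  assumes "k \<in> {1..K}" "n \<in> {1..M}" "l \<in> {1..K}" "q \<in> {1..M}" "m' \<in> {1..M}" "m' \<noteq> m" "(k, n) \<noteq> (l, q)"
  shows "(\<integral>x. signal_term k n m' x \<bullet> signal_term l q m' x \<partial>\<nu>) = 0"
proof -
  have a: "(\<integral>x. signal_term k n m' x \<bullet> signal_term l q m' x \<partial>\<nu>) = 0" if "n \<noteq> m"
    by (rule orthogonal_flip[OF gain_indexI(2)[OF assms(1,2)]]) (use that assms flip_dest in auto)
  have b: "(\<integral>x. signal_term k n m' x \<bullet> signal_term l q m' x \<partial>\<nu>) = 0" if "q \<noteq> m"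
    by (rule orthogonal_flip(2)[OF gain_indexI(2)[OF assms(3,4)]]) (use that assms flip_dest in auto)
  have c: "(\<integral>x. signal_term k n m' x \<bullet> signal_term l q m' x \<partial>\<nu>) = 0" if "n = m" "k \<noteq> l"
    by (rule orthogonal_flip[OF gain_indexI(1)[OF assms(1,5)]]) (use that assms flip_source in auto)
  show ?thesis using a b c assms by auto
qed

lemma orthogonal_noise_term:
  assumes "k \<in> {1..K}" "n \<in> {1..M}" "q \<in> {1..M}" "n \<noteq> q"
  shows "(\<integral>x. noise_term k n x \<bullet> noise_term k q x \<partial>\<nu>) = 0"
proof -
  have a: "(\<integral>x. noise_term k n x \<bullet> noise_term k q x \<partial>\<nu>) = 0" if "n \<noteq> m"
    by (rule orthogonal_flip[OF gain_indexI(2)[OF assms(1,2)]]) (use that assms flip_dest in auto)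
  have b: "(\<integral>x. noise_term k n x \<bullet> noise_term k q x \<partial>\<nu>) = 0" if "q \<noteq> m"
    by (rule orthogonal_flip(2)[OF gain_indexI(2)[OF assms(1,3)]]) (use that assms flip_dest in auto)
  show ?thesis using a b assms by auto
qed

text \<open>For the own source the aligned terms are even in every gain; they are centred at
  \<open>e\<close> and separated by independence across relays. Flips treat all other pairs.\<close>

lemma orthogonal_signal:
  fixes e :: "nat \<Rightarrow> complex"
  defines "e \<equiv> (\<lambda>n. if n = m then of_real (pi / 4) else 0)"
  assumes "k \<in> {1..K}" "n \<in> {1..M}" "l \<in> {1..K}" "q \<in> {1..M}" "(k, n) \<noteq> (l, q)"
  shows "(\<integral>x. (signal_term k n m x - e n) \<bullet> (signal_term l q m x - e q) \<partial>\<nu>) = 0"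
proof -
  note [measurable] = m
  have e0: "e n = 0" if "n \<noteq> m" for n using that by (simp add: e_def)
  have a: "(\<integral>x. (signal_term k n m x - e n) \<bullet> (signal_term l q m x - e q) \<partial>\<nu>) = 0" if "n \<noteq> m"
    by (rule orthogonal_flip[OF gain_indexI(2)[OF assms(2,3)]]) (use that assms m flip_dest e0 in auto)
  have b: "(\<integral>x. (signal_term k n m x - e n) \<bullet> (signal_term l q m x - e q) \<partial>\<nu>) = 0" if "q \<noteq> m"
    by (rule orthogonal_flip(2)[OF gain_indexI(2)[OF assms(4,5)]]) (use that assms m flip_dest e0 in auto)
  have c: "(\<integral>x. (signal_term k n m x - e n) \<bullet> (signal_term l q m x - e q) \<partial>\<nu>) = 0" if "n = m" "q = m" "k \<noteq> l"
  proof -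
    have eq: "(signal_term k n m x - e n) \<bullet> (signal_term l q m x - e q)
      = (cmod (x (Relay_Dest_Gain m k)) * cmod (x (Source_Relay_Gain k m)) - sqrt pi / 2 * (sqrt pi / 2)) *
        (cmod (x (Relay_Dest_Gain m l)) * cmod (x (Source_Relay_Gain l m)) - sqrt pi / 2 * (sqrt pi / 2))" for x
      using that by (simp add: signal_term_diag e_def inner_complex_def)
    show ?thesis unfolding eq
      by (rule orthogonal_coordinates) (use that assms m gain_indexI in \<open>auto intro!: has_bochner_integral_CN_moments\<close>)
  qed
  show ?thesis using a b c assms by auto
qed

text \<open>Centring at the mean lowers the second moment, so the uncentred bound 1
  persists.\<close>

lemma integrable_signal_centered:
  fixes e :: "nat \<Rightarrow> complex"
  defines "e \<equiv> (\<lambda>n. if n = m then of_real (pi / 4) else 0)"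
  assumes "k \<in> {1..K}" "n \<in> {1..M}"
  shows "integrable \<nu> (\<lambda>x. (cmod (signal_term k n m x - e n))\<^sup>2)" "(\<integral>x. (cmod (signal_term k n m x - e n))\<^sup>2 \<partial>\<nu>) \<le> 1"
proof -
  note i1 = integrable_cmod2_signal_term[OF assms(2,3) m] and i2 = integrable_signal_term[OF assms(2,3) m]
  have "integrable \<nu> (\<lambda>x. (cmod (signal_term k n m x - e n))\<^sup>2) \<and> (\<integral>x. (cmod (signal_term k n m x - e n))\<^sup>2 \<partial>\<nu>) \<le> 1"
  proof (cases "n = m")
    case False
    then show ?thesis using i1 by (simp add: e_def)
  next
    case True
    have sq: "(cmod (signal_term k n m x - e n))\<^sup>2 = (cmod (signal_term k n m x))\<^sup>2 - pi / 2 * Re (signal_term k n m x) + (pi / 4)\<^sup>2" for x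
      unfolding cmod_power2 using True by (simp add: e_def power2_eq_square algebra_simps)
    have r: "integrable \<nu> (\<lambda>x. Re (signal_term k n m x))" "(\<integral>x. Re (signal_term k n m x) \<partial>\<nu>) = pi / 4"
      using i2 integral_signal_term[OF assms(2,3)] True by (auto simp: integral_Re simp del: of_real_divide)
    have "(\<integral>x. (cmod (signal_term k n m x - e n))\<^sup>2 \<partial>\<nu>) = (\<integral>x. (cmod (signal_term k n m x))\<^sup>2 \<partial>\<nu>) - pi / 2 * (pi / 4) + (pi / 4)\<^sup>2"
      unfolding sq using i1 r by (simp add: prob_space)
    also have "\<dots> = (\<integral>x. (cmod (signal_term k n m x))\<^sup>2 \<partial>\<nu>) - (pi / 4)\<^sup>2"
      by (simp add: power2_eq_square)
    also have "\<dots> \<le> 1" using i1(2) zero_le_power2[of "pi / 4"] by linarith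
    finally have "(\<integral>x. (cmod (signal_term k n m x - e n))\<^sup>2 \<partial>\<nu>) \<le> 1" .
    moreover have "integrable \<nu> (\<lambda>x. (cmod (signal_term k n m x - e n))\<^sup>2)"
      unfolding sq using i1 r by simp
    ultimately show ?thesis by simp
  qed
  then show "integrable \<nu> (\<lambda>x. (cmod (signal_term k n m x - e n))\<^sup>2)" "(\<integral>x. (cmod (signal_term k n m x - e n))\<^sup>2 \<partial>\<nu>) \<le> 1" by auto
qed

text \<open>The coefficients are left free; the network enters with \<open>c = C_sig m\<close> and,
  for the relay noise, \<open>e = C_noise m\<close>.\<close>

definition gain :: "(nat \<Rightarrow> nat \<Rightarrow> real) \<Rightarrow> nat \<Rightarrow> (rv_index \<Rightarrow> complex) \<Rightarrow> complex" where
  "gain c m' x = of_real (1 / sqrt (real K * real M)) * (\<Sum>k = 1..K. \<Sum>n = 1..M. of_real (c m' k) * signal_term k n m' x)"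

definition noise_gain :: "(nat \<Rightarrow> real) \<Rightarrow> nat \<Rightarrow> (rv_index \<Rightarrow> complex) \<Rightarrow> complex" where
  "noise_gain e k x = of_real (1 / sqrt (real K * real M)) * (\<Sum>n = 1..M. of_real (e k) * noise_term k n x)"

lemma measurable_gains [measurable]:
  "m' \<in> {1..M} \<Longrightarrow> gain c m' \<in> borel_measurable \<nu>"
  "k \<in> {1..K} \<Longrightarrow> noise_gain e k \<in> borel_measurable \<nu>"
  unfolding gain_def[abs_def] noise_gain_def[abs_def] by measurable

lemma KM_pos: "0 < real K * real M" using K M by simp

text \<open>One aligned term per relay survives. With \<open>c = C_sig m\<close> the value is the
  number that the destination knows.\<close>

lemma gain_mean: "(\<integral>x. gain c m x \<partial>\<nu>) = of_real (pi / (4 * sqrt (real K * real M)) * (\<Sum>k = 1..K. c m k))"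
proof -
  have "(\<integral>x. gain c m x \<partial>\<nu>) = of_real (1 / sqrt (real K * real M)) * (\<Sum>k = 1..K. \<Sum>n = 1..M. of_real (c m k) * (\<integral>x. signal_term k n m x \<partial>\<nu>))"
  proof -
    have i: "integrable \<nu> (\<lambda>x. of_real (c m k) * signal_term k n m x)" if "k \<in> {1..K}" "n \<in> {1..M}" for k n
      using integrable_signal_term[OF that m] by simp
    have "(\<integral>x. (\<Sum>k = 1..K. \<Sum>n = 1..M. of_real (c m k) * signal_term k n m x) \<partial>\<nu>)
        = (\<Sum>k = 1..K. \<integral>x. (\<Sum>n = 1..M. of_real (c m k) * signal_term k n m x) \<partial>\<nu>)"
      by (rule Bochner_Integration.integral_sum) (intro Bochner_Integration.integrable_sum i)
    also have "\<dots> = (\<Sum>k = 1..K. \<Sum>n = 1..M. \<integral>x. of_real (c m k) * signal_term k n m x \<partial>\<nu>)"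
      by (intro sum.cong refl Bochner_Integration.integral_sum i)
    finally show ?thesis unfolding gain_def by simp
  qed
  also have "\<dots> = of_real (1 / sqrt (real K * real M)) * (\<Sum>k = 1..K. of_real (c m k) * of_real (pi / 4))"
  proof -
    have "(\<Sum>n = 1..M. of_real (c m k) * (\<integral>x. signal_term k n m x \<partial>\<nu>)) = of_real (c m k) * complex_of_real (pi / 4)"
      if "k \<in> {1..K}" for k
    proof -
      have "(\<Sum>n = 1..M. of_real (c m k) * (\<integral>x. signal_term k n m x \<partial>\<nu>))
        = (\<Sum>n = 1..M. if n = m then of_real (c m k) * complex_of_real (pi / 4) else 0)"
        using that by (intro sum.cong) (auto simp: integral_signal_term)
      also have "\<dots> = of_real (c m k) * complex_of_real (pi / 4)" using m by (subst sum.delta) auto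
      finally show ?thesis .
    qed
    then show ?thesis by (simp del: of_real_divide)
  qed
  also have "\<dots> = of_real (pi / (4 * sqrt (real K * real M)) * (\<Sum>k = 1..K. c m k))"
    by (simp add: sum_distrib_left sum_distrib_right divide_simps mult_ac)
  finally show ?thesis .
qed

lemma scaled_norm2: "(cmod (of_real (1 / sqrt (real K * real M)) * z))\<^sup>2 = (cmod z)\<^sup>2 / (real K * real M)"
  using KM_pos by (simp add: norm_mult norm_divide power_mult_distrib power_divide)

text \<open>Orthogonal terms add in power, not in amplitude: \<open>K * M\<close> terms against the
  normalisation \<open>1 / (K * M)\<close> leave an average over the relays, bounded in
  \<open>K\<close>, whereas the squared mean of the own gain grows like
  \<open>K / M\<close>.\<close>

lemma scaled_sum_bound:
  fixes Y :: "nat \<Rightarrow> nat \<Rightarrow> (rv_index \<Rightarrow> complex) \<Rightarrow> complex" and c :: "nat \<Rightarrow> real"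
  assumes meas: "\<And>k n. k \<in> {1..K} \<Longrightarrow> n \<in> {1..M} \<Longrightarrow> Y k n \<in> borel_measurable \<nu>"
    and sq: "\<And>k n. k \<in> {1..K} \<Longrightarrow> n \<in> {1..M} \<Longrightarrow> integrable \<nu> (\<lambda>x. (cmod (Y k n x))\<^sup>2)"
      "\<And>k n. k \<in> {1..K} \<Longrightarrow> n \<in> {1..M} \<Longrightarrow> (\<integral>x. (cmod (Y k n x))\<^sup>2 \<partial>\<nu>) \<le> 1"
    and orth: "\<And>k n l q. k \<in> {1..K} \<Longrightarrow> n \<in> {1..M} \<Longrightarrow> l \<in> {1..K} \<Longrightarrow> q \<in> {1..M} \<Longrightarrow> (k, n) \<noteq> (l, q)
      \<Longrightarrow> (\<integral>x. Y k n x \<bullet> Y l q x \<partial>\<nu>) = 0"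
  defines "Z \<equiv> \<lambda>x. of_real (1 / sqrt (real K * real M)) * (\<Sum>k = 1..K. \<Sum>n = 1..M. of_real (c k) * Y k n x)"
  shows "integrable \<nu> (\<lambda>x. (cmod (Z x))\<^sup>2)" "(\<integral>x. (cmod (Z x))\<^sup>2 \<partial>\<nu>) \<le> (\<Sum>k = 1..K. (c k)\<^sup>2) / K"
proof -
  let ?X = "\<lambda>(k, n) x. of_real (c k) * Y k n x"
  let ?A = "{1..K} \<times> {1..M}"
  have sum: "(\<Sum>k = 1..K. \<Sum>n = 1..M. of_real (c k) * Y k n x) = (\<Sum>a\<in>?A. ?X a x)" for x
    by (simp add: sum.cartesian_product split_beta')
  have sq': "(norm (?X a x))\<^sup>2 = (c (fst a))\<^sup>2 * (cmod (Y (fst a) (snd a) x))\<^sup>2" for a x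
    by (simp add: split_beta' norm_mult power_mult_distrib)
  have i: "integrable \<nu> (\<lambda>x. (norm (?X a x))\<^sup>2)" if "a \<in> ?A" for a
    unfolding sq' using that by (auto intro!: integrable_mult_right sq)
  have o: "(\<integral>x. ?X a x \<bullet> ?X b x \<partial>\<nu>) = 0" if "a \<in> ?A" "b \<in> ?A" "a \<noteq> b" for a b
  proof -
    have "?X a x \<bullet> ?X b x = (c (fst a) * c (fst b)) * (Y (fst a) (snd a) x \<bullet> Y (fst b) (snd b) x)" for x
      by (simp add: split_beta' inner_complex_def algebra_simps)
    then show ?thesis using that orth[of "fst a" "snd a" "fst b" "snd b"]
      by (auto simp: mem_Times_iff)
  qed
  have m: "?X a \<in> borel_measurable \<nu>" if "a \<in> ?A" for a
    using that meas by (auto simp: split_beta')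
  note pyth = pythagoras[of ?A ?X \<nu>, OF _ m i o, simplified]
  show "integrable \<nu> (\<lambda>x. (cmod (Z x))\<^sup>2)"
    unfolding Z_def scaled_norm2 sum using pyth(1) by simp
  have "(\<integral>x. (cmod (Z x))\<^sup>2 \<partial>\<nu>) = (\<Sum>a\<in>?A. \<integral>x. (norm (?X a x))\<^sup>2 \<partial>\<nu>) / (real K * real M)"
    unfolding Z_def scaled_norm2 sum using pyth(2) by simp
  also have "\<dots> \<le> (\<Sum>a\<in>?A. (c (fst a))\<^sup>2) / (real K * real M)"
    unfolding sq' using KM_pos sq
    by (intro divide_right_mono sum_mono) (auto intro!: mult_left_le)
  also have "(\<Sum>a\<in>?A. (c (fst a))\<^sup>2) = (\<Sum>k = 1..K. \<Sum>n = 1..M. (c k)\<^sup>2)"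
    by (subst sum.cartesian_product) (simp add: split_beta')
  also have "\<dots> = M * (\<Sum>k = 1..K. (c k)\<^sup>2)"
    by (simp add: sum_distrib_left)
  also have "\<dots> / (real K * real M) = (\<Sum>k = 1..K. (c k)\<^sup>2) / K"
    using M by simp
  finally show "(\<integral>x. (cmod (Z x))\<^sup>2 \<partial>\<nu>) \<le> (\<Sum>k = 1..K. (c k)\<^sup>2) / K" .
qed

lemma gain_interference:
  assumes "m' \<in> {1..M}" "m' \<noteq> m"
  shows "integrable \<nu> (\<lambda>x. (cmod (gain c m' x))\<^sup>2)"
    "(\<integral>x. (cmod (gain c m' x))\<^sup>2 \<partial>\<nu>) \<le> (\<Sum>k = 1..K. (c m' k)\<^sup>2) / K"
  unfolding gain_def using assms
  by (intro scaled_sum_bound measurable_terms integrable_cmod2_signal_term orthogonal_interference; simp)+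

lemma gain_variance:
  fixes c :: "nat \<Rightarrow> nat \<Rightarrow> real"
  defines "\<mu> \<equiv> complex_of_real (pi / (4 * sqrt (real K * real M)) * (\<Sum>k = 1..K. c m k))"
  shows "integrable \<nu> (\<lambda>x. (cmod (gain c m x - \<mu>))\<^sup>2)"
    "(\<integral>x. (cmod (gain c m x - \<mu>))\<^sup>2 \<partial>\<nu>) \<le> (\<Sum>k = 1..K. (c m k)\<^sup>2) / K"
proof -
  \<comment> \<open>The termwise means; subtracted inside the double sum, they bring the variance
    into the form of \<open>scaled_sum_bound\<close>.\<close>
  define e where "e n = (if n = m then complex_of_real (pi / 4) else 0)" for n
  have mu: "\<mu> = of_real (1 / sqrt (real K * real M)) * (\<Sum>k = 1..K. \<Sum>n = 1..M. of_real (c m k) * e n)"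
  proof -
    have "(\<Sum>n = 1..M. of_real (c m k) * e n) = of_real (c m k) * complex_of_real (pi / 4)" for k
      using m by (simp add: sum_distrib_left[symmetric] e_def)
    then show ?thesis by (simp add: \<mu>_def sum_distrib_left sum_distrib_right divide_simps mult_ac)
  qed
  have eq: "gain c m x - \<mu> = of_real (1 / sqrt (real K * real M)) * (\<Sum>k = 1..K. \<Sum>n = 1..M. of_real (c m k) * (signal_term k n m x - e n))" for x
    unfolding mu gain_def by (simp only: right_diff_distrib sum_subtractf)
  have "(\<lambda>x. signal_term k n m x - e n) \<in> borel_measurable \<nu>" if "k \<in> {1..K}" "n \<in> {1..M}" for k n
    using that m by measurable
  note r = scaled_sum_bound[where c="c m", OF this integrable_signal_centered[folded e_def] orthogonal_signal[folded e_def]]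
  show "integrable \<nu> (\<lambda>x. (cmod (gain c m x - \<mu>))\<^sup>2)"
    "(\<integral>x. (cmod (gain c m x - \<mu>))\<^sup>2 \<partial>\<nu>) \<le> (\<Sum>k = 1..K. (c m k)\<^sup>2) / K"
    unfolding eq by (rule r; assumption)+
qed

text \<open>A single relay has only \<open>M\<close> terms against \<open>1 / (K * M)\<close>, so
  its noise gain has power of order \<open>1 / K\<close>.\<close>

lemma noise_gain_power:
  assumes k: "k \<in> {1..K}"
  shows "integrable \<nu> (\<lambda>x. (cmod (noise_gain e k x))\<^sup>2)"
    "(\<integral>x. (cmod (noise_gain e k x))\<^sup>2 \<partial>\<nu>) \<le> (e k)\<^sup>2 / K"
proof -
  let ?X = "\<lambda>n x. of_real (e k) * noise_term k n x"
  have sq: "(norm (?X n x))\<^sup>2 = (e k)\<^sup>2 * (cmod (noise_term k n x))\<^sup>2" for n x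
    by (simp add: norm_mult power_mult_distrib)
  have i: "integrable \<nu> (\<lambda>x. (norm (?X n x))\<^sup>2)" if "n \<in> {1..M}" for n
    unfolding sq using that k by (auto intro!: integrable_mult_right integrable_cmod2_noise_term)
  have o: "(\<integral>x. ?X n x \<bullet> ?X q x \<partial>\<nu>) = 0" if "n \<in> {1..M}" "q \<in> {1..M}" "n \<noteq> q" for n q
  proof -
    have "?X n x \<bullet> ?X q x = (e k * e k) * (noise_term k n x \<bullet> noise_term k q x)" for x
      by (simp add: inner_complex_def algebra_simps)
    then show ?thesis using that k orthogonal_noise_term[of k n q] by simp
  qed
  have meas: "?X n \<in> borel_measurable \<nu>" if "n \<in> {1..M}" for n
    using that k by auto
  note pyth = pythagoras[of "{1..M}" ?X \<nu>, OF _ meas i o, simplified]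
  show "integrable \<nu> (\<lambda>x. (cmod (noise_gain e k x))\<^sup>2)"
    unfolding noise_gain_def scaled_norm2 using pyth(1) by simp
  have "(\<integral>x. (cmod (noise_gain e k x))\<^sup>2 \<partial>\<nu>) = (\<Sum>n = 1..M. \<integral>x. (norm (?X n x))\<^sup>2 \<partial>\<nu>) / (real K * real M)"
    unfolding noise_gain_def scaled_norm2 using pyth(2) by simp
  also have "\<dots> \<le> (\<Sum>n = 1..M. (e k)\<^sup>2) / (real K * real M)"
    unfolding sq using KM_pos k integrable_cmod2_noise_term
    by (intro divide_right_mono sum_mono) (auto intro!: mult_left_le)
  also have "\<dots> = (e k)\<^sup>2 / K" using M by simp
  finally show "(\<integral>x. (cmod (noise_gain e k x))\<^sup>2 \<partial>\<nu>) \<le> (e k)\<^sup>2 / K" .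
qed

end

section \<open>Concentration of the interference power\<close>

context network_gains
begin

definition pairs :: "nat \<Rightarrow> (nat \<times> nat) set" where
  "pairs N = {(a, b)\<in>{1..N} \<times> {1..N}. a < b}"

lemma finite_pairs: "finite (pairs N)" and card_pairs_le: "card (pairs N) \<le> N * N"
proof -
  have sub: "pairs N \<subseteq> {1..N} \<times> {1..N}" by (auto simp: pairs_def)
  show "finite (pairs N)" using finite_subset[OF sub] by simp
  show "card (pairs N) \<le> N * N" using card_mono[OF _ sub] by simp
qed

text \<open>Almost everywhere only, because \<open>sgn 0 = 0\<close>.\<close>

lemma AE_cmod_phase_term: "AE x in \<nu>. \<forall>k\<in>{1..K}. \<forall>n\<in>{1..M}. cmod (phase_term k n x) = 1"
  using AE_nonzero
proof eventually_elim
  case (elim x)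
  then show ?case using gain_indexI by (auto simp: phase_term_def norm_mult norm_sgn)
qed

definition phase_sum :: "nat \<Rightarrow> (rv_index \<Rightarrow> complex) \<Rightarrow> complex" where
  "phase_sum k x = (\<Sum>n = 1..M. phase_term k n x)"

lemma measurable_phase_sum [measurable]: "k \<in> {1..K} \<Longrightarrow> phase_sum k \<in> borel_measurable \<nu>"
  unfolding phase_sum_def[abs_def] by measurable

text \<open>Expanding the squared phase sums separates the fluctuation of the independent weights \<open>g k\<close>
  (\<open>F1\<close> below) from the products of distinct phases (\<open>F2\<close>); both are sums of orthogonal terms.\<close>

lemma diagonal_concentration:
  fixes m' :: nat and a :: "nat \<Rightarrow> real" and A :: real and \<psi> :: "complex \<Rightarrow> real"
  defines "g \<equiv> \<lambda>k x. (cmod (x (Relay_Dest_Gain m k)))\<^sup>2 * \<psi> (x (Source_Relay_Gain k m'))"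
  assumes m': "m' \<in> {1..M}" and A: "0 < A" "\<And>k. k \<in> {1..K} \<Longrightarrow> \<bar>a k\<bar> \<le> A"
    and \<psi>: "\<And>z. 0 \<le> \<psi> z" "has_bochner_integral (CN 1) \<psi> 1" "has_bochner_integral (CN 1) (\<lambda>z. (\<psi> z)\<^sup>2) d" "d \<le> 2"
    and [measurable]: "\<psi> \<in> borel_measurable borel"
  defines "T \<equiv> \<lambda>x. (\<Sum>k = 1..K. a k * g k x * (cmod (phase_sum k x))\<^sup>2) / (real K * real M)"
  shows "integrable \<nu> (\<lambda>x. T x - (\<Sum>k = 1..K. a k) / K)"
    "(\<integral>x. \<bar>T x - (\<Sum>k = 1..K. a k) / K\<bar> \<partial>\<nu>) \<le> 7 * A / sqrt K"
proof -
  note [measurable] = m m'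
  have Kpos: "0 < real K" and Mpos: "0 < real M" using K M by auto
  have g_meas [measurable]: "g k \<in> borel_measurable \<nu>" if "k \<in> {1..K}" for k
    unfolding g_def using that by measurable
  have g_nonneg: "0 \<le> g k x" for k x unfolding g_def using \<psi> by simp
  \<comment> \<open>\<open>\<psi>\<close> will be the squared modulus for an interferer and the
    constant 1 for the relay noise. The factor 2 is the fourth moment of the forwarding
    gain.\<close>
  have g2: "has_bochner_integral \<nu> (\<lambda>x. (g k x)\<^sup>2) (2 * d)" if "k \<in> {1..K}" for k
  proof -
    have "has_bochner_integral \<nu> (\<lambda>x. (cmod (x (Relay_Dest_Gain m k))) ^ 4 * (\<psi> (x (Source_Relay_Gain k m')))\<^sup>2) (2 * d)"
      using that m m' by (intro has_bochner_integral_coordinates2 gain_indexI has_bochner_integral_CN_moments \<psi>) auto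
    moreover have "(g k x)\<^sup>2 = (cmod (x (Relay_Dest_Gain m k))) ^ 4 * (\<psi> (x (Source_Relay_Gain k m')))\<^sup>2" for x
      by (simp add: g_def power_mult_distrib flip: power_mult)
    ultimately show ?thesis by simp
  qed

  \<comment> \<open>Centred independent weights: each relay contributes a second moment of order
    \<open>1 / K^2\<close>, the sum one of order \<open>1 / K\<close>.\<close>
  define F1 where "F1 x = (\<Sum>k\<in>{1..K}. a k / K * (g k x - 1))" for x
  have F1: "integrable \<nu> F1" "(\<integral>x. \<bar>F1 x\<bar> \<partial>\<nu>) \<le> 3 * A / sqrt K"
  proof -
    let ?X = "\<lambda>k x. a k / K * (g k x - 1)"
    have meas: "?X k \<in> borel_measurable \<nu>" if "k \<in> {1..K}" for k using that by measurable
    have b: "integrable \<nu> (\<lambda>x. (norm (?X k x))\<^sup>2) \<and> (\<integral>x. (norm (?X k x))\<^sup>2 \<partial>\<nu>) \<le> 9 * A\<^sup>2 / K\<^sup>2" if k: "k \<in> {1..K}" for k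
    proof -
      have le: "(norm (?X k x))\<^sup>2 \<le> A\<^sup>2 / K\<^sup>2 * ((g k x)\<^sup>2 + 1)" for x
      proof -
        have "(a k)\<^sup>2 \<le> A\<^sup>2" using A(2)[OF k] A(1) by (metis abs_ge_zero power2_abs power_mono)
        then have "(a k)\<^sup>2 / K\<^sup>2 \<le> A\<^sup>2 / K\<^sup>2" by (intro divide_right_mono) auto
        moreover have "(g k x - 1)\<^sup>2 \<le> (g k x)\<^sup>2 + 1" using g_nonneg[of k x] by (simp add: power2_diff)
        ultimately have "(a k)\<^sup>2 / K\<^sup>2 * (g k x - 1)\<^sup>2 \<le> A\<^sup>2 / K\<^sup>2 * ((g k x)\<^sup>2 + 1)"
          by (intro mult_mono) auto
        then show ?thesis by (simp add: power_mult_distrib power_divide)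
      qed
      have h: "has_bochner_integral \<nu> (\<lambda>x. A\<^sup>2 / K\<^sup>2 * ((g k x)\<^sup>2 + 1)) (A\<^sup>2 / K\<^sup>2 * (2 * d + 1))"
        using g2[OF k] prob_space by (intro has_bochner_integral_mult_right has_bochner_integral_add) (auto simp: has_bochner_integral_iff)
      have "(\<lambda>x. (norm (?X k x))\<^sup>2) \<in> borel_measurable \<nu>" using k by measurable
      note r = integral_le_of_bound[OF this _ le h]
      \<comment> \<open>\<open>2 * d + 1\<close> is at most 5; rounding up to the square 9 gives the
        factor 3.\<close>
      have "A\<^sup>2 / K\<^sup>2 * (2 * d + 1) \<le> A\<^sup>2 / K\<^sup>2 * 9" using \<psi>(4) by (intro mult_left_mono) auto
      then show ?thesis using r by (auto simp: mult.commute)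
    qed
    have o: "(\<integral>x. ?X k x \<bullet> ?X l x \<partial>\<nu>) = 0" if kl: "k \<in> {1..K}" "l \<in> {1..K}" "k \<noteq> l" for k l
    proof -
      have "(\<integral>x. (g k x - 1 * 1) * (g l x - 1 * 1) \<partial>\<nu>) = 0"
        unfolding g_def using kl m m' gain_indexI
        by (intro orthogonal_coordinates has_bochner_integral_CN_moments \<psi>) auto
      moreover have "?X k x \<bullet> ?X l x = (a k / K * (a l / K)) * ((g k x - 1 * 1) * (g l x - 1 * 1))" for x by simp
      ultimately show ?thesis by (simp only: integral_mult_right_zero)
    qed
    note pyth = pythagoras[of "{1..K}" ?X \<nu>, OF _ meas _ o]
    have i: "integrable \<nu> (\<lambda>x. (F1 x)\<^sup>2)" using pyth(1) b unfolding F1_def by simp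
    have "(\<integral>x. (F1 x)\<^sup>2 \<partial>\<nu>) = (\<Sum>k\<in>{1..K}. \<integral>x. (norm (?X k x))\<^sup>2 \<partial>\<nu>)" using pyth(2) b unfolding F1_def by simp
    also have "\<dots> \<le> (\<Sum>k\<in>{1..K}. 9 * A\<^sup>2 / K\<^sup>2)" using b by (intro sum_mono) blast
    also have "\<dots> = (3 * A / sqrt K)\<^sup>2" using Kpos by (simp add: power_divide power_mult_distrib power2_eq_square)
    finally have le: "(\<integral>x. (F1 x)\<^sup>2 \<partial>\<nu>) \<le> (3 * A / sqrt K)\<^sup>2" .
    have pos: "0 < 3 * A / sqrt K" using A(1) Kpos by simp
    have F_meas: "F1 \<in> borel_measurable \<nu>" unfolding F1_def[abs_def] by measurable
    show "integrable \<nu> F1" "(\<integral>x. \<bar>F1 x\<bar> \<partial>\<nu>) \<le> 3 * A / sqrt K"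
      by (rule integral_abs_le_of_square[OF pos i le F_meas])+
  qed

  \<comment> \<open>Products of two distinct phases at one relay: at most \<open>K * M^2\<close>
    terms, each of second moment at most \<open>16 * A^2 / (K^2 * M^2)\<close>. The resulting factor
    4 and the 3 of \<open>F1\<close> make up the 7.\<close>
  define F2 where "F2 x = (\<Sum>(k, n, n')\<in>{1..K} \<times> pairs M. 2 / (K * M) * a k * g k x * (phase_term k n x \<bullet> phase_term k n' x))" for x
  have F2: "integrable \<nu> F2" "(\<integral>x. \<bar>F2 x\<bar> \<partial>\<nu>) \<le> 4 * A / sqrt K"
  proof -
    let ?A = "{1..K} \<times> pairs M"
    let ?X = "\<lambda>(k, n, n') x. 2 / (K * M) * a k * g k x * (phase_term k n x \<bullet> phase_term k n' x)"
    have meas: "?X t \<in> borel_measurable \<nu>" if t: "t \<in> ?A" for t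
    proof -
      obtain k n n' where t': "t = (k, n, n')" by (cases t)
      then have [measurable]: "k \<in> {1..K}" "n \<in> {1..M}" "n' \<in> {1..M}" using t by (auto simp: pairs_def)
      show ?thesis unfolding t' prod.case by measurable
    qed
    have b: "integrable \<nu> (\<lambda>x. (norm (?X t x))\<^sup>2) \<and> (\<integral>x. (norm (?X t x))\<^sup>2 \<partial>\<nu>) \<le> 16 * A\<^sup>2 / (K\<^sup>2 * M\<^sup>2)" if t: "t \<in> ?A" for t
    proof -
      obtain k n n' where t': "t = (k, n, n')" by (cases t)
      then have k: "k \<in> {1..K}" using t by auto
      have le: "(norm (?X t x))\<^sup>2 \<le> 4 * A\<^sup>2 / (K\<^sup>2 * M\<^sup>2) * (g k x)\<^sup>2" for x
      proof -
        have "(a k)\<^sup>2 \<le> A\<^sup>2" using A(2)[OF k] A(1) by (metis abs_ge_zero power2_abs power_mono)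
        then have "4 * (a k)\<^sup>2 / (K\<^sup>2 * M\<^sup>2) \<le> 4 * A\<^sup>2 / (K\<^sup>2 * M\<^sup>2)" by (intro divide_right_mono) auto
        then have 1: "4 * (a k)\<^sup>2 / (K\<^sup>2 * M\<^sup>2) * (g k x)\<^sup>2 \<le> 4 * A\<^sup>2 / (K\<^sup>2 * M\<^sup>2) * (g k x)\<^sup>2" by (intro mult_right_mono) auto
        have "\<bar>phase_term k n x \<bullet> phase_term k n' x\<bar> \<le> 1"
          using Cauchy_Schwarz_ineq2[of "phase_term k n x" "phase_term k n' x"] mult_le_one[OF cmod_phase_term_le[of k n x] norm_ge_zero cmod_phase_term_le[of k n' x]] by linarith
        then have "(phase_term k n x \<bullet> phase_term k n' x)\<^sup>2 \<le> 1" by (simp add: abs_square_le_1)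
        then have "4 * (a k)\<^sup>2 / (K\<^sup>2 * M\<^sup>2) * (g k x)\<^sup>2 * (phase_term k n x \<bullet> phase_term k n' x)\<^sup>2 \<le> 4 * (a k)\<^sup>2 / (K\<^sup>2 * M\<^sup>2) * (g k x)\<^sup>2"
          by (intro mult_left_le) auto
        moreover have "(norm (?X t x))\<^sup>2 = 4 * (a k)\<^sup>2 / (K\<^sup>2 * M\<^sup>2) * (g k x)\<^sup>2 * (phase_term k n x \<bullet> phase_term k n' x)\<^sup>2"
          by (simp add: t' power_mult_distrib power_divide)
        ultimately show ?thesis using 1 by linarith
      qed
      have h: "has_bochner_integral \<nu> (\<lambda>x. 4 * A\<^sup>2 / (K\<^sup>2 * M\<^sup>2) * (g k x)\<^sup>2) (4 * A\<^sup>2 / (K\<^sup>2 * M\<^sup>2) * (2 * d))"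
        using g2[OF k] by (intro has_bochner_integral_mult_right) auto
      have "(\<lambda>x. (norm (?X t x))\<^sup>2) \<in> borel_measurable \<nu>" using meas[OF t] by measurable
      note r = integral_le_of_bound[OF this _ le h]
      have "4 * A\<^sup>2 / (K\<^sup>2 * M\<^sup>2) * (2 * d) \<le> 4 * A\<^sup>2 / (K\<^sup>2 * M\<^sup>2) * 4" using \<psi>(4) by (intro mult_left_mono) auto
      then show ?thesis using r by (auto simp: mult.commute)
    qed
    have o: "(\<integral>x. ?X t x \<bullet> ?X u x \<partial>\<nu>) = 0" if tu: "t \<in> ?A" "u \<in> ?A" "t \<noteq> u" for t u
    proof -
      obtain k n n' l q q' where t': "t = (k, n, n')" "u = (l, q, q')" by (cases t, cases u)
      have idx: "k \<in> {1..K}" "n \<in> {1..M}" "n' \<in> {1..M}" "n < n'" "l \<in> {1..K}" "q \<in> {1..M}" "q' \<in> {1..M}" "q < q'"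
        using tu t' by (auto simp: pairs_def)
      have g_flip: "g j (flip (Relay_Dest_Gain i i') x) = g j x" for j i i' x
        by (simp add: g_def flip_def)
      \<comment> \<open>Both phase pairs are increasing, so distinct triples cannot share both
        phases; the destination gain of a phase of \<open>t\<close> absent from \<open>u\<close> is
        flipped. The weights \<open>g\<close> see only the modulus of that gain.\<close>
      consider "(k, n) \<noteq> (l, q)" "(k, n) \<noteq> (l, q')" | "(k, n') \<noteq> (l, q)" "(k, n') \<noteq> (l, q')"
        using tu t' idx by fastforce
      then show ?thesis
      proof cases
        case 1
        have ne: "(k, n') \<noteq> (k, n)" "(l, q) \<noteq> (k, n)" "(l, q') \<noteq> (k, n)" using 1 idx by auto
        show ?thesis
          by (intro orthogonal_flip(1)[OF gain_indexI(2)[OF idx(1,2)] meas[OF tu(1)] meas[OF tu(2)]])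
            (simp_all add: t' g_flip flip_dest_phase_term(1) ne[THEN flip_dest_phase_term(2)])
      next
        case 2
        have ne: "(k, n) \<noteq> (k, n')" "(l, q) \<noteq> (k, n')" "(l, q') \<noteq> (k, n')" using 2 idx by auto
        show ?thesis
          by (intro orthogonal_flip(1)[OF gain_indexI(2)[OF idx(1,3)] meas[OF tu(1)] meas[OF tu(2)]])
            (simp_all add: t' g_flip flip_dest_phase_term(1) ne[THEN flip_dest_phase_term(2)])
      qed
    qed
    have fin: "finite ?A" by (simp add: finite_pairs)
    note pyth = pythagoras[of ?A ?X \<nu>, OF fin meas _ o]
    have i: "integrable \<nu> (\<lambda>x. (F2 x)\<^sup>2)" using pyth(1) b unfolding F2_def by (simp add: split_beta')
    have "(\<integral>x. (F2 x)\<^sup>2 \<partial>\<nu>) = (\<Sum>t\<in>?A. \<integral>x. (norm (?X t x))\<^sup>2 \<partial>\<nu>)" using pyth(2) b unfolding F2_def by (simp add: split_beta')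
    also have "\<dots> \<le> (\<Sum>t\<in>?A. 16 * A\<^sup>2 / (K\<^sup>2 * M\<^sup>2))" using b by (intro sum_mono) blast
    also have "\<dots> = real (card (pairs M)) * (K * (16 * A\<^sup>2 / (K\<^sup>2 * M\<^sup>2)))"
      by (simp add: card_cartesian_product)
    also have "\<dots> \<le> real (M * M) * (K * (16 * A\<^sup>2 / (K\<^sup>2 * M\<^sup>2)))"
      using card_pairs_le[of M] by (intro mult_right_mono) (auto simp del: of_nat_mult)
    also have "\<dots> = (4 * A / sqrt K)\<^sup>2" using Kpos Mpos by (simp add: power_divide power_mult_distrib power2_eq_square)
    finally have le: "(\<integral>x. (F2 x)\<^sup>2 \<partial>\<nu>) \<le> (4 * A / sqrt K)\<^sup>2" .
    have pos: "0 < 4 * A / sqrt K" using A(1) Kpos by simp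
    have F_meas: "F2 \<in> borel_measurable \<nu>"
    proof -
      have "F2 = (\<lambda>x. \<Sum>t\<in>?A. ?X t x)" by (simp add: F2_def[abs_def] split_beta')
      then show ?thesis using meas by (simp add: borel_measurable_sum)
    qed
    show "integrable \<nu> F2" "(\<integral>x. \<bar>F2 x\<bar> \<partial>\<nu>) \<le> 4 * A / sqrt K"
      by (rule integral_abs_le_of_square[OF pos i le F_meas])+
  qed

  \<comment> \<open>The diagonal of the squared phase sum is \<open>M\<close> only where every phase
    has modulus 1.\<close>
  have ae: "AE x in \<nu>. T x - (\<Sum>k = 1..K. a k) / K = F1 x + F2 x"
    using AE_cmod_phase_term
  proof eventually_elim
    case (elim x)
    have S: "(cmod (phase_sum k x))\<^sup>2 = M + 2 * (\<Sum>(n, n')\<in>pairs M. phase_term k n x \<bullet> phase_term k n' x)" if "k \<in> {1..K}" for k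
      unfolding phase_sum_def pairs_def using elim that by (subst norm_sum_square_pairs) auto
    have "T x = (\<Sum>k = 1..K. a k * g k x * (M + 2 * (\<Sum>(n, n')\<in>pairs M. phase_term k n x \<bullet> phase_term k n' x))) / (K * M)"
      unfolding T_def using S by simp
    also have "\<dots> = (\<Sum>k = 1..K. a k / K * g k x + 2 / (K * M) * a k * g k x * (\<Sum>(n, n')\<in>pairs M. phase_term k n x \<bullet> phase_term k n' x))"
      unfolding sum_divide_distrib using Kpos Mpos by (intro sum.cong refl) (simp add: field_simps)
    also have "\<dots> = (\<Sum>k = 1..K. a k / K * g k x) + F2 x"
      unfolding F2_def sum.distrib sum.cartesian_product[symmetric] by (simp add: sum_distrib_left split_beta')
    also have "(\<Sum>k = 1..K. a k / K * g k x) = F1 x + (\<Sum>k = 1..K. a k) / K"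
      unfolding F1_def by (simp add: right_diff_distrib sum_subtractf sum_divide_distrib)
    finally show ?case by simp
  qed
  have [measurable]: "T \<in> borel_measurable \<nu>" "F1 \<in> borel_measurable \<nu>" "F2 \<in> borel_measurable \<nu>"
    unfolding T_def using F1(1) F2(1) by auto
  have i12: "integrable \<nu> (\<lambda>x. F1 x + F2 x)" using F1 F2 by simp
  show "integrable \<nu> (\<lambda>x. T x - (\<Sum>k = 1..K. a k) / K)"
    using ae i12 by (subst integrable_cong_AE[where g="\<lambda>x. F1 x + F2 x"]) auto
  have "(\<integral>x. \<bar>T x - (\<Sum>k = 1..K. a k) / K\<bar> \<partial>\<nu>) = (\<integral>x. \<bar>F1 x + F2 x\<bar> \<partial>\<nu>)"
    using ae by (intro integral_cong_AE) auto
  also have "\<dots> \<le> (\<integral>x. \<bar>F1 x\<bar> + \<bar>F2 x\<bar> \<partial>\<nu>)"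
    using i12 F1 F2 by (intro integral_mono) auto
  also have "\<dots> \<le> 7 * A / sqrt K" using F1 F2 by simp
  finally show "(\<integral>x. \<bar>T x - (\<Sum>k = 1..K. a k) / K\<bar> \<partial>\<nu>) \<le> 7 * A / sqrt K" .
qed

section \<open>Cross terms between distinct relays\<close>

definition signal_sum :: "nat \<Rightarrow> nat \<Rightarrow> (rv_index \<Rightarrow> complex) \<Rightarrow> complex" where
  "signal_sum k m' x = (\<Sum>n = 1..M. signal_term k n m' x)"

lemma measurable_signal_sum [measurable]:
  "k \<in> {1..K} \<Longrightarrow> m' \<in> {1..M} \<Longrightarrow> signal_sum k m' \<in> borel_measurable \<nu>"
  unfolding signal_sum_def[abs_def] by measurable

text \<open>Either some relay of the first product is absent from the second, or the ordered relay
  pairs coincide. In the first case a gain at that relay is flipped: the source gain if its term is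
  aligned with \<open>m\<close>, the destination gain otherwise. In the second case phase indices or
  sources differ, and the difference provides a gain that is odd in one product only.\<close>

lemma orthogonal_cross_relay:
  assumes k: "k \<in> {1..K}" "l \<in> {1..K}" "k < l" and k': "k' \<in> {1..K}" "l' \<in> {1..K}" "k' < l'"
    and n: "n \<in> {1..M}" "n' \<in> {1..M}" and q: "q \<in> {1..M}" "q' \<in> {1..M}"
    and i: "i \<in> {1..M} - {m}" "j \<in> {1..M} - {m}"
    and ne: "(i, (k, l), n, n') \<noteq> (j, (k', l'), q, q')"
  shows "(\<integral>x. (signal_term k n i x \<bullet> signal_term l n' i x) * (signal_term k' q j x \<bullet> signal_term l' q' j x) \<partial>\<nu>) = 0"
    (is "(\<integral>x. ?X x * ?Y x \<partial>\<nu>) = 0")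
proof -
  note [measurable] = k(1,2) k'(1,2) n q
  have [measurable]: "i \<in> {1..M}" "j \<in> {1..M}" using i by auto
  have meas: "?X \<in> borel_measurable \<nu>" "?Y \<in> borel_measurable \<nu>" by measurable
  have orth: "(\<integral>x. ?X x * ?Y x \<partial>\<nu>) = 0"
    if "r \<in> gain_indices M K" "\<And>x. ?X (flip r x) = - ?X x" "\<And>x. ?Y (flip r x) = ?Y x" for r
    using orthogonal_flip(1)[OF that(1) meas that(2,3)] by simp
  have orth': "(\<integral>x. ?X x * ?Y x \<partial>\<nu>) = 0"
    if "r \<in> gain_indices M K" "\<And>x. ?X (flip r x) = ?X x" "\<And>x. ?Y (flip r x) = - ?Y x" for r
    using orthogonal_flip(2)[OF that(1) meas(2,1) that(3,2)] by simp
  consider (relay1) "k \<notin> {k', l'}" | (relay2) "l \<notin> {k', l'}" | (same) "k = k'" "l = l'"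
    using k k' by fastforce
  then show ?thesis
  proof cases
    case relay1
    show ?thesis
    proof (cases "n = m")
      case True
      show ?thesis using relay1 True i k
        by (intro orth[of "Source_Relay_Gain k i"] gain_indexI) (auto simp: flip_source)
    next
      case False
      show ?thesis using relay1 False i k n
        by (intro orth[of "Relay_Dest_Gain n k"] gain_indexI) (auto simp: flip_dest)
    qed
  next
    case relay2
    show ?thesis
    proof (cases "n' = m")
      case True
      show ?thesis using relay2 True i k
        by (intro orth[of "Source_Relay_Gain l i"] gain_indexI) (auto simp: flip_source)
    next
      case False
      show ?thesis using relay2 False i k n
        by (intro orth[of "Relay_Dest_Gain n' l"] gain_indexI) (auto simp: flip_dest)
    qed
  next
    case same
    consider (n) "n \<noteq> q" | (n') "n' \<noteq> q'" | (source) "n = q" "n' = q'" "i \<noteq> j"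
      using ne same by auto
    then show ?thesis
    proof cases
      case n
      show ?thesis
      proof (cases "n = m")
        case True
        \<comment> \<open>An aligned term cannot be separated by its destination gain, so the flip
          acts on the other product, which is not aligned.\<close>
        then have "q \<noteq> m" using n by simp
        then show ?thesis using same n k q
          by (intro orth'[of "Relay_Dest_Gain q k"] gain_indexI) (auto simp: flip_dest)
      next
        case False
        then show ?thesis using same n k \<open>n \<in> {1..M}\<close>
          by (intro orth[of "Relay_Dest_Gain n k"] gain_indexI) (auto simp: flip_dest)
      qed
    next
      case n'
      show ?thesis
      proof (cases "n' = m")
        case True
        then have "q' \<noteq> m" using n' by simp
        then show ?thesis using same n' k q
          by (intro orth'[of "Relay_Dest_Gain q' l"] gain_indexI) (auto simp: flip_dest)
      next
        case False
        then show ?thesis using same n' k \<open>n' \<in> {1..M}\<close>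
          by (intro orth[of "Relay_Dest_Gain n' l"] gain_indexI) (auto simp: flip_dest)
      qed
    next
      case source
      show ?thesis
      \<comment> \<open>A source different from the common phase index \<open>n\<close> enters its
        product linearly and is absent from the other. Of \<open>i\<close> and \<open>j\<close>, at
        least one qualifies.\<close>
      proof (cases "n = i")
        case True
        then show ?thesis using same source k i
          by (intro orth'[of "Source_Relay_Gain k j"] gain_indexI) (auto simp: flip_source)
      next
        case False
        then show ?thesis using same source k i
          by (intro orth[of "Source_Relay_Gain k i"] gain_indexI) (auto simp: flip_source)
      qed
    qed
  qed
qed

text \<open>There are at most \<open>M * K^2 * M^2\<close> orthogonal terms, each of second moment
  at most \<open>4 * C^4 / (K^2 * M^4)\<close>, hence \<open>4 * C^4 / M\<close> in total. For a
  single interferer the same count gives no decay; the average over the sources supplies it.\<close>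

lemma cross_relay_concentration:
  fixes c :: "nat \<Rightarrow> nat \<Rightarrow> real" and C :: real
  assumes C: "0 < C" "\<And>i k. i \<in> {1..M} \<Longrightarrow> k \<in> {1..K} \<Longrightarrow> \<bar>c i k\<bar> \<le> C"
  defines "R \<equiv> \<lambda>x. (\<Sum>i\<in>{1..M} - {m}. 2 * (\<Sum>(k, l)\<in>pairs K. (c i k * c i l) * (signal_sum k i x \<bullet> signal_sum l i x)) / (real K * real M)) / M"
  shows "integrable \<nu> R" "(\<integral>x. \<bar>R x\<bar> \<partial>\<nu>) \<le> 2 * C\<^sup>2 / sqrt M"
proof -
  have Kpos: "0 < real K" and Mpos: "0 < real M" using K M by auto
  let ?A = "({1..M} - {m}) \<times> pairs K \<times> ({1..M} \<times> {1..M})"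
  let ?X = "\<lambda>(i, (k, l), n, n') x. 2 / (K * M * M) * (c i k * c i l) * (signal_term k n i x \<bullet> signal_term l n' i x)"
  have tD: "k \<in> {1..K}" "l \<in> {1..K}" "k < l" "n \<in> {1..M}" "n' \<in> {1..M}" "i \<in> {1..M} - {m}" "i \<in> {1..M}"
    if "(i, (k, l), n, n') \<in> ?A" for i k l n n'
    using that by (simp_all add: pairs_def)
  \<comment> \<open>Flattened to one index set, so that orthogonality is used across sources, relay
    pairs and phases at once.\<close>
  have R_eq: "R x = (\<Sum>t\<in>?A. ?X t x)" for x
  proof -
    have "(\<Sum>t\<in>?A. ?X t x) = (\<Sum>i\<in>{1..M} - {m}. \<Sum>(k, l)\<in>pairs K. \<Sum>(n, n')\<in>{1..M} \<times> {1..M}.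
        2 / (K * M * M) * (c i k * c i l) * (signal_term k n i x \<bullet> signal_term l n' i x))"
      by (simp add: sum.cartesian_product' split_beta')
    also have "\<dots> = (\<Sum>i\<in>{1..M} - {m}. \<Sum>(k, l)\<in>pairs K. 2 / (K * M * M) * (c i k * c i l) * (signal_sum k i x \<bullet> signal_sum l i x))"
    proof -
      have "(\<Sum>(n, n')\<in>{1..M} \<times> {1..M}. b * (signal_term k n i x \<bullet> signal_term l n' i x)) = b * (signal_sum k i x \<bullet> signal_sum l i x)"
        for i k l b
      proof -
        have "signal_sum k i x \<bullet> signal_sum l i x = (\<Sum>n = 1..M. \<Sum>n' = 1..M. signal_term k n i x \<bullet> signal_term l n' i x)"
          unfolding signal_sum_def inner_sum_left by (simp add: inner_sum_right)
        then show ?thesis by (simp add: sum.cartesian_product sum_distrib_left split_beta')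
      qed
      then show ?thesis by (simp only:)
    qed
    also have "\<dots> = R x"
      unfolding R_def sum_divide_distrib sum_distrib_left by (intro sum.cong) (auto simp: split_beta')
    finally show ?thesis by simp
  qed
  have meas: "?X t \<in> borel_measurable \<nu>" if "t \<in> ?A" for t
  proof -
    obtain i k l n n' where t: "t = (i, (k, l), n, n')" by (metis surj_pair)
    note [measurable] = tD[OF that[unfolded t]]
    show ?thesis unfolding t prod.case by measurable
  qed
  have b: "integrable \<nu> (\<lambda>x. (norm (?X t x))\<^sup>2) \<and> (\<integral>x. (norm (?X t x))\<^sup>2 \<partial>\<nu>) \<le> 4 * C ^ 4 / (K\<^sup>2 * M ^ 4)" if t: "t \<in> ?A" for t
  proof -
    obtain i k l n n' where t': "t = (i, (k, l), n, n')" by (metis surj_pair)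
    note idx = tD[OF t[unfolded t']]
    let ?g = "\<lambda>k x. (cmod (x (Relay_Dest_Gain m k)))\<^sup>2 * (cmod (x (Source_Relay_Gain k i)))\<^sup>2"
    let ?B = "4 * C ^ 4 / (K\<^sup>2 * M ^ 4)"
    have cc: "(c i k * c i l)\<^sup>2 \<le> C ^ 4"
    proof -
      have "\<bar>c i k * c i l\<bar> \<le> C * C" unfolding abs_mult using C idx by (intro mult_mono) auto
      then have "\<bar>c i k * c i l\<bar>\<^sup>2 \<le> (C * C)\<^sup>2" by (intro power_mono) auto
      then show ?thesis by (simp add: power_mult_distrib flip: power_add)
    qed
    have le: "(norm (?X t x))\<^sup>2 \<le> ?B * (?g k x * ?g l x)" for x
    proof -
      have "\<bar>signal_term k n i x \<bullet> signal_term l n' i x\<bar>\<^sup>2 \<le> (cmod (signal_term k n i x) * cmod (signal_term l n' i x))\<^sup>2"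
        by (intro power_mono Cauchy_Schwarz_ineq2) auto
      also have "\<dots> \<le> ?g k x * ?g l x"
        unfolding power_mult_distrib by (intro mult_mono cmod2_signal_term_le) auto
      finally have "4 / (K\<^sup>2 * M ^ 4) * ((c i k * c i l)\<^sup>2 * (signal_term k n i x \<bullet> signal_term l n' i x)\<^sup>2) \<le> 4 / (K\<^sup>2 * M ^ 4) * (C ^ 4 * (?g k x * ?g l x))"
        using cc by (intro mult_left_mono mult_mono) auto
      moreover have "(norm (?X t x))\<^sup>2 = 4 / (K\<^sup>2 * M ^ 4) * ((c i k * c i l)\<^sup>2 * (signal_term k n i x \<bullet> signal_term l n' i x)\<^sup>2)"
        by (simp add: t' power_mult_distrib power_divide power4_eq_xxxx power2_eq_square mult_ac)
      ultimately show ?thesis by simp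
    qed
    \<comment> \<open>Four distinct gains, as \<open>k < l\<close>, so the expectation
      factorises.\<close>
    have "has_bochner_integral \<nu> (\<lambda>x. ?g k x * ?g l x) ((1 * 1) * (1 * 1))"
      using idx m by (intro has_bochner_integral_coordinates4 has_bochner_integral_CN_moments) (auto intro: gain_indexI)
    then have h: "has_bochner_integral \<nu> (\<lambda>x. ?B * (?g k x * ?g l x)) (?B * ((1 * 1) * (1 * 1)))"
      by (intro has_bochner_integral_mult_right) auto
    have "(\<lambda>x. (norm (?X t x))\<^sup>2) \<in> borel_measurable \<nu>" using meas[OF t] by measurable
    note r = integral_le_of_bound[OF this _ le h]
    show ?thesis
    proof (intro conjI)
      show "integrable \<nu> (\<lambda>x. (norm (?X t x))\<^sup>2)" by (rule r(1)) simp
      have "(\<integral>x. (norm (?X t x))\<^sup>2 \<partial>\<nu>) \<le> ?B * ((1 * 1) * (1 * 1))" by (rule r(2)) simp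
      then show "(\<integral>x. (norm (?X t x))\<^sup>2 \<partial>\<nu>) \<le> ?B" by simp
    qed
  qed
  have o: "(\<integral>x. ?X t x \<bullet> ?X u x \<partial>\<nu>) = 0" if tu: "t \<in> ?A" "u \<in> ?A" "t \<noteq> u" for t u
  proof -
    obtain i k l n n' where t: "t = (i, (k, l), n, n')" by (metis surj_pair)
    obtain j k' l' q q' where u: "u = (j, (k', l'), q, q')" by (metis surj_pair)
    note idx = tD[OF tu(1)[unfolded t]] tD[OF tu(2)[unfolded u]]
    have "?X t x \<bullet> ?X u x = (2 / (K * M * M) * (c i k * c i l) * (2 / (K * M * M) * (c j k' * c j l'))) *
        ((signal_term k n i x \<bullet> signal_term l n' i x) * (signal_term k' q j x \<bullet> signal_term l' q' j x))" for x
      unfolding t u prod.case inner_real_def by (simp only: mult_ac)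
    moreover have "(\<integral>x. (signal_term k n i x \<bullet> signal_term l n' i x) * (signal_term k' q j x \<bullet> signal_term l' q' j x) \<partial>\<nu>) = 0"
      using idx tu(3) t u by (intro orthogonal_cross_relay) auto
    ultimately show ?thesis by (simp only: integral_mult_right_zero)
  qed
  have fin: "finite ?A" by (simp add: finite_pairs)
  note pyth = pythagoras[of ?A ?X \<nu>, OF fin meas conjunct1[OF b] o]
  have i: "integrable \<nu> (\<lambda>x. (R x)\<^sup>2)" using pyth(1) unfolding R_eq real_norm_def power2_abs .
  have "(\<integral>x. (R x)\<^sup>2 \<partial>\<nu>) = (\<Sum>t\<in>?A. \<integral>x. (norm (?X t x))\<^sup>2 \<partial>\<nu>)"
    using pyth(2) unfolding R_eq real_norm_def power2_abs .
  also have "\<dots> \<le> (\<Sum>t\<in>?A. 4 * C ^ 4 / (K\<^sup>2 * M ^ 4))" using b by (intro sum_mono) blast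
  also have "\<dots> = real (card ?A) * (4 * C ^ 4 / (K\<^sup>2 * M ^ 4))" by simp
  also have "\<dots> \<le> real (M * (K * K * (M * M))) * (4 * C ^ 4 / (K\<^sup>2 * M ^ 4))"
  proof (intro mult_right_mono of_nat_mono)
    have "card ?A = card ({1..M} - {m}) * (card (pairs K) * (M * M))" by (simp add: card_cartesian_product)
    also have "\<dots> \<le> M * (K * K * (M * M))"
      using card_pairs_le[of K] card_mono[of "{1..M}" "{1..M} - {m}"] by (intro mult_le_mono) auto
    finally show "card ?A \<le> M * (K * K * (M * M))" .
  qed auto
  also have "\<dots> = (2 * C\<^sup>2 / sqrt M)\<^sup>2"
    using Kpos Mpos by (simp add: power_divide power_mult_distrib power4_eq_xxxx power2_eq_square)
  finally have le: "(\<integral>x. (R x)\<^sup>2 \<partial>\<nu>) \<le> (2 * C\<^sup>2 / sqrt M)\<^sup>2" .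
  have pos: "0 < 2 * C\<^sup>2 / sqrt M" using C(1) Mpos by simp
  have R_meas: "R \<in> borel_measurable \<nu>"
  proof -
    have "R = (\<lambda>x. \<Sum>t\<in>?A. ?X t x)" using R_eq by (rule ext)
    then show ?thesis using borel_measurable_sum[OF meas] by (simp only:)
  qed
  show "integrable \<nu> R" "(\<integral>x. \<bar>R x\<bar> \<partial>\<nu>) \<le> 2 * C\<^sup>2 / sqrt M"
    by (rule integral_abs_le_of_square[OF pos i le R_meas])+
qed

text \<open>The variance of everything but the own signal in the output of destination
  \<open>m\<close>, given the gains; each source has power \<open>1 / M\<close>.\<close>

definition interference :: "(nat \<Rightarrow> nat \<Rightarrow> real) \<Rightarrow> (nat \<Rightarrow> real) \<Rightarrow> real \<Rightarrow> (rv_index \<Rightarrow> complex) \<Rightarrow> real" where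
  "interference c e \<sigma>2 x =
     \<sigma>2 + ((\<Sum>i\<in>{1..M} - {m}. (cmod (gain c i x))\<^sup>2 / M) + (\<Sum>k = 1..K. (cmod (noise_gain e k x))\<^sup>2 * \<sigma>2))"

text \<open>The mean that orthogonality predicts, written with averages of squared coefficients so
  that the constants of the claim bound it termwise.\<close>

definition mean_interference :: "(nat \<Rightarrow> nat \<Rightarrow> real) \<Rightarrow> (nat \<Rightarrow> real) \<Rightarrow> real \<Rightarrow> real" where
  "mean_interference c e \<sigma>2 =
     \<sigma>2 + ((\<Sum>i\<in>{1..M} - {m}. ((\<Sum>k = 1..K. (c i k)\<^sup>2) / K) / M) + (\<Sum>k = 1..K. (e k)\<^sup>2) / K * \<sigma>2)"

lemma measurable_interference [measurable]: "interference c e \<sigma>2 \<in> borel_measurable \<nu>"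
  unfolding interference_def[abs_def] by measurable

lemma integrable_interference:
  assumes "0 \<le> \<sigma>2"
  shows "integrable \<nu> (interference c e \<sigma>2)" "expectation (interference c e \<sigma>2) \<le> mean_interference c e \<sigma>2"
proof -
  have i1: "integrable \<nu> (\<lambda>x. \<Sum>i\<in>{1..M} - {m}. (cmod (gain c i x))\<^sup>2 / M)"
    by (intro Bochner_Integration.integrable_sum integrable_divide gain_interference) auto
  have i2: "integrable \<nu> (\<lambda>x. \<Sum>k = 1..K. (cmod (noise_gain e k x))\<^sup>2 * \<sigma>2)"
    by (intro Bochner_Integration.integrable_sum integrable_mult_left noise_gain_power) auto
  show "integrable \<nu> (interference c e \<sigma>2)"
    unfolding interference_def[abs_def] using i1 i2 by simp
  have "expectation (interference c e \<sigma>2) = \<sigma>2 + ((\<integral>x. (\<Sum>i\<in>{1..M} - {m}. (cmod (gain c i x))\<^sup>2 / M) \<partial>\<nu>)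
      + (\<integral>x. (\<Sum>k = 1..K. (cmod (noise_gain e k x))\<^sup>2 * \<sigma>2) \<partial>\<nu>))"
    unfolding interference_def[abs_def] using i1 i2 by (simp add: prob_space)
  also have "(\<integral>x. (\<Sum>i\<in>{1..M} - {m}. (cmod (gain c i x))\<^sup>2 / M) \<partial>\<nu>) = (\<Sum>i\<in>{1..M} - {m}. (\<integral>x. (cmod (gain c i x))\<^sup>2 \<partial>\<nu>) / M)"
    by (subst Bochner_Integration.integral_sum) (auto intro!: integrable_divide gain_interference)
  also have "(\<integral>x. (\<Sum>k = 1..K. (cmod (noise_gain e k x))\<^sup>2 * \<sigma>2) \<partial>\<nu>) = (\<Sum>k = 1..K. (\<integral>x. (cmod (noise_gain e k x))\<^sup>2 \<partial>\<nu>) * \<sigma>2)"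
    by (subst Bochner_Integration.integral_sum) (auto intro!: integrable_mult_left noise_gain_power)
  also have "(\<Sum>k = 1..K. (\<integral>x. (cmod (noise_gain e k x))\<^sup>2 \<partial>\<nu>) * \<sigma>2) \<le> (\<Sum>k = 1..K. (e k)\<^sup>2 / K * \<sigma>2)"
    using assms by (intro sum_mono mult_right_mono noise_gain_power) auto
  also have "(\<Sum>i\<in>{1..M} - {m}. (\<integral>x. (cmod (gain c i x))\<^sup>2 \<partial>\<nu>) / M) \<le> (\<Sum>i\<in>{1..M} - {m}. ((\<Sum>k = 1..K. (c i k)\<^sup>2) / K) / M)"
    by (intro sum_mono divide_right_mono gain_interference) auto
  finally show "expectation (interference c e \<sigma>2) \<le> mean_interference c e \<sigma>2"
    unfolding mean_interference_def by (simp add: sum_divide_distrib sum_distrib_right)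
qed

text \<open>The power splits into contributions of single relays, which deviate by order
  \<open>1 / sqrt K\<close>, and cross terms between relays, of order \<open>1 / sqrt M\<close>. The
  weight \<open>1 / M\<close> of each source keeps the sum over the interferers uniform in
  \<open>M\<close>.\<close>

lemma interference_concentration:
  fixes c :: "nat \<Rightarrow> nat \<Rightarrow> real" and e :: "nat \<Rightarrow> real"
  assumes C: "0 < C" "\<And>i k. i \<in> {1..M} \<Longrightarrow> k \<in> {1..K} \<Longrightarrow> \<bar>c i k\<bar> \<le> C"
    and B: "0 < B" "\<And>k. k \<in> {1..K} \<Longrightarrow> \<bar>e k\<bar> \<le> B" and s: "0 \<le> \<sigma>2"
  shows "(\<integral>x. \<bar>interference c e \<sigma>2 x - mean_interference c e \<sigma>2\<bar> \<partial>\<nu>)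
    \<le> (7 * C\<^sup>2 + 7 * B\<^sup>2 * \<sigma>2) / sqrt K + 2 * C\<^sup>2 / sqrt M"
proof -
  have Kpos: "0 < real K" and Mpos: "0 < real M" using K M by auto
  define T where "T i x = (\<Sum>k = 1..K. (c i k)\<^sup>2 * ((cmod (x (Relay_Dest_Gain m k)))\<^sup>2 * (cmod (x (Source_Relay_Gain k i)))\<^sup>2)
      * (cmod (phase_sum k x))\<^sup>2) / (real K * real M)" for i x
  define N where "N x = (\<Sum>k = 1..K. (e k)\<^sup>2 * ((cmod (x (Relay_Dest_Gain m k)))\<^sup>2 * 1)
      * (cmod (phase_sum k x))\<^sup>2) / (real K * real M)" for x
  define R where "R x = (\<Sum>i\<in>{1..M} - {m}. 2 * (\<Sum>(k, l)\<in>pairs K. (c i k * c i l) * (signal_sum k i x \<bullet> signal_sum l i x)) / (real K * real M)) / M" for x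
  define t where "t i x = T i x - (\<Sum>k = 1..K. (c i k)\<^sup>2) / K" for i x
  define n where "n x = N x - (\<Sum>k = 1..K. (e k)\<^sup>2) / K" for x
  have sq_le: "\<bar>z\<^sup>2\<bar> \<le> b\<^sup>2" if "\<bar>z\<bar> \<le> b" for z b :: real
    using power_mono[OF that, of 2] by simp
  have t: "integrable \<nu> (t i)" "(\<integral>x. \<bar>t i x\<bar> \<partial>\<nu>) \<le> 7 * C\<^sup>2 / sqrt K" if "i \<in> {1..M} - {m}" for i
  proof -
    have p4: "has_bochner_integral (CN 1) (\<lambda>z. ((cmod z)\<^sup>2)\<^sup>2) 2"
      using has_bochner_integral_CN_moments(3) by (simp flip: power_mult)
    have a: "\<And>k. k \<in> {1..K} \<Longrightarrow> \<bar>(c i k)\<^sup>2\<bar> \<le> C\<^sup>2" using C that by (intro sq_le) auto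
    have "i \<in> {1..M}" "0 < C\<^sup>2" using that C by auto
    from diagonal_concentration[OF this a _ has_bochner_integral_CN_moments(2) p4]
    show "integrable \<nu> (t i)" "(\<integral>x. \<bar>t i x\<bar> \<partial>\<nu>) \<le> 7 * C\<^sup>2 / sqrt K"
      unfolding t_def[abs_def] T_def by auto
  qed
  have n: "integrable \<nu> n" "(\<integral>x. \<bar>n x\<bar> \<partial>\<nu>) \<le> 7 * B\<^sup>2 / sqrt K"
  proof -
    have p4: "has_bochner_integral (CN 1) (\<lambda>z. (1::real)\<^sup>2) 1"
      using has_bochner_integral_CN_const[of 1] by simp
    have a: "\<And>k. k \<in> {1..K} \<Longrightarrow> \<bar>(e k)\<^sup>2\<bar> \<le> B\<^sup>2" using B by (intro sq_le) auto
    have "0 < B\<^sup>2" using B by auto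
    from diagonal_concentration[OF m this a _ has_bochner_integral_CN_const[of 1] p4]
    show "integrable \<nu> n" "(\<integral>x. \<bar>n x\<bar> \<partial>\<nu>) \<le> 7 * B\<^sup>2 / sqrt K"
      unfolding n_def[abs_def] N_def by auto
  qed
  have R: "integrable \<nu> R" "(\<integral>x. \<bar>R x\<bar> \<partial>\<nu>) \<le> 2 * C\<^sup>2 / sqrt M"
    unfolding R_def[abs_def] by (rule cross_relay_concentration[of C c]; use C in auto)+
  have gain_eq: "(cmod (gain c i x))\<^sup>2 = T i x + 2 * (\<Sum>(k, l)\<in>pairs K. (c i k * c i l) * (signal_sum k i x \<bullet> signal_sum l i x)) / (real K * real M)" for i x
  proof -
    have sum: "(\<Sum>k = 1..K. \<Sum>n = 1..M. complex_of_real (c i k) * signal_term k n i x) = (\<Sum>k = 1..K. of_real (c i k) * signal_sum k i x)"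
      by (simp add: signal_sum_def sum_distrib_left)
    \<comment> \<open>The forwarding gain and the gain of source \<open>i\<close> are common to all
      phases at relay \<open>k\<close>; this gives the diagonal the shape required by
      \<open>diagonal_concentration\<close>.\<close>
    have ms: "signal_sum k i x = x (Relay_Dest_Gain m k) * x (Source_Relay_Gain k i) * phase_sum k x" for k
      by (simp add: signal_sum_def signal_term_eq phase_sum_def sum_distrib_left)
    have "(cmod (\<Sum>k = 1..K. of_real (c i k) * signal_sum k i x))\<^sup>2 =
        (\<Sum>k = 1..K. (cmod (of_real (c i k) * signal_sum k i x))\<^sup>2) + 2 * (\<Sum>(k, l)\<in>pairs K. (of_real (c i k) * signal_sum k i x) \<bullet> (of_real (c i l) * signal_sum l i x))"
      unfolding pairs_def by (rule norm_sum_square_pairs) simp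
    also have "(\<Sum>k = 1..K. (cmod (of_real (c i k) * signal_sum k i x))\<^sup>2) = T i x * (real K * real M)"
      using Kpos Mpos by (simp add: T_def ms norm_mult power_mult_distrib mult_ac)
    also have "(\<Sum>(k, l)\<in>pairs K. (complex_of_real (c i k) * signal_sum k i x) \<bullet> (of_real (c i l) * signal_sum l i x))
      = (\<Sum>(k, l)\<in>pairs K. (c i k * c i l) * (signal_sum k i x \<bullet> signal_sum l i x))"
      by (intro sum.cong) (auto simp: inner_complex_def algebra_simps)
    finally show ?thesis
      unfolding gain_def scaled_norm2 sum using Kpos Mpos by (simp add: add_divide_distrib)
  qed
  have noise_eq: "(\<Sum>k = 1..K. (cmod (noise_gain e k x))\<^sup>2 * \<sigma>2) = N x * \<sigma>2" for x
  proof -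
    have "(cmod (noise_gain e k x))\<^sup>2 = (e k)\<^sup>2 * ((cmod (x (Relay_Dest_Gain m k)))\<^sup>2 * 1) * (cmod (phase_sum k x))\<^sup>2 / (real K * real M)" for k
    proof -
      have "(\<Sum>n = 1..M. complex_of_real (e k) * noise_term k n x) = of_real (e k) * (x (Relay_Dest_Gain m k) * phase_sum k x)"
        by (simp add: noise_term_eq phase_sum_def sum_distrib_left)
      then show ?thesis unfolding noise_gain_def scaled_norm2 by (simp add: norm_mult power_mult_distrib mult_ac)
    qed
    then show ?thesis by (simp add: N_def sum_divide_distrib sum_distrib_right)
  qed
  have eq: "interference c e \<sigma>2 x - mean_interference c e \<sigma>2 = (\<Sum>i\<in>{1..M} - {m}. t i x / M) + R x + n x * \<sigma>2" for x
    unfolding interference_def mean_interference_def noise_eq gain_eq R_def t_def n_def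
    by (simp add: add_divide_distrib diff_divide_distrib sum.distrib sum_subtractf sum_divide_distrib algebra_simps)
  have "(\<integral>x. \<bar>interference c e \<sigma>2 x - mean_interference c e \<sigma>2\<bar> \<partial>\<nu>)
    \<le> (\<integral>x. (\<Sum>i\<in>{1..M} - {m}. \<bar>t i x\<bar> / M) + \<bar>R x\<bar> + \<bar>n x\<bar> * \<sigma>2 \<partial>\<nu>)"
  proof (rule integral_mono)
    show "integrable \<nu> (\<lambda>x. \<bar>interference c e \<sigma>2 x - mean_interference c e \<sigma>2\<bar>)"
      using integrable_interference(1)[OF s, of c e] by simp
    show "integrable \<nu> (\<lambda>x. (\<Sum>i\<in>{1..M} - {m}. \<bar>t i x\<bar> / M) + \<bar>R x\<bar> + \<bar>n x\<bar> * \<sigma>2)"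
      using t R n by (intro Bochner_Integration.integrable_add Bochner_Integration.integrable_sum) auto
    fix x
    have "\<bar>\<Sum>i\<in>{1..M} - {m}. t i x / M\<bar> \<le> (\<Sum>i\<in>{1..M} - {m}. \<bar>t i x / M\<bar>)" by (rule sum_abs)
    moreover have "\<bar>n x * \<sigma>2\<bar> = \<bar>n x\<bar> * \<sigma>2" using s by (simp add: abs_mult)
    ultimately show "\<bar>interference c e \<sigma>2 x - mean_interference c e \<sigma>2\<bar> \<le> (\<Sum>i\<in>{1..M} - {m}. \<bar>t i x\<bar> / M) + \<bar>R x\<bar> + \<bar>n x\<bar> * \<sigma>2"
      unfolding eq by simp
  qed
  also have "\<dots> = (\<Sum>i\<in>{1..M} - {m}. (\<integral>x. \<bar>t i x\<bar> \<partial>\<nu>) / M) + (\<integral>x. \<bar>R x\<bar> \<partial>\<nu>) + (\<integral>x. \<bar>n x\<bar> \<partial>\<nu>) * \<sigma>2"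
  proof -
    have "(\<integral>x. (\<Sum>i\<in>{1..M} - {m}. \<bar>t i x\<bar> / M) \<partial>\<nu>) = (\<Sum>i\<in>{1..M} - {m}. (\<integral>x. \<bar>t i x\<bar> \<partial>\<nu>) / M)"
      by (subst Bochner_Integration.integral_sum) (use t in auto)
    moreover have "integrable \<nu> (\<lambda>x. \<Sum>i\<in>{1..M} - {m}. \<bar>t i x\<bar> / M)"
      by (intro Bochner_Integration.integrable_sum) (use t in auto)
    ultimately show ?thesis using R n by simp
  qed
  also have "\<dots> \<le> 7 * C\<^sup>2 / sqrt K + 2 * C\<^sup>2 / sqrt M + 7 * B\<^sup>2 / sqrt K * \<sigma>2"
  proof (intro add_mono mult_right_mono R n s)
    have "(\<Sum>i\<in>{1..M} - {m}. (\<integral>x. \<bar>t i x\<bar> \<partial>\<nu>) / M) \<le> (\<Sum>i\<in>{1..M} - {m}. 7 * C\<^sup>2 / sqrt K / M)"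
      using t by (intro sum_mono divide_right_mono) auto
    also have "\<dots> = real (card ({1..M} - {m})) * (7 * C\<^sup>2 / sqrt K / M)" by simp
    also have "\<dots> \<le> real M * (7 * C\<^sup>2 / sqrt K / M)"
      using card_mono[of "{1..M}" "{1..M} - {m}"] by (intro mult_right_mono) auto
    also have "\<dots> = 7 * C\<^sup>2 / sqrt K" using Mpos by simp
    finally show "(\<Sum>i\<in>{1..M} - {m}. (\<integral>x. \<bar>t i x\<bar> \<partial>\<nu>) / M) \<le> 7 * C\<^sup>2 / sqrt K" .
  qed
  also have "\<dots> = (7 * C\<^sup>2 + 7 * B\<^sup>2 * \<sigma>2) / sqrt K + 2 * C\<^sup>2 / sqrt M"
    by (simp add: add_divide_distrib)
  finally show ?thesis .
qed

end

section \<open>The network as a Gaussian channel\<close>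

lemma phase_eq_sgn: "z \<noteq> 0 \<Longrightarrow> phase z = sgn z"
  by (simp add: phase_def cis_Arg)

context relay_network
begin

definition rv :: "rv_index \<Rightarrow> 'a \<Rightarrow> complex" where
  "rv i = (case i of Source_Relay_Gain k m \<Rightarrow> h k m | Relay_Dest_Gain m k \<Rightarrow> f m k
     | Source_Signal m \<Rightarrow> s m | Relay_Noise k \<Rightarrow> z k | Dest_Noise m \<Rightarrow> w m)"

definition rv_variance :: "rv_index \<Rightarrow> real" where
  "rv_variance i = (case i of Source_Relay_Gain k m \<Rightarrow> 1 | Relay_Dest_Gain m k \<Rightarrow> 1
     | Source_Signal m \<Rightarrow> 1 / real M | Relay_Noise k \<Rightarrow> \<sigma>2 | Dest_Noise m \<Rightarrow> \<sigma>2)"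

definition gains :: "'a \<Rightarrow> rv_index \<Rightarrow> complex" where
  "gains \<omega> = (\<lambda>i\<in>gain_indices M K. rv i \<omega>)"

text \<open>Noise at the other destinations is listed, with coefficient 0 later, so that the blocks
  exhaust \<open>rv_indices\<close>.\<close>

definition other_indices :: "nat \<Rightarrow> rv_index set" where
  "other_indices m = Source_Signal ` ({1..M} - {m}) \<union> Relay_Noise ` {1..K} \<union> Dest_Noise ` ({1..M} - {m})"

lemma finite_other_indices: "finite (other_indices m)"
  by (simp add: other_indices_def)

lemma sum_other_indices:
  "(\<Sum>i\<in>other_indices m. F i) = (\<Sum>i\<in>{1..M} - {m}. F (Source_Signal i)) + (\<Sum>k = 1..K. F (Relay_Noise k))
    + (\<Sum>i\<in>{1..M} - {m}. F (Dest_Noise i))"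
proof -
  have "(\<Sum>i\<in>other_indices m. F i) = (\<Sum>i\<in>Source_Signal ` ({1..M} - {m}) \<union> Relay_Noise ` {1..K}. F i) + (\<Sum>i\<in>Dest_Noise ` ({1..M} - {m}). F i)"
    unfolding other_indices_def by (rule sum.union_disjoint) auto
  also have "(\<Sum>i\<in>Source_Signal ` ({1..M} - {m}) \<union> Relay_Noise ` {1..K}. F i)
      = (\<Sum>i\<in>Source_Signal ` ({1..M} - {m}). F i) + (\<Sum>i\<in>Relay_Noise ` {1..K}. F i)"
    by (rule sum.union_disjoint) auto
  finally show ?thesis by (simp add: sum.reindex inj_on_def)
qed

lemma rv_indices_eq:
  assumes "m \<in> {1..M}"
  shows "rv_indices M K = gain_indices M K \<union> insert (Source_Signal m) (insert (Dest_Noise m) (other_indices m))"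
  using assms unfolding rv_indices_def gain_indices_def other_indices_def by auto

lemma distr_rv:
  assumes "i \<in> rv_indices M K" "1 \<le> M" "0 < \<sigma>2"
  shows "rv i \<in> borel_measurable \<Omega>" "distr \<Omega> borel (rv i) = CN (rv_variance i)"
proof -
  have g: "complex_gaussian \<Omega> (rv_variance i) (rv i)"
    using assms(1) h_gaussian f_gaussian s_gaussian z_gaussian w_gaussian
    unfolding rv_indices_def rv_def rv_variance_def by auto
  show "rv i \<in> borel_measurable \<Omega>"
    using g unfolding complex_gaussian_def distributed_def by simp
  show "distr \<Omega> borel (rv i) = CN (rv_variance i)"
    by (rule complex_gaussian_distr[OF g]) (use assms in \<open>auto simp: rv_variance_def split: rv_index.split\<close>)
qed

text \<open>Given the channel gains, the output at destination \<open>m\<close> is a linear combination of independent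
  Gaussian variables.\<close>

lemma gaussian_channel:
  assumes m: "m \<in> {1..M}" and K: "1 \<le> K" and s2: "0 < \<sigma>2"
  shows "gaussian_channel \<Omega> (gaussian_family.\<nu> (gain_indices M K)) gains (s m) (received m)
    (network_gains.gain M K m (C_sig m) m) (network_gains.interference M K m (C_sig m) (C_noise m) \<sigma>2) (1 / real M) \<sigma>2"
proof -
  interpret G: network_gains M K m using m K by unfold_locales
  let ?J = "gain_indices M K" and ?R = "rv_indices M K" and ?src = "Source_Signal m" and ?dst = "Dest_Noise m"
  let ?I = "other_indices m" and ?q = "1 / real M" and ?N = "\<lambda>A. Pi\<^sub>M A (\<lambda>i. CN (rv_variance i))"
  let ?S = "insert ?src (insert ?dst ?I)"
  let ?G = "G.gain (C_sig m)" and ?B = "G.noise_gain (C_noise m)" and ?D = "G.interference (C_sig m) (C_noise m) \<sigma>2"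
  have M: "1 \<le> M" using m by simp
  have vpos: "0 < rv_variance i" for i
    using M s2 by (simp add: rv_variance_def split: rv_index.split)
  interpret P: product_sigma_finite "\<lambda>i. CN (rv_variance i)"
    by (intro product_sigma_finite.intro prob_space_imp_sigma_finite prob_space_CN vpos)
  have R: "?R = ?J \<union> ?S" by (rule rv_indices_eq[OF m])
  have disj: "?J \<inter> ?S = {}" "?src \<notin> insert ?dst ?I" "?dst \<notin> ?I"
    by (auto simp: gain_indices_def other_indices_def)
  have fin: "finite ?J" "finite ?I" by (simp_all add: finite_gain_indices finite_other_indices)
  have rv_meas: "rv i \<in> borel_measurable \<Omega>" if "i \<in> ?R" for i by (rule distr_rv(1)[OF that M s2])
  have nu: "G.\<nu> = ?N ?J"
    unfolding G.\<nu>_def by (rule PiM_cong) (auto simp: gain_indices_def rv_variance_def)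
  have joint: "distr \<Omega> (Pi\<^sub>M ?R (\<lambda>_. borel)) (\<lambda>\<omega>. \<lambda>i\<in>?R. rv i \<omega>) = ?N ?R"
  proof -
    have "indep_vars (\<lambda>_. borel) rv ?R"
      using independent unfolding rv_def[abs_def] .
    moreover have "?R \<noteq> {}" using R by simp
    ultimately have "distr \<Omega> (Pi\<^sub>M ?R (\<lambda>_. borel)) (\<lambda>\<omega>. \<lambda>i\<in>?R. rv i \<omega>) = Pi\<^sub>M ?R (\<lambda>i. distr \<Omega> borel (rv i))"
      using rv_meas by (subst (asm) indep_vars_iff_distr_eq_PiM') auto
    also have "\<dots> = ?N ?R"
      by (rule PiM_cong) (auto simp: distr_rv(2)[OF _ M s2])
    finally show ?thesis .
  qed
  have sets_CN: "sets (?N A) = sets (Pi\<^sub>M A (\<lambda>_. borel))" for A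
    by (rule sets_PiM_cong) auto
  have coord: "(\<lambda>u. u i) \<in> borel_measurable (?N A)" if "i \<in> A" for i A
    using measurable_component_singleton[OF that, of "\<lambda>i. CN (rv_variance i)"]
    by (simp cong: measurable_cong_sets)
  define cf where "cf i x = (case i of Source_Signal i' \<Rightarrow> ?G i' x | Relay_Noise k \<Rightarrow> ?B k x | _ \<Rightarrow> 0)" for i x
  have cf_meas [measurable]: "cf i \<in> borel_measurable G.\<nu>" if "i \<in> ?I" for i
    using that G.measurable_gains unfolding cf_def[abs_def] other_indices_def by auto
  \<comment> \<open>The received value as a function of the sample coordinates, with
    \<open>sgn\<close> for \<open>phase\<close>; the two agree unless some gain is 0.\<close>
  define lin where "lin u = u ?dst + (\<Sum>i\<in>?I. cf i (restrict u ?J) * u i) + ?G m (restrict u ?J) * u ?src" for u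
  have D_eq: "?D x = \<sigma>2 + (\<Sum>i\<in>?I. (cmod (cf i x))\<^sup>2 * rv_variance i)" for x
    unfolding G.interference_def sum_other_indices by (simp add: cf_def rv_variance_def)
  have D_ge: "\<sigma>2 \<le> ?D x" for x
    unfolding G.interference_def using s2 by (simp add: sum_nonneg)

  have gains_meas [measurable]: "gains \<in> measurable \<Omega> G.\<nu>"
  proof -
    have "gains \<in> measurable \<Omega> (Pi\<^sub>M ?J (\<lambda>_. borel))"
      unfolding gains_def[abs_def] using rv_meas R by (intro measurable_restrict) auto
    then show ?thesis by (simp cong: measurable_cong_sets add: G.sets_\<nu>)
  qed
  have [measurable]: "s m \<in> borel_measurable \<Omega>"
    using rv_meas[of ?src] R by (simp add: rv_def)
  have hf_meas: "h k n \<in> borel_measurable \<Omega>" "f n k \<in> borel_measurable \<Omega>" if "k \<in> {1..K}" "n \<in> {1..M}" for k n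
    using rv_meas[of "Source_Relay_Gain k n"] rv_meas[of "Relay_Dest_Gain n k"] that G.gain_indexI R
    by (auto simp: rv_def)

  have ae: "AE \<omega> in \<Omega>. received m \<omega> = lin (\<lambda>i\<in>?R. rv i \<omega>)"
  proof -
    have "AE \<omega> in \<Omega>. \<forall>i\<in>?J. rv i \<omega> \<noteq> 0"
    proof (rule AE_finite_allI[OF fin(1)])
      fix i assume i: "i \<in> ?J"
      then have iR: "i \<in> ?R" using R by simp
      have "AE x in distr \<Omega> borel (rv i). x \<noteq> 0"
        unfolding distr_rv(2)[OF iR M s2] by (rule AE_CN_nonzero)
      then show "AE \<omega> in \<Omega>. rv i \<omega> \<noteq> 0" using rv_meas[OF iR] by (subst (asm) AE_distr_iff) auto
    qed
    then show ?thesis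
    proof eventually_elim
      case (elim \<omega>)
      define v where "v = (\<lambda>i\<in>?R. rv i \<omega>)"
      let ?r = "1 / complex_of_real (sqrt (real K * real M))"
      have val: "restrict v ?J = gains \<omega>"
        unfolding gains_def v_def using R by (auto simp: restrict_def fun_eq_iff)
      have g: "gains \<omega> (Source_Relay_Gain k n) = h k n \<omega>" "gains \<omega> (Relay_Dest_Gain n k) = f n k \<omega>"
        "phase (h k n \<omega>) = sgn (h k n \<omega>)" "phase (f n k \<omega>) = sgn (f n k \<omega>)"
        if "k \<in> {1..K}" "n \<in> {1..M}" for k n
        using that G.gain_indexI[OF that] bspec[OF elim, of "Source_Relay_Gain k n"] bspec[OF elim, of "Relay_Dest_Gain n k"]
        by (auto simp: gains_def rv_def phase_eq_sgn)
      have gain: "?G i (gains \<omega>) = ?r * (\<Sum>k = 1..K. \<Sum>n = 1..M. a_coeff m i n k \<omega>)" if "i \<in> {1..M}" for i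
      proof -
        have "(\<Sum>k = 1..K. \<Sum>n = 1..M. of_real (C_sig m i k) * G.signal_term k n i (gains \<omega>)) = (\<Sum>k = 1..K. \<Sum>n = 1..M. a_coeff m i n k \<omega>)"
          using that m by (intro sum.cong refl) (simp add: G.signal_term_def G.noise_term_def a_coeff_def g mult_ac)
        then show ?thesis by (simp add: G.gain_def)
      qed
      have noise: "?B k (gains \<omega>) * z k \<omega> = ?r * (\<Sum>n = 1..M. b_coeff m n k \<omega> * z k \<omega>)" if "k \<in> {1..K}" for k
      proof -
        have "(\<Sum>n = 1..M. of_real (C_noise m k) * G.noise_term k n (gains \<omega>)) = (\<Sum>n = 1..M. b_coeff m n k \<omega>)"
          using that m by (intro sum.cong refl) (simp add: G.noise_term_def b_coeff_def g mult_ac)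
        then show ?thesis by (simp add: G.noise_gain_def sum_distrib_right)
      qed
      have ur: "v i = rv i \<omega>" if "i \<in> ?R" for i using that by (simp add: v_def)
      have mem: "?dst \<in> ?R" "?src \<in> ?R" "\<And>i. i \<in> {1..M} - {m} \<Longrightarrow> Source_Signal i \<in> ?R" "\<And>k. k \<in> {1..K} \<Longrightarrow> Relay_Noise k \<in> ?R"
        using m unfolding rv_indices_def by blast+
      have u: "v ?dst = w m \<omega>" "v ?src = s m \<omega>" "\<And>i. i \<in> {1..M} - {m} \<Longrightarrow> v (Source_Signal i) = s i \<omega>"
        "\<And>k. k \<in> {1..K} \<Longrightarrow> v (Relay_Noise k) = z k \<omega>"
        unfolding mem[THEN ur] by (simp_all add: rv_def)
      have "(\<Sum>i\<in>?I. cf i (gains \<omega>) * v i) = (\<Sum>i\<in>{1..M} - {m}. ?G i (gains \<omega>) * s i \<omega>) + (\<Sum>k = 1..K. ?B k (gains \<omega>) * z k \<omega>)"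
        unfolding sum_other_indices by (auto simp: cf_def u intro!: arg_cong2[where f="(+)"] sum.cong)
      also have "(\<Sum>i\<in>{1..M} - {m}. ?G i (gains \<omega>) * s i \<omega>)
          = (\<Sum>i\<in>{1..M} - {m}. s i \<omega> * ?r * (\<Sum>k = 1..K. \<Sum>n = 1..M. a_coeff m i n k \<omega>))"
        by (intro sum.cong refl, subst gain) (simp_all only: mult_ac, simp)
      also have "(\<Sum>k = 1..K. ?B k (gains \<omega>) * z k \<omega>) = ?r * (\<Sum>k = 1..K. \<Sum>n = 1..M. b_coeff m n k \<omega> * z k \<omega>)"
      proof -
        have "(\<Sum>k = 1..K. ?B k (gains \<omega>) * z k \<omega>) = (\<Sum>k = 1..K. ?r * (\<Sum>n = 1..M. b_coeff m n k \<omega> * z k \<omega>))"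
          by (intro sum.cong refl noise)
        then show ?thesis by (simp only: sum_distrib_left[of ?r, symmetric])
      qed
      finally have "lin v = w m \<omega> + ((\<Sum>i\<in>{1..M} - {m}. s i \<omega> * ?r * (\<Sum>k = 1..K. \<Sum>n = 1..M. a_coeff m i n k \<omega>))
          + ?r * (\<Sum>k = 1..K. \<Sum>n = 1..M. b_coeff m n k \<omega> * z k \<omega>)) + ?r * (\<Sum>k = 1..K. \<Sum>n = 1..M. a_coeff m m n k \<omega>) * s m \<omega>"
        unfolding lin_def val u gain[OF m] by simp
      then show ?case unfolding received_def v_def[symmetric] by (simp only: ac_simps)
    qed
  qed

  have received_meas: "received m \<in> borel_measurable \<Omega>"
  proof -
    \<comment> \<open>Measurability of \<open>phase\<close> is obtained from \<open>sgn\<close>,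
      with the value 1 at 0 restored.\<close>
    have ph: "(\<lambda>\<omega>. cnj (phase (g \<omega>))) \<in> borel_measurable \<Omega>" if [measurable]: "g \<in> borel_measurable \<Omega>" for g
    proof -
      have "(\<lambda>\<omega>. cnj (phase (g \<omega>))) = (\<lambda>\<omega>. if g \<omega> = 0 then 1 else cnj (sgn (g \<omega>)))"
        by (simp add: fun_eq_iff phase_def cis_Arg Arg_zero)
      also have "\<dots> \<in> borel_measurable \<Omega>" by measurable
      finally show ?thesis .
    qed
    have "a_coeff m i n k \<in> borel_measurable \<Omega>" "b_coeff m n k \<in> borel_measurable \<Omega>"
      if "i \<in> {1..M}" "n \<in> {1..M}" "k \<in> {1..K}" for i n k
      unfolding a_coeff_def[abs_def] b_coeff_def[abs_def] using that m
      by (auto intro!: borel_measurable_times ph hf_meas)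
    moreover have "s i \<in> borel_measurable \<Omega>" "w i \<in> borel_measurable \<Omega>" if "i \<in> {1..M}" for i
      using rv_meas[of "Source_Signal i"] rv_meas[of "Dest_Noise i"] that by (auto simp: rv_def rv_indices_def)
    moreover have "z k \<in> borel_measurable \<Omega>" if "k \<in> {1..K}" for k
      using rv_meas[of "Relay_Noise k"] that by (auto simp: rv_def rv_indices_def)
    ultimately show ?thesis
      unfolding received_def[abs_def] using m
      by (intro borel_measurable_add borel_measurable_times borel_measurable_sum borel_measurable_const) auto
  qed

  show ?thesis
  proof (unfold_locales)
    show "0 < 1 / real M" "0 < \<sigma>2" using M s2 by auto
    show "\<sigma>2 \<le> ?D x" for x by (rule D_ge)
    show "gains \<in> measurable \<Omega> G.\<nu>" "s m \<in> borel_measurable \<Omega>" by measurable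
    show "received m \<in> borel_measurable \<Omega>" by (rule received_meas)
    show "?G m \<in> borel_measurable G.\<nu>" using m by measurable
    show "?D \<in> borel_measurable G.\<nu>" by measurable
    show "integrable G.\<nu> (\<lambda>x. (cmod (?G m x))\<^sup>2)"
    proof (rule Bochner_Integration.integrable_bound)
      define \<mu> where "\<mu> = complex_of_real (pi / (4 * sqrt (real K * real M)) * (\<Sum>k = 1..K. C_sig m m k))"
      show "integrable G.\<nu> (\<lambda>x. 2 * (cmod (?G m x - \<mu>))\<^sup>2 + 2 * (cmod \<mu>)\<^sup>2)"
        using G.gain_variance(1)[of "C_sig m"] by (simp add: \<mu>_def)
      show "(\<lambda>x. (cmod (?G m x))\<^sup>2) \<in> borel_measurable G.\<nu>" using m by measurable
      have "(cmod a)\<^sup>2 \<le> 2 * (cmod (a - \<mu>))\<^sup>2 + 2 * (cmod \<mu>)\<^sup>2" for a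
      proof -
        have "(cmod a)\<^sup>2 \<le> (cmod (a - \<mu>) + cmod \<mu>)\<^sup>2"
          using norm_triangle_ineq[of "a - \<mu>" \<mu>] by (intro power_mono) auto
        also have "\<dots> \<le> 2 * (cmod (a - \<mu>))\<^sup>2 + 2 * (cmod \<mu>)\<^sup>2"
          using sum_squares_bound[of "cmod (a - \<mu>)" "cmod \<mu>"] by (simp add: power2_sum)
        finally show ?thesis .
      qed
      then show "AE x in G.\<nu>. norm ((cmod (?G m x))\<^sup>2) \<le> norm (2 * (cmod (?G m x - \<mu>))\<^sup>2 + 2 * (cmod \<mu>)\<^sup>2)"
        by simp
    qed
    show "integrable G.\<nu> ?D" using s2 by (intro G.integrable_interference) simp
  next
    fix \<phi> :: "(rv_index \<Rightarrow> complex) \<times> complex \<times> complex \<Rightarrow> ennreal"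
    assume phi [measurable]: "\<phi> \<in> borel_measurable (G.\<nu> \<Otimes>\<^sub>M (borel \<Otimes>\<^sub>M borel))"
    define \<Phi> where "\<Phi> u = \<phi> (restrict u ?J, u ?src, lin u)" for u
    have \<Phi>_meas: "\<Phi> \<in> borel_measurable (?N ?R)"
    proof -
      have [measurable]: "(\<lambda>u. u i) \<in> borel_measurable (?N ?R)" if "i \<in> ?R" for i
        by (rule coord[OF that])
      have [measurable]: "(\<lambda>u. restrict u ?J) \<in> measurable (?N ?R) G.\<nu>"
        unfolding nu using R by (intro measurable_restrict_subset) auto
      have idx: "?src \<in> ?R" "?dst \<in> ?R" "\<And>i. i \<in> ?I \<Longrightarrow> i \<in> ?R" using R by auto
      have [measurable]: "lin \<in> borel_measurable (?N ?R)"
        unfolding lin_def[abs_def] using idx m by measurable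
      show ?thesis unfolding \<Phi>_def[abs_def] using idx by measurable
    qed
    have "(\<integral>\<^sup>+\<omega>. \<phi> (gains \<omega>, s m \<omega>, received m \<omega>) \<partial>\<Omega>) = (\<integral>\<^sup>+\<omega>. \<Phi> (\<lambda>i\<in>?R. rv i \<omega>) \<partial>\<Omega>)"
    proof (rule nn_integral_cong_AE)
      show "AE \<omega> in \<Omega>. \<phi> (gains \<omega>, s m \<omega>, received m \<omega>) = \<Phi> (\<lambda>i\<in>?R. rv i \<omega>)"
        using ae
      proof eventually_elim
        case (elim \<omega>)
        have "restrict (\<lambda>i\<in>?R. rv i \<omega>) ?J = gains \<omega>"
          unfolding gains_def using R by (auto simp: restrict_def fun_eq_iff)
        moreover have "(\<lambda>i\<in>?R. rv i \<omega>) ?src = s m \<omega>" using R by (simp add: rv_def)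
        ultimately show ?case by (simp add: \<Phi>_def elim)
      qed
    qed
    also have "\<dots> = (\<integral>\<^sup>+u. \<Phi> u \<partial>?N ?R)"
    proof -
      have "\<Phi> \<in> borel_measurable (Pi\<^sub>M ?R (\<lambda>_. borel))"
        using \<Phi>_meas by (simp cong: measurable_cong_sets add: sets_CN)
      moreover have "(\<lambda>\<omega>. \<lambda>i\<in>?R. rv i \<omega>) \<in> measurable \<Omega> (Pi\<^sub>M ?R (\<lambda>_. borel))"
        by (intro measurable_restrict rv_meas)
      ultimately show ?thesis unfolding joint[symmetric] by (subst nn_integral_distr) auto
    qed
    \<comment> \<open>The gains are integrated outermost, so that the rest takes place at a fixed
      state \<open>x\<close>.\<close>
    also have "\<dots> = (\<integral>\<^sup>+x. \<integral>\<^sup>+u. \<Phi> (merge ?J ?S (x, u))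
        \<partial>?N ?S \<partial>G.\<nu>)"
      unfolding R nu using \<Phi>_meas[unfolded R] disj fin by (intro P.product_nn_integral_fold) auto
    also have "\<dots> = (\<integral>\<^sup>+x. \<integral>\<^sup>+a. \<integral>\<^sup>+b. \<phi> (x, a, b + ?G m x * a) \<partial>CN (?D x) \<partial>CN ?q \<partial>G.\<nu>)"
    proof (rule nn_integral_cong)
      fix x assume x: "x \<in> space G.\<nu>"
      then have ext: "restrict x ?J = x"
        unfolding nu by (auto simp: space_PiM PiE_restrict)
      define \<Psi> where "\<Psi> u = \<phi> (x, u ?src, (u ?dst + (\<Sum>i\<in>?I. cf i x * u i)) + ?G m x * u ?src)" for u
      have merge: "\<Phi> (merge ?J ?S (x, u)) = \<Psi> u" for u
      proof -
        have r: "restrict (merge ?J ?S (x, u)) ?J = x"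
          using disj ext by simp
        have v: "merge ?J ?S (x, u) i = u i" if "i \<in> ?S" for i
          using disj that by simp
        show ?thesis unfolding \<Phi>_def \<Psi>_def lin_def r using v by (simp cong: sum.cong)
      qed
      have phi_x [measurable]: "(\<lambda>p. \<phi> (x, p)) \<in> borel_measurable (borel \<Otimes>\<^sub>M borel)" using x by measurable
      have \<Psi>_meas: "\<Psi> \<in> borel_measurable (?N ?S)"
      proof -
        have [measurable]: "(\<lambda>u. u i) \<in> borel_measurable (?N ?S)"
          if "i \<in> ?S" for i by (rule coord[OF that])
        show ?thesis unfolding \<Psi>_def[abs_def] by measurable
      qed
      define \<Xi> where "\<Xi> a u = \<phi> (x, a, (u ?dst + (\<Sum>i\<in>?I. cf i x * u i)) + ?G m x * a)" for a u
      have upd1: "\<Psi> (u(?src := a)) = \<Xi> a u" for a u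
      proof -
        have "(\<Sum>i\<in>?I. cf i x * (u(?src := a)) i) = (\<Sum>i\<in>?I. cf i x * u i)"
          using disj by (intro sum.cong) auto
        then show ?thesis by (simp add: \<Psi>_def \<Xi>_def)
      qed
      have upd2: "\<Xi> a (u(?dst := b)) = \<phi> (x, a, (b + (\<Sum>i\<in>?I. cf i x * u i)) + ?G m x * a)" for a b u
      proof -
        have "(\<Sum>i\<in>?I. cf i x * (u(?dst := b)) i) = (\<Sum>i\<in>?I. cf i x * u i)"
          using disj by (intro sum.cong) auto
        then show ?thesis by (simp add: \<Xi>_def)
      qed
      have \<Xi>_meas: "\<Xi> a \<in> borel_measurable (?N (insert ?dst ?I))" for a
      proof -
        have [measurable]: "(\<lambda>u. u i) \<in> borel_measurable (?N (insert ?dst ?I))"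
          if "i \<in> insert ?dst ?I" for i by (rule coord[OF that])
        show ?thesis unfolding \<Xi>_def[abs_def] by measurable
      qed
      \<comment> \<open>The own signal is integrated outermost and the own noise innermost. The
        latter has variance \<open>\<sigma>2\<close> and is the base noise into which
        \<open>CN_sum\<close> absorbs all other variables.\<close>
      have "(\<integral>\<^sup>+u. \<Psi> u \<partial>?N ?S)
        = (\<integral>\<^sup>+a. \<integral>\<^sup>+u. \<Xi> a u \<partial>?N (insert ?dst ?I) \<partial>CN ?q)"
        using fin disj by (subst P.product_nn_integral_insert_rev[OF _ _ \<Psi>_meas]) (auto simp: upd1 rv_variance_def)
      also have "\<dots> = (\<integral>\<^sup>+a. \<integral>\<^sup>+u. \<integral>\<^sup>+b. \<phi> (x, a, (b + (\<Sum>i\<in>?I. cf i x * u i)) + ?G m x * a)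
          \<partial>CN \<sigma>2 \<partial>?N ?I \<partial>CN ?q)"
        using fin disj by (subst P.product_nn_integral_insert[OF _ _ \<Xi>_meas]) (auto simp: upd2 rv_variance_def)
      also have "\<dots> = (\<integral>\<^sup>+a. \<integral>\<^sup>+b. \<phi> (x, a, b + ?G m x * a) \<partial>CN (?D x) \<partial>CN ?q)"
        unfolding D_eq using fin vpos s2
        by (intro nn_integral_cong CN_sum[where f="\<lambda>b. \<phi> (x, a, b + ?G m x * a)" for a]) auto
      finally show "(\<integral>\<^sup>+u. \<Phi> (merge ?J ?S (x, u))
          \<partial>?N ?S)
        = (\<integral>\<^sup>+a. \<integral>\<^sup>+b. \<phi> (x, a, b + ?G m x * a) \<partial>CN (?D x) \<partial>CN ?q)"
        unfolding merge .
    qed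
    finally show "(\<integral>\<^sup>+\<omega>. \<phi> (gains \<omega>, s m \<omega>, received m \<omega>) \<partial>\<Omega>)
      = (\<integral>\<^sup>+x. \<integral>\<^sup>+a. \<integral>\<^sup>+b. \<phi> (x, a, b + ?G m x * a) \<partial>CN (?D x) \<partial>CN ?q \<partial>G.\<nu>)" .
  qed
qed

end

section \<open>Bounds on the capacity\<close>

lemma const_C_mono:
  assumes "0 \<le> P" "P \<le> P'" "0 \<le> E" "E \<le> E'" "0 < F'" "F' \<le> F" "0 \<le> Prel" "0 \<le> \<sigma>2"
  shows "const_C P E F Prel \<sigma>2 \<le> const_C P' E' F' Prel \<sigma>2"
  unfolding const_C_def using assms
  by (intro real_sqrt_le_mono frac_le mult_mono mult_nonneg_nonneg add_mono add_pos_nonneg) auto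

lemma const_c_eq: "const_c P F Prel \<sigma>2 = const_C P 1 F Prel \<sigma>2"
  by (simp add: const_c_def const_C_def)

context relay_network
begin

context
  assumes Elo: "0 < Elo" and Plo: "0 < Plo" and Prel: "0 < Prel" and s2: "0 < \<sigma>2" and K: "1 \<le> K"
begin

definition E_mean :: "nat \<Rightarrow> real" where "E_mean k = (\<Sum>m = 1..M. E k m) / M"

lemma E_mean_bounds:
  assumes "1 \<le> M" "k \<in> {1..K}"
  shows "Elo \<le> E_mean k" "E_mean k \<le> Ehi"
proof -
  have "(\<Sum>m = 1..M. Elo) \<le> (\<Sum>m = 1..M. E k m)" "(\<Sum>m = 1..M. E k m) \<le> (\<Sum>m = 1..M. Ehi)"
    using E_bounds[OF assms(2)] by (intro sum_mono; simp)+
  then show "Elo \<le> E_mean k" "E_mean k \<le> Ehi"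
    using assms by (simp_all add: E_mean_def field_simps)
qed

text \<open>The factor \<open>sqrt (K * M)\<close> undoes the normalisation in \<open>d_P2\<close>
  and leaves the source average of the energies. Every coefficient thus becomes a
  \<open>const_C\<close> at intermediate energies, where monotonicity applies.\<close>

lemma sqrt_KM_d_P2:
  assumes "1 \<le> M" "k \<in> {1..K}"
  shows "sqrt (real K * real M) * d_P2 k * sqrt x = sqrt (x * Prel / (E_mean k + \<sigma>2))"
proof -
  have KM: "0 < real K * real M" using K assms by simp
  have pos: "0 < E_mean k + \<sigma>2" using E_mean_bounds[OF assms] Elo s2 by linarith
  have den: "real K * (\<Sum>m = 1..M. E k m) + real M * real K * \<sigma>2 = (real K * real M) * (E_mean k + \<sigma>2)"
    using assms by (simp add: E_mean_def field_simps)
  define a where "a = sqrt (real K * real M)"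
  have a: "a \<noteq> 0" using K assms(1) by (simp add: a_def)
  have "d_P2 k = sqrt Prel / (a * sqrt (E_mean k + \<sigma>2))"
  proof -
    have "0 < (real K * real M) * (E_mean k + \<sigma>2)" using KM pos by simp
    then have "d_P2 k = sqrt Prel / sqrt ((real K * real M) * (E_mean k + \<sigma>2))"
      unfolding d_P2_def den by (simp add: powr_minus powr_half_sqrt divide_simps)
    then show ?thesis unfolding a_def by (simp only: real_sqrt_mult)
  qed
  then show ?thesis
    unfolding a_def[symmetric] using a by (simp only: real_sqrt_mult real_sqrt_divide) simp
qed

lemma C_sig_bounds:
  assumes "m \<in> {1..M}" "i \<in> {1..M}" "k \<in> {1..K}"
  shows "const_C Plo Elo Ehi Prel \<sigma>2 \<le> C_sig m i k" "C_sig m i k \<le> const_C Phi Ehi Elo Prel \<sigma>2"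
proof -
  have M: "1 \<le> M" using assms by simp
  have eq: "C_sig m i k = const_C (P m k) (E k i) (E_mean k) Prel \<sigma>2"
    unfolding C_sig_def sqrt_KM_d_P2[OF M assms(3)] const_C_def by simp
  have b: "Elo \<le> E k i" "E k i \<le> Ehi" "Plo \<le> P m k" "P m k \<le> Phi"
    using E_bounds[OF assms(3,2)] P_bounds[OF assms(1,3)] by auto
  show "const_C Plo Elo Ehi Prel \<sigma>2 \<le> C_sig m i k" "C_sig m i k \<le> const_C Phi Ehi Elo Prel \<sigma>2"
    unfolding eq using b E_mean_bounds[OF M assms(3)] Elo Plo Prel s2 by (intro const_C_mono; linarith)+
qed

lemma C_noise_bounds:
  assumes "m \<in> {1..M}" "k \<in> {1..K}"
  shows "const_c Plo Ehi Prel \<sigma>2 \<le> C_noise m k" "C_noise m k \<le> const_c Phi Elo Prel \<sigma>2"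
proof -
  have M: "1 \<le> M" using assms by simp
  have eq: "C_noise m k = const_C (P m k) 1 (E_mean k) Prel \<sigma>2"
    unfolding C_noise_def sqrt_KM_d_P2[OF M assms(2)] const_C_def by simp
  have b: "Plo \<le> P m k" "P m k \<le> Phi"
    using P_bounds[OF assms(1,2)] by auto
  show "const_c Plo Ehi Prel \<sigma>2 \<le> C_noise m k" "C_noise m k \<le> const_c Phi Elo Prel \<sigma>2"
    unfolding eq const_c_eq using b E_mean_bounds[OF M assms(2)] Elo Plo Prel s2 by (intro const_C_mono; linarith)+
qed

lemma Phi_Ehi:
  assumes "m \<in> {1..M}"
  shows "Elo \<le> Ehi" "Plo \<le> Phi"
  using E_bounds[of 1 m] P_bounds[of m 1] assms K by auto

lemma const_pos:
  assumes "m \<in> {1..M}"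
  shows "0 < const_C Plo Elo Ehi Prel \<sigma>2" "0 < const_C Phi Ehi Elo Prel \<sigma>2"
    "0 < const_c Plo Ehi Prel \<sigma>2" "0 < const_c Phi Elo Prel \<sigma>2"
  using Phi_Ehi[OF assms] Elo Plo Prel s2 unfolding const_C_def const_c_def by auto

lemma average_square_bounds:
  fixes g :: "nat \<Rightarrow> real"
  assumes "0 < a" "\<And>k. k \<in> {1..K} \<Longrightarrow> a \<le> g k" "\<And>k. k \<in> {1..K} \<Longrightarrow> g k \<le> b"
  shows "a\<^sup>2 \<le> (\<Sum>k = 1..K. (g k)\<^sup>2) / K" "(\<Sum>k = 1..K. (g k)\<^sup>2) / K \<le> b\<^sup>2"
proof -
  have "a\<^sup>2 \<le> (g k)\<^sup>2 \<and> (g k)\<^sup>2 \<le> b\<^sup>2" if "k \<in> {1..K}" for k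
    using assms(1) assms(2,3)[OF that] by (auto intro!: power_mono)
  then have "(\<Sum>k = 1..K. a\<^sup>2) \<le> (\<Sum>k = 1..K. (g k)\<^sup>2)" "(\<Sum>k = 1..K. (g k)\<^sup>2) \<le> (\<Sum>k = 1..K. b\<^sup>2)"
    by (intro sum_mono; blast)+
  then show "a\<^sup>2 \<le> (\<Sum>k = 1..K. (g k)\<^sup>2) / K" "(\<Sum>k = 1..K. (g k)\<^sup>2) / K \<le> b\<^sup>2"
    using K by (simp_all add: field_simps)
qed

lemma average_C_sig:
  assumes "m \<in> {1..M}" "i \<in> {1..M}"
  shows "(const_C Plo Elo Ehi Prel \<sigma>2)\<^sup>2 \<le> (\<Sum>k = 1..K. (C_sig m i k)\<^sup>2) / K"
    "(\<Sum>k = 1..K. (C_sig m i k)\<^sup>2) / K \<le> (const_C Phi Ehi Elo Prel \<sigma>2)\<^sup>2"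
  by (rule average_square_bounds[OF const_pos(1)[OF assms(1)] C_sig_bounds[OF assms]]; assumption)+

lemma average_C_noise:
  assumes "m \<in> {1..M}"
  shows "(const_c Plo Ehi Prel \<sigma>2)\<^sup>2 \<le> (\<Sum>k = 1..K. (C_noise m k)\<^sup>2) / K"
    "(\<Sum>k = 1..K. (C_noise m k)\<^sup>2) / K \<le> (const_c Phi Elo Prel \<sigma>2)\<^sup>2"
  by (rule average_square_bounds[OF const_pos(3)[OF assms] C_noise_bounds[OF assms]]; assumption)+

lemma const_C_SN_square:
  assumes "0 < P'" "0 < E'" "0 < F'"
  shows "(const_C_SN P' E' F' Prel \<sigma>2)\<^sup>2 = (const_C P' E' F' Prel \<sigma>2)\<^sup>2 + \<sigma>2 * ((const_c P' F' Prel \<sigma>2)\<^sup>2 + 1)"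
  unfolding const_C_SN_def using s2 by (intro real_sqrt_pow2 add_nonneg_nonneg mult_nonneg_nonneg) auto

text \<open>The decoder uses the mean gain alone and sees the effective noise power
  \<open>N\<close>, which is compared with the constant of the claim at fixed \<open>M\<close> and
  \<open>K\<close>; no limit is taken.\<close>

theorem C_P2_ge:
  assumes m: "m \<in> {1..M}"
  shows "1 / 2 * log 2 (1 + pi\<^sup>2 / 16 * ((const_C Plo Elo Ehi Prel \<sigma>2)\<^sup>2 / (const_C_SN Phi Ehi Elo Prel \<sigma>2)\<^sup>2)
      * (real K / (real M)\<^sup>2)) \<le> C_P2 m"
proof -
  interpret G: network_gains M K m using m K by unfold_locales
  let ?c = "C_sig m" and ?e = "C_noise m"
  interpret C: gaussian_channel \<Omega> G.\<nu> gains "s m" "received m" "G.gain ?c m" "G.interference ?c ?e \<sigma>2" "1 / real M" \<sigma>2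
    by (rule gaussian_channel[OF m K s2])
  let ?lo = "const_C Plo Elo Ehi Prel \<sigma>2" and ?hi = "const_C Phi Ehi Elo Prel \<sigma>2" and ?chi = "const_c Phi Elo Prel \<sigma>2"
  let ?SN = "(const_C_SN Phi Ehi Elo Prel \<sigma>2)\<^sup>2"
  have M: "1 \<le> M" using m by simp
  have pos: "0 < real K" "0 < real M" using K M by auto
  note cp = const_pos[OF m]
  note ord = Phi_Ehi[OF m]
  have SN: "?SN = ?hi\<^sup>2 + \<sigma>2 * (?chi\<^sup>2 + 1)"
    using ord Elo Plo by (intro const_C_SN_square) auto
  define \<mu>r where "\<mu>r = pi / (4 * sqrt (real K * real M)) * (\<Sum>k = 1..K. ?c m k)"
  have mu: "of_real \<mu>r = G.expectation (G.gain ?c m)"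
    unfolding \<mu>r_def by (rule G.gain_mean[symmetric])
  define N where "N = G.expectation (G.interference ?c ?e \<sigma>2)
      + 1 / real M * G.expectation (\<lambda>x. (cmod (G.gain ?c m x - of_real \<mu>r))\<^sup>2)"
  have N_le: "N \<le> ?SN"
  proof -
    have "N \<le> G.mean_interference ?c ?e \<sigma>2 + 1 / real M * ((\<Sum>k = 1..K. (?c m k)\<^sup>2) / K)"
      unfolding N_def \<mu>r_def using s2
      by (intro add_mono mult_left_mono G.integrable_interference(2) G.gain_variance(2)) auto
    \<comment> \<open>The variance bound of the own gain has the size of one more interferer and
      fills the slot \<open>i = m\<close> that the interference leaves empty.\<close>
    also have "\<dots> = \<sigma>2 + (\<Sum>i = 1..M. ((\<Sum>k = 1..K. (?c i k)\<^sup>2) / K) / M) + (\<Sum>k = 1..K. (?e k)\<^sup>2) / K * \<sigma>2"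
      unfolding G.mean_interference_def using m by (subst (2) sum.remove[of _ m]) auto
    also have "\<dots> \<le> \<sigma>2 + (\<Sum>i = 1..M. ?hi\<^sup>2 / M) + ?chi\<^sup>2 * \<sigma>2"
      using s2 m by (intro add_mono sum_mono divide_right_mono mult_right_mono average_C_sig average_C_noise) auto
    also have "\<dots> = ?SN" using pos by (simp add: SN algebra_simps)
    finally show ?thesis .
  qed
  have N_pos: "0 < N"
  proof -
    have "0 < G.expectation (G.interference ?c ?e \<sigma>2)"
      using C.integrable_D C.D_pos by (intro G.expectation_greater) auto
    then show ?thesis unfolding N_def by (intro add_pos_nonneg) auto
  qed
  have mu_ge: "pi\<^sup>2 / 16 * ?lo\<^sup>2 * (real K / (real M)) \<le> (cmod (complex_of_real \<mu>r))\<^sup>2"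
  proof -
    have "real K * ?lo \<le> (\<Sum>k = 1..K. ?c m k)"
      using sum_mono[of "{1..K}" "\<lambda>k. ?lo" "\<lambda>k. ?c m k"] C_sig_bounds[OF m m] by simp
    then have "pi / (4 * sqrt (real K * real M)) * (real K * ?lo) \<le> \<mu>r"
      unfolding \<mu>r_def using pos by (intro mult_left_mono) auto
    then have "(pi / (4 * sqrt (real K * real M)) * (real K * ?lo))\<^sup>2 \<le> \<mu>r\<^sup>2"
      using cp pos by (intro power_mono) auto
    moreover have "(pi / (4 * sqrt (real K * real M)) * (real K * ?lo))\<^sup>2 = pi\<^sup>2 / 16 * ?lo\<^sup>2 * (real K / (real M))"
      using pos by (simp add: power_mult_distrib power_divide) (simp add: power2_eq_square)
    ultimately show ?thesis by simp
  qed
  have "pi\<^sup>2 / 16 * (?lo\<^sup>2 / ?SN) * (real K / (real M)\<^sup>2) = 1 / real M * (pi\<^sup>2 / 16 * ?lo\<^sup>2 * (real K / (real M))) / ?SN"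
    by (simp add: power2_eq_square)
  also have "\<dots> \<le> 1 / real M * (cmod (complex_of_real \<mu>r))\<^sup>2 / N"
    using mu_ge N_le N_pos by (intro frac_le mult_left_mono) auto
  finally have le: "1 + pi\<^sup>2 / 16 * (?lo\<^sup>2 / ?SN) * (real K / (real M)\<^sup>2) \<le> 1 + 1 / real M * (cmod (complex_of_real \<mu>r))\<^sup>2 / N"
    by simp
  have "0 \<le> pi\<^sup>2 / 16 * (?lo\<^sup>2 / ?SN) * (real K / (real M)\<^sup>2)" by simp
  then have "log 2 (1 + pi\<^sup>2 / 16 * (?lo\<^sup>2 / ?SN) * (real K / (real M)\<^sup>2)) \<le> log 2 (1 + 1 / real M * (cmod (complex_of_real \<mu>r))\<^sup>2 / N)"
    using le by (subst log_le_cancel_iff) linarith+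
  also have "\<dots> \<le> mutual_information 2 borel borel (received m) (s m)"
    unfolding N_def by (rule C.mutual_information_ge[OF mu])
  finally show ?thesis unfolding C_P2_def by simp
qed

text \<open>The free \<open>\<eta>\<close> weighs mean against fluctuation of the gain. The first
  summand carries the relative error \<open>\<kappa> / \<sigma>2\<close> of the inverse
  interference, the second is the price of the random part of the gain.\<close>

theorem C_P2_le:
  fixes \<eta> :: real
  assumes m: "m \<in> {1..M}" and M2: "2 \<le> M" and eta: "0 < \<eta>"
  defines "Chi \<equiv> const_C Phi Ehi Elo Prel \<sigma>2" and "chi \<equiv> const_c Phi Elo Prel \<sigma>2"
    and "S \<equiv> (const_C_SN Plo Elo Ehi Prel \<sigma>2)\<^sup>2"
  defines "\<kappa> \<equiv> (7 * Chi\<^sup>2 + 7 * chi\<^sup>2 * \<sigma>2) / sqrt K + 2 * Chi\<^sup>2 / sqrt M"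
  shows "C_P2 m \<le> 1 / 2 * log 2 (1 + 1 / real M * ((1 + \<eta>) * (pi\<^sup>2 / 16 * Chi\<^sup>2 * (real K / real M)) * ((1 + \<kappa> / \<sigma>2) / ((1 - 1 / M) * S))
      + (1 + 1 / \<eta>) * (Chi\<^sup>2 / \<sigma>2)))"
proof -
  interpret G: network_gains M K m using m K by unfold_locales
  let ?c = "C_sig m" and ?e = "C_noise m"
  interpret C: gaussian_channel \<Omega> G.\<nu> gains "s m" "received m" "G.gain ?c m" "G.interference ?c ?e \<sigma>2" "1 / real M" \<sigma>2
    by (rule gaussian_channel[OF m K s2])
  let ?lo = "const_C Plo Elo Ehi Prel \<sigma>2" and ?clo = "const_c Plo Ehi Prel \<sigma>2"
  let ?D = "G.interference ?c ?e \<sigma>2" and ?G = "G.gain ?c m"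
  define Db where "Db = G.mean_interference ?c ?e \<sigma>2"
  have M: "1 \<le> M" using m by simp
  have pos: "0 < real K" "0 < real M" using K M by auto
  note cp = const_pos[OF m]
  note ord = Phi_Ehi[OF m]
  have Chi: "0 < Chi" "0 < chi" unfolding Chi_def chi_def using cp by auto
  have S: "S = ?lo\<^sup>2 + \<sigma>2 * (?clo\<^sup>2 + 1)"
    unfolding S_def using ord Elo Plo by (intro const_C_SN_square) auto
  have S_pos: "0 < S" unfolding S using s2 cp by (intro add_pos_pos mult_pos_pos) auto
  have M1: "0 < 1 - 1 / real M" using M2 by simp
  \<comment> \<open>Only \<open>M - 1\<close> sources interfere, whence the factor
    \<open>1 - 1 / M\<close>; it is positive because \<open>M\<close> is at least 2.\<close>
  have Db_ge: "(1 - 1 / M) * S \<le> Db"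
  proof -
    have "(1 - 1 / M) * S = (1 - 1 / M) * ?lo\<^sup>2 + (1 - 1 / M) * (\<sigma>2 * (?clo\<^sup>2 + 1))" unfolding S by (rule distrib_left)
    also have "\<dots> \<le> (\<Sum>i\<in>{1..M} - {m}. ?lo\<^sup>2 / M) + \<sigma>2 * (?clo\<^sup>2 + 1)"
    proof (rule add_mono)
      have "card ({1..M} - {m}) = M - 1" using m by simp
      then show "(1 - 1 / M) * ?lo\<^sup>2 \<le> (\<Sum>i\<in>{1..M} - {m}. ?lo\<^sup>2 / M)" using M by (simp add: of_nat_diff field_simps)
      show "(1 - 1 / M) * (\<sigma>2 * (?clo\<^sup>2 + 1)) \<le> \<sigma>2 * (?clo\<^sup>2 + 1)"
        using M1 s2 pos by (intro mult_left_le_one_le mult_nonneg_nonneg) auto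
    qed
    also have "\<dots> = \<sigma>2 + ((\<Sum>i\<in>{1..M} - {m}. ?lo\<^sup>2 / M) + ?clo\<^sup>2 * \<sigma>2)" by (simp add: algebra_simps)
    also have "\<dots> \<le> Db"
      unfolding Db_def G.mean_interference_def using s2 m
      by (intro add_mono sum_mono divide_right_mono mult_right_mono order_refl average_C_sig average_C_noise) auto
    finally show ?thesis .
  qed
  have Db_pos: "0 < Db" using Db_ge M1 S_pos by (smt (verit) mult_pos_pos)
  have conc: "G.expectation (\<lambda>x. \<bar>?D x - Db\<bar>) \<le> \<kappa>"
    unfolding Db_def \<kappa>_def
  proof (rule G.interference_concentration[OF Chi(1) _ Chi(2)])
    show "\<bar>?c i k\<bar> \<le> Chi" if "i \<in> {1..M}" "k \<in> {1..K}" for i k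
      using C_sig_bounds[OF m that] cp unfolding Chi_def by auto
    show "\<bar>?e k\<bar> \<le> chi" if "k \<in> {1..K}" for k
      using C_noise_bounds[OF m that] cp unfolding chi_def by auto
  qed (use s2 in simp)
  have int_abs: "integrable G.\<nu> (\<lambda>x. \<bar>?D x - Db\<bar>)" using C.integrable_D by simp

  define \<mu> where "\<mu> = complex_of_real (pi / (4 * sqrt (real K * real M)) * (\<Sum>k = 1..K. ?c m k))"
  have mu_le: "(cmod \<mu>)\<^sup>2 \<le> pi\<^sup>2 / 16 * Chi\<^sup>2 * (real K / real M)"
  proof -
    let ?r = "pi / (4 * sqrt (real K * real M))"
    have le: "(\<Sum>k = 1..K. ?c m k) \<le> real K * Chi"
      using sum_mono[of "{1..K}" "\<lambda>k. ?c m k" "\<lambda>k. Chi"] C_sig_bounds[OF m m] unfolding Chi_def by simp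
    have nn: "0 \<le> (\<Sum>k = 1..K. ?c m k)"
      using C_sig_bounds(1)[OF m m] cp(1) by (intro sum_nonneg) (meson less_imp_le order_trans)
    have "(?r * (\<Sum>k = 1..K. ?c m k))\<^sup>2 \<le> (?r * (real K * Chi))\<^sup>2"
      using le nn pos by (intro power_mono mult_left_mono mult_nonneg_nonneg) auto
    moreover have "(?r * (real K * Chi))\<^sup>2 = pi\<^sup>2 / 16 * Chi\<^sup>2 * (real K / (real M))"
      using pos by (simp add: power_mult_distrib power_divide) (simp add: power2_eq_square)
    ultimately show ?thesis unfolding \<mu>_def norm_of_real power2_abs by simp
  qed
  have var: "integrable G.\<nu> (\<lambda>x. (cmod (?G x - \<mu>))\<^sup>2)" "G.expectation (\<lambda>x. (cmod (?G x - \<mu>))\<^sup>2) \<le> Chi\<^sup>2"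
  proof -
    show "integrable G.\<nu> (\<lambda>x. (cmod (?G x - \<mu>))\<^sup>2)" unfolding \<mu>_def by (rule G.gain_variance(1))
    have "(\<Sum>k = 1..K. (?c m k)\<^sup>2) / K \<le> Chi\<^sup>2"
      unfolding Chi_def by (rule average_C_sig[OF m m])
    then show "G.expectation (\<lambda>x. (cmod (?G x - \<mu>))\<^sup>2) \<le> Chi\<^sup>2"
      using G.gain_variance(2)[of ?c] unfolding \<mu>_def by linarith
  qed

  \<comment> \<open>A majorant without any quotient of two random quantities; its mean needs only
    the L1 deviation of the interference and the variance of the gain.\<close>
  let ?B = "\<lambda>x. (1 + \<eta>) * (cmod \<mu>)\<^sup>2 * (1 / Db + \<bar>?D x - Db\<bar> / (\<sigma>2 * Db)) + (1 + 1 / \<eta>) * ((cmod (?G x - \<mu>))\<^sup>2 / \<sigma>2)"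
  have pointwise: "(cmod (?G x))\<^sup>2 / ?D x \<le> ?B x" for x
  proof -
    have D: "0 < ?D x" "\<sigma>2 \<le> ?D x" by (rule C.D_pos, rule C.D_ge)
    have sq: "(cmod (?G x))\<^sup>2 \<le> (1 + \<eta>) * (cmod \<mu>)\<^sup>2 + (1 + 1 / \<eta>) * (cmod (?G x - \<mu>))\<^sup>2"
    proof -
      let ?a = "cmod \<mu>" and ?b = "cmod (?G x - \<mu>)"
      have "(cmod (?G x))\<^sup>2 \<le> (?a + ?b)\<^sup>2"
        using norm_triangle_ineq[of \<mu> "?G x - \<mu>"] by (intro power_mono) auto
      also have "\<dots> \<le> (1 + \<eta>) * ?a\<^sup>2 + (1 + 1 / \<eta>) * ?b\<^sup>2"
      proof -
        \<comment> \<open>The square behind Young's inequality with weight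
          \<open>\<eta>\<close>.\<close>
        have "0 \<le> (\<eta> * ?a - ?b)\<^sup>2 / \<eta>" using eta by simp
        also have "(\<eta> * ?a - ?b)\<^sup>2 / \<eta> = \<eta> * ?a\<^sup>2 + 1 / \<eta> * ?b\<^sup>2 - 2 * ?a * ?b"
          using eta by (simp add: power2_eq_square field_simps)
        finally show ?thesis by (simp add: power2_sum algebra_simps)
      qed
      finally show ?thesis .
    qed
    \<comment> \<open>The exact difference of inverses, with \<open>\<sigma>2\<close> in place of
      one factor \<open>?D x\<close>; the error stays relative to \<open>1 / Db\<close>.\<close>
    have inv: "1 / ?D x \<le> 1 / Db + \<bar>?D x - Db\<bar> / (\<sigma>2 * Db)"
    proof -
      have "1 / ?D x = 1 / Db + (Db - ?D x) / (?D x * Db)" using D Db_pos by (simp add: field_simps)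
      moreover have "(Db - ?D x) / (?D x * Db) \<le> \<bar>?D x - Db\<bar> / (\<sigma>2 * Db)"
        using D Db_pos s2 by (intro frac_le mult_right_mono) auto
      ultimately show ?thesis by linarith
    qed
    have "(cmod (?G x))\<^sup>2 / ?D x \<le> ((1 + \<eta>) * (cmod \<mu>)\<^sup>2 + (1 + 1 / \<eta>) * (cmod (?G x - \<mu>))\<^sup>2) / ?D x"
      using sq D by (intro divide_right_mono) auto
    also have "\<dots> = (1 + \<eta>) * (cmod \<mu>)\<^sup>2 * (1 / ?D x) + (1 + 1 / \<eta>) * ((cmod (?G x - \<mu>))\<^sup>2 / ?D x)"
      by (simp add: add_divide_distrib)
    also have "\<dots> \<le> ?B x"
      using inv eta D s2 by (intro add_mono mult_left_mono divide_left_mono mult_nonneg_nonneg) auto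
    finally show ?thesis .
  qed
  have int_B: "integrable G.\<nu> ?B" using int_abs var by simp
  have int_ratio: "integrable G.\<nu> (\<lambda>x. (cmod (?G x))\<^sup>2 / ?D x)"
  proof (rule Bochner_Integration.integrable_bound[OF int_B])
    show "(\<lambda>x. (cmod (?G x))\<^sup>2 / ?D x) \<in> borel_measurable G.\<nu>" by measurable
    have nonneg: "0 \<le> (cmod (?G x))\<^sup>2 / ?D x" for x using C.D_pos[of x] by simp
    have abs_le: "\<bar>u\<bar> \<le> \<bar>v\<bar>" if "0 \<le> u" "u \<le> v" for u v :: real using that by simp
    have "\<bar>(cmod (?G x))\<^sup>2 / ?D x\<bar> \<le> \<bar>?B x\<bar>" for x
      by (rule abs_le[OF nonneg pointwise])
    then show "AE x in G.\<nu>. norm ((cmod (?G x))\<^sup>2 / ?D x) \<le> norm (?B x)"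
      unfolding real_norm_def by (rule AE_I2)
  qed
  let ?X = "(1 + \<eta>) * (pi\<^sup>2 / 16 * Chi\<^sup>2 * (real K / real M)) * ((1 + \<kappa> / \<sigma>2) / ((1 - 1 / M) * S)) + (1 + 1 / \<eta>) * (Chi\<^sup>2 / \<sigma>2)"
  have kappa: "0 \<le> \<kappa>" unfolding \<kappa>_def using s2 by simp
  have E_ratio: "G.expectation (\<lambda>x. (cmod (?G x))\<^sup>2 / ?D x) \<le> ?X"
  proof -
    have "G.expectation (\<lambda>x. (cmod (?G x))\<^sup>2 / ?D x) \<le> G.expectation ?B"
      using int_ratio int_B pointwise by (intro integral_mono) auto
    also have "\<dots> = (1 + \<eta>) * (cmod \<mu>)\<^sup>2 * (1 / Db + G.expectation (\<lambda>x. \<bar>?D x - Db\<bar>) / (\<sigma>2 * Db))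
        + (1 + 1 / \<eta>) * (G.expectation (\<lambda>x. (cmod (?G x - \<mu>))\<^sup>2) / \<sigma>2)"
      using int_abs var by (simp add: G.prob_space)
    also have "\<dots> \<le> (1 + \<eta>) * (cmod \<mu>)\<^sup>2 * (1 / Db + \<kappa> / (\<sigma>2 * Db)) + (1 + 1 / \<eta>) * (Chi\<^sup>2 / \<sigma>2)"
      using conc var(2) eta s2 Db_pos
      by (intro add_mono mult_left_mono divide_right_mono mult_nonneg_nonneg order_refl) auto
    also have "1 / Db + \<kappa> / (\<sigma>2 * Db) = (1 + \<kappa> / \<sigma>2) / Db" using s2 Db_pos by (simp add: field_simps)
    also have "(1 + \<eta>) * (cmod \<mu>)\<^sup>2 * ((1 + \<kappa> / \<sigma>2) / Db) \<le> (1 + \<eta>) * (pi\<^sup>2 / 16 * Chi\<^sup>2 * (real K / real M)) * ((1 + \<kappa> / \<sigma>2) / ((1 - 1 / M) * S))"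
      using mu_le eta kappa s2 Db_ge M1 S_pos pos Db_pos
      by (intro mult_mono mult_left_mono frac_le mult_nonneg_nonneg add_nonneg_nonneg divide_nonneg_nonneg mult_pos_pos) auto
    finally show ?thesis by simp
  qed
  define r where "r x = (cmod (?G x))\<^sup>2 / ?D x" for x
  have r: "integrable G.\<nu> r" "G.expectation r \<le> ?X" "\<And>x. 0 \<le> r x"
    unfolding r_def[abs_def] using int_ratio E_ratio C.D_pos by (auto simp: less_imp_le)
  have r_eq: "1 + 1 / real M * (cmod (?G x))\<^sup>2 / ?D x = 1 + r x / M" for x
    by (simp add: r_def)
  have "mutual_information 2 borel borel (received m) (s m) \<le> G.expectation (\<lambda>x. log 2 (1 + r x / M))"
    using C.mutual_information_le unfolding r_eq .
  also have "\<dots> = G.expectation (\<lambda>x. ln (1 + r x / M)) / ln 2"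
    by (simp add: log_def)
  \<comment> \<open>Jensen, after which only the mean of the ratio \<open>r\<close> matters.\<close>
  also have "\<dots> \<le> ln (G.expectation (\<lambda>x. 1 + r x / M)) / ln 2"
    using r(1,3) C.integrable_ln_sinr[unfolded r_eq]
    by (intro divide_right_mono G.expectation_ln_le) (auto intro!: add_pos_nonneg)
  also have "G.expectation (\<lambda>x. 1 + r x / M) = 1 + G.expectation r / M"
    using r(1) by (simp add: G.prob_space)
  also have "ln (1 + G.expectation r / M) / ln 2 \<le> log 2 (1 + 1 / real M * ?X)"
  proof -
    have "0 \<le> G.expectation r" using r(3) by simp
    then have "0 < 1 + G.expectation r / M" by (intro add_pos_nonneg) auto
    moreover have "1 + G.expectation r / M \<le> 1 + 1 / real M * ?X"
      using divide_right_mono[OF r(2), of "real M"] by simp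
    ultimately show ?thesis unfolding log_def by (intro divide_right_mono ln_mono) auto
  qed
  finally show ?thesis unfolding C_P2_def by simp
qed

end

end

text \<open>The first summand carries the capacity, the second is absorbed by \<open>M powr \<delta>\<close>.\<close>

lemma eventually_bound:
  fixes \<epsilon> \<delta> \<sigma>2 A B S Ci :: real
  assumes eps: "0 < \<epsilon>" and delta: "0 < \<delta>" and pos: "0 < \<sigma>2" "0 < A" "0 < B" "0 < S" "0 < Ci"
  defines "\<eta> \<equiv> \<epsilon> / 4"
  shows "\<exists>N0\<ge>2. \<forall>M\<ge>N0. \<forall>K\<ge>N0.
    1 / real M * ((1 + \<eta>) * (pi\<^sup>2 / 16 * Ci * (real K / real M)) * ((1 + (A / sqrt K + B / sqrt M) / \<sigma>2) / ((1 - 1 / M) * S)) + (1 + 1 / \<eta>) * (Ci / \<sigma>2))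
    \<le> pi\<^sup>2 / 16 * (Ci / S) * (max (real K) (real M powr (1 + \<delta>)) / (real M)\<^sup>2) * (1 + \<epsilon>)"
proof -
  have eta: "0 < \<eta>" using eps by (simp add: \<eta>_def)
  \<comment> \<open>\<open>\<epsilon>\<close> is halved between the two summands. With
    \<open>\<eta> = \<epsilon> / 4\<close> the first half leaves room for a factor
    \<open>\<rho> > 1\<close>.\<close>
  define \<rho> where "\<rho> = (1 + \<epsilon> / 2) / (1 + \<eta>)"
  have rho: "1 < \<rho>" "(1 + \<eta>) * \<rho> = 1 + \<epsilon> / 2" using eps by (auto simp: \<rho>_def \<eta>_def field_simps)
  \<comment> \<open>Solves \<open>(1 + 2 * \<theta>) / (1 - \<theta>) = \<rho>\<close>: the two
    error terms in the numerator and \<open>1 / M\<close> in the denominator are allowed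
    \<open>\<theta>\<close> each.\<close>
  define \<theta> where "\<theta> = (\<rho> - 1) / (\<rho> + 2)"
  have theta: "0 < \<theta>" "\<theta> < 1" using rho by (auto simp: \<theta>_def field_simps)
  have theta_rho: "(1 + 2 * \<theta>) / (1 - \<theta>) = \<rho>" using rho by (simp add: \<theta>_def field_simps)
  \<comment> \<open>Chosen so that \<open>\<epsilon> / 2 * (b * M)\<close>, times the leading
    constant over \<open>M^2\<close>, equals the second summand. The second half of
    \<open>\<epsilon>\<close> pays for it once \<open>M powr \<delta>\<close> exceeds
    \<open>b\<close>.\<close>
  define b where "b = (1 + 1 / \<eta>) * (16 / pi\<^sup>2) * (S / \<sigma>2) * (2 / \<epsilon>)"
  have b: "0 < b" unfolding b_def using eta eps pos by (intro mult_pos_pos add_pos_pos) auto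
  obtain N1 :: nat where N1: "max (max ((A / (\<sigma>2 * \<theta>))\<^sup>2) ((B / (\<sigma>2 * \<theta>))\<^sup>2)) (max (1 / \<theta>) (b powr (1 / \<delta>))) < real N1"
    using reals_Archimedean2 by blast
  have small: "x / sqrt n / \<sigma>2 \<le> \<theta>" if n: "(x / (\<sigma>2 * \<theta>))\<^sup>2 < real n" and x: "0 < x" for x and n :: nat
  proof -
    have "0 < x / (\<sigma>2 * \<theta>)" using x pos theta by simp
    then have "x / (\<sigma>2 * \<theta>) \<le> sqrt n" using n by (intro real_le_rsqrt) simp
    moreover have "0 < real n" using n by (smt (verit) zero_le_power2)
    ultimately show ?thesis using pos theta by (simp add: field_simps)
  qed
  show ?thesis
  proof (intro exI[of _ "max 2 N1"] conjI allI impI)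
    fix M K :: nat assume MK: "max 2 N1 \<le> M" "max 2 N1 \<le> K"
    have Mpos: "0 < real M" "2 \<le> M" using MK by auto
    have big: "(A / (\<sigma>2 * \<theta>))\<^sup>2 < real K" "(B / (\<sigma>2 * \<theta>))\<^sup>2 < real M" "1 / \<theta> < real M" "b powr (1 / \<delta>) < real M"
      using N1 MK by auto
    let ?k = "(A / sqrt K + B / sqrt M) / \<sigma>2" and ?L = "max (real K) (real M powr (1 + \<delta>))"
    let ?c = "pi\<^sup>2 / 16 * (Ci / S) / (real M)\<^sup>2"
    have c: "0 < ?c" using pos Mpos by simp
    have k: "?k \<le> 2 * \<theta>" "0 \<le> ?k"
      using small[OF big(1) pos(2)] small[OF big(2) pos(3)] pos by (auto simp: add_divide_distrib)
    have M1: "1 - \<theta> \<le> 1 - 1 / M" using big(3) theta Mpos by (simp add: field_simps)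
    have "(1 + ?k) / (1 - 1 / M) \<le> (1 + 2 * \<theta>) / (1 - \<theta>)"
      using k M1 theta by (intro frac_le) auto
    then have "(1 + \<eta>) * ((1 + ?k) / (1 - 1 / M)) \<le> (1 + \<eta>) * \<rho>"
      unfolding theta_rho using eta by (intro mult_left_mono) auto
    then have "(1 + \<eta>) * ((1 + ?k) / (1 - 1 / M)) * real K \<le> (1 + \<epsilon> / 2) * ?L"
      unfolding rho(2) using eps by (intro mult_mono) auto
    then have first: "?c * ((1 + \<eta>) * ((1 + ?k) / (1 - 1 / M)) * real K) \<le> ?c * ((1 + \<epsilon> / 2) * ?L)"
      using c by (intro mult_left_mono) auto
    have "b \<le> real M powr \<delta>"
    proof -
      have "b = (b powr (1 / \<delta>)) powr \<delta>" using b delta by (simp add: powr_powr)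
      also have "\<dots> \<le> real M powr \<delta>" using big(4) delta by (intro powr_mono2) auto
      finally show ?thesis .
    qed
    then have "b * real M \<le> real M powr \<delta> * real M" using Mpos by (intro mult_right_mono) auto
    also have "\<dots> = real M powr (1 + \<delta>)" using Mpos by (simp add: powr_add)
    also have "\<dots> \<le> ?L" by simp
    finally have "?c * (\<epsilon> / 2 * (b * real M)) \<le> ?c * (\<epsilon> / 2 * ?L)"
      using c eps by (intro mult_left_mono) auto
    moreover have "?c * (\<epsilon> / 2 * (b * real M)) = 1 / real M * ((1 + 1 / \<eta>) * (Ci / \<sigma>2))"
    proof -
      have e: "\<epsilon> / 2 * b = (1 + 1 / \<eta>) * (16 / pi\<^sup>2) * (S / \<sigma>2)"
        using eps by (simp add: b_def)
      have "?c * (\<epsilon> / 2 * (b * real M)) = ?c * (\<epsilon> / 2 * b) * real M" by simp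
      also have "\<dots> = 1 / real M * ((1 + 1 / \<eta>) * (Ci / \<sigma>2))"
        unfolding e using pos Mpos eta by (simp add: power2_eq_square field_simps)
      finally show ?thesis .
    qed
    moreover have "1 / real M * ((1 + \<eta>) * (pi\<^sup>2 / 16 * Ci * (real K / real M)) * ((1 + ?k) / ((1 - 1 / M) * S)))
        = ?c * ((1 + \<eta>) * ((1 + ?k) / (1 - 1 / M)) * real K)"
      by (simp add: power2_eq_square mult_ac)
    ultimately have "1 / real M * ((1 + \<eta>) * (pi\<^sup>2 / 16 * Ci * (real K / real M)) * ((1 + ?k) / ((1 - 1 / M) * S)) + (1 + 1 / \<eta>) * (Ci / \<sigma>2))
       \<le> ?c * ((1 + \<epsilon> / 2) * ?L) + ?c * (\<epsilon> / 2 * ?L)"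
      using first unfolding distrib_left[of "1 / real M"] by linarith
    also have "\<dots> = ?c * ?L * (1 + \<epsilon>)"
    proof -
      have "u * ((1 + \<epsilon> / 2) * v) + u * (\<epsilon> / 2 * v) = u * v * (1 + \<epsilon>)" for u v :: real
        by (simp add: algebra_simps)
      then show ?thesis .
    qed
    also have "\<dots> = pi\<^sup>2 / 16 * (Ci / S) * (?L / (real M)\<^sup>2) * (1 + \<epsilon>)" by simp
    finally show "1 / real M * ((1 + \<eta>) * (pi\<^sup>2 / 16 * Ci * (real K / real M)) * ((1 + ?k) / ((1 - 1 / M) * S)) + (1 + 1 / \<eta>) * (Ci / \<sigma>2))
      \<le> pi\<^sup>2 / 16 * (Ci / S) * (?L / (real M)\<^sup>2) * (1 + \<epsilon>)" .
  qed simp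
qed

text \<open>For \<open>\<epsilon> > 1\<close> the argument of the lower logarithm can fail to be
  positive; the bound is asserted where that logarithm is defined. One threshold serves as both
  \<open>M0\<close> and \<open>K0\<close>.\<close>

theorem theorem4:
  fixes Elo Ehi Plo Phi Prel \<sigma>2 :: real
    and \<Omega> :: "nat \<Rightarrow> nat \<Rightarrow> 'a measure"
    and E P :: "nat \<Rightarrow> nat \<Rightarrow> nat \<Rightarrow> nat \<Rightarrow> real"
    and h f :: "nat \<Rightarrow> nat \<Rightarrow> nat \<Rightarrow> nat \<Rightarrow> 'a \<Rightarrow> complex"
    and s z w :: "nat \<Rightarrow> nat \<Rightarrow> nat \<Rightarrow> 'a \<Rightarrow> complex"
    and \<epsilon> \<delta> :: real
  assumes "0 < Elo" "Elo \<le> Ehi" "0 < Plo" "Plo \<le> Phi" "0 < Prel" "0 < \<sigma>2"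
    and "\<And>M K. 1 \<le> M \<Longrightarrow> 1 \<le> K \<Longrightarrow>
           relay_network (\<Omega> M K) M K Elo Ehi Plo Phi \<sigma>2 (E M K) (P M K)
             (h M K) (f M K) (s M K) (z M K) (w M K)"
    and "0 < \<epsilon>" "0 < \<delta>"
  shows "\<exists>M0 > 0. \<exists>K0 > 0. \<forall>M \<ge> M0. \<forall>K \<ge> K0. \<forall>m \<in> {1..M}.
    (let
       capacity = relay_network.C_P2 (\<Omega> M K) M K Prel \<sigma>2 (E M K) (P M K)
         (h M K) (f M K) (s M K) (z M K) (w M K) m;
       lower_arg = 1 + pi\<^sup>2 / 16 *
         ((const_C Plo Elo Ehi Prel \<sigma>2)\<^sup>2 / (const_C_SN Phi Ehi Elo Prel \<sigma>2)\<^sup>2) *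
         (real K / (real M)\<^sup>2) * (1 - \<epsilon>);
       upper_arg = 1 + pi\<^sup>2 / 16 *
         ((const_C Phi Ehi Elo Prel \<sigma>2)\<^sup>2 / (const_C_SN Plo Elo Ehi Prel \<sigma>2)\<^sup>2) *
         (max (real K) (real M powr (1 + \<delta>)) / (real M)\<^sup>2) * (1 + \<epsilon>)
     in (0 < lower_arg \<longrightarrow> 1 / 2 * log 2 lower_arg \<le> capacity) \<and>
        capacity \<le> 1 / 2 * log 2 upper_arg)"
proof -
  let ?Chi = "const_C Phi Ehi Elo Prel \<sigma>2" and ?chi = "const_c Phi Elo Prel \<sigma>2"
  let ?S = "(const_C_SN Plo Elo Ehi Prel \<sigma>2)\<^sup>2"
  have Chi: "0 < ?Chi" using assms(1-6) unfolding const_C_def by auto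
  have S: "0 < ?S"
  proof -
    have "0 < const_C_SN Plo Elo Ehi Prel \<sigma>2"
      unfolding const_C_SN_def using assms(6) by (intro real_sqrt_gt_zero add_nonneg_pos mult_pos_pos add_nonneg_pos) auto
    then show ?thesis by simp
  qed
  have "0 < 7 * ?Chi\<^sup>2 + 7 * ?chi\<^sup>2 * \<sigma>2" using Chi assms(6) by (intro add_pos_nonneg) auto
  from eventually_bound[OF assms(8,9,6) this _ S, of "2 * ?Chi\<^sup>2" "?Chi\<^sup>2"] Chi
  obtain N0 where N0: "2 \<le> N0" and upper: "\<And>M K. N0 \<le> M \<Longrightarrow> N0 \<le> K \<Longrightarrow>
    1 / real M * ((1 + \<epsilon> / 4) * (pi\<^sup>2 / 16 * ?Chi\<^sup>2 * (real K / real M)) *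
      ((1 + ((7 * ?Chi\<^sup>2 + 7 * ?chi\<^sup>2 * \<sigma>2) / sqrt K + 2 * ?Chi\<^sup>2 / sqrt M) / \<sigma>2) / ((1 - 1 / M) * ?S)) + (1 + 1 / (\<epsilon> / 4)) * (?Chi\<^sup>2 / \<sigma>2))
    \<le> pi\<^sup>2 / 16 * (?Chi\<^sup>2 / ?S) * (max (real K) (real M powr (1 + \<delta>)) / (real M)\<^sup>2) * (1 + \<epsilon>)"
    by auto
  have "0 < N0" using N0 by simp
  let ?l = "\<lambda>M K. pi\<^sup>2 / 16 * ((const_C Plo Elo Ehi Prel \<sigma>2)\<^sup>2 / (const_C_SN Phi Ehi Elo Prel \<sigma>2)\<^sup>2) * (real K / (real M)\<^sup>2)"
  let ?u = "\<lambda>M K. pi\<^sup>2 / 16 * (?Chi\<^sup>2 / ?S) * (max (real K) (real M powr (1 + \<delta>)) / (real M)\<^sup>2) * (1 + \<epsilon>)"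
  let ?C = "\<lambda>M K m. relay_network.C_P2 (\<Omega> M K) M K Prel \<sigma>2 (E M K) (P M K) (h M K) (f M K) (s M K) (z M K) (w M K) m"
  have main: "(0 < 1 + ?l M K * (1 - \<epsilon>) \<longrightarrow> 1 / 2 * log 2 (1 + ?l M K * (1 - \<epsilon>)) \<le> ?C M K m) \<and> ?C M K m \<le> 1 / 2 * log 2 (1 + ?u M K)"
    if MK: "N0 \<le> M" "N0 \<le> K" and m: "m \<in> {1..M}" for M K m
  proof -
    have K: "1 \<le> K" and M: "1 \<le> M" "2 \<le> M" using MK N0 by auto
    interpret R: relay_network "\<Omega> M K" M K Elo Ehi Plo Phi Prel \<sigma>2 "E M K" "P M K" "h M K" "f M K" "s M K" "z M K" "w M K"
      by (rule assms(7)[OF M(1) K])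
    let ?X = "1 / real M * ((1 + \<epsilon> / 4) * (pi\<^sup>2 / 16 * ?Chi\<^sup>2 * (real K / real M)) *
      ((1 + ((7 * ?Chi\<^sup>2 + 7 * ?chi\<^sup>2 * \<sigma>2) / sqrt K + 2 * ?Chi\<^sup>2 / sqrt M) / \<sigma>2) / ((1 - 1 / M) * ?S)) + (1 + 1 / (\<epsilon> / 4)) * (?Chi\<^sup>2 / \<sigma>2))"
    have lower: "1 / 2 * log 2 (1 + ?l M K * (1 - \<epsilon>)) \<le> R.C_P2 m" if "0 < 1 + ?l M K * (1 - \<epsilon>)"
    proof -
      \<comment> \<open>The lower bound was proved without loss. The factor
        \<open>1 - \<epsilon>\<close> only weakens it, and positivity of the argument gives
        monotonicity of the logarithm.\<close>
      have "?l M K * (1 - \<epsilon>) \<le> ?l M K * 1" using assms(8) by (intro mult_left_mono) auto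
      then have "log 2 (1 + ?l M K * (1 - \<epsilon>)) \<le> log 2 (1 + ?l M K)"
        using that by (subst log_le_cancel_iff) auto
      also have "1 / 2 * log 2 (1 + ?l M K) \<le> R.C_P2 m"
        by (rule R.C_P2_ge[OF assms(1,3,5,6) K m])
      finally show ?thesis by simp
    qed
    have "R.C_P2 m \<le> 1 / 2 * log 2 (1 + ?X)"
      using assms(8) by (intro R.C_P2_le[OF assms(1,3,5,6) K m M(2)]) simp
    also have "\<dots> \<le> 1 / 2 * log 2 (1 + ?u M K)"
    proof -
      have "0 \<le> ?X" using assms(6,8) M S
        by (intro mult_nonneg_nonneg add_nonneg_nonneg divide_nonneg_nonneg) auto
      then show ?thesis using upper[OF MK] by (intro mult_left_mono, subst log_le_cancel_iff) auto
    qed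
    finally show ?thesis using lower by blast
  qed
  show ?thesis
    unfolding Let_def using main \<open>0 < N0\<close> by blast
qed

end
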